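(* Let $\mathbf n=(n_1,\dots,n_r)\in(\frac12\mathbb N)^r$ with $n=\sum_in_i\in\mathbb N$, and $\mathbf p\in\mathbb C^r$ with the $[p_i]\in E_\tau$ pairwise distinct. The Hilbert quasi-polynomial of $\overline V_{\mathbf n,\mathbf p}(\tau)$ is $$\chi_{\overline V_{\mathbf n,\mathbf p}(\tau)}(m)=\frac{m-n+1}2F(\mathbf n)+\frac14\Big(\prod_{i=1}^r(2n_i+1)+(-1)^m\delta_{\mathbf n,\mathbb N^r}\Big),$$ where $\delta_{\mathbf n,\mathbb N^r}=1$ if $\mathbf n\in\mathbb N^r$ and $0$ otherwise.
   Context: $\mathbb N=\{1,2,\dots\}$. $\Im\tau>0$, $\Lambda_\tau=\mathbb Z+\mathbb Z\tau$, $E_\tau=\mathbb C/\Lambda_\tau$; $\wp,\zeta$ are the Weierstrass functions of $\Lambda_\tau$. $F(\mathbf n)$ is the number of $(k_1,\dots,k_r)\in\mathbb Z_{\ge0}^r$ with $\sum k_i=n$ and $k_i\le2n_i$ for all $i$. Consider $w''=Qw$ with $Q(z)=\sum_in_i(n_i+1)\wp(z-p_i)+\sum_iA_i\zeta(z-p_i)+B$. For each $i$ put $\ell_i=2n_i$ and expand $Q(z)=\sum_{s\ge-2}q_s(z-p_i)^s$ at $p_i$ (so $q_{-1}=A_i$ and each $q_s$ is a polynomial in $(\mathbf A,B)$). Set $c_0=1$, $c_k=\frac1{k(k-1-\ell_i)}\sum_{s=-1}^{k-2}q_sc_{k-2-s}$ for $1\le k\le\ell_i$, and $F_{\ell_i}(\mathbf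 A,B)=\sum_{s=-1}^{\ell_i-1}q_sc_{\ell_i-1-s}$ (its vanishing means no logarithmic solution at $p_i$). The log-free variety is the affine scheme $V_{\mathbf n,\mathbf p}(\tau)=\{(\mathbf A,B)\in\mathbb C^{r+1}:F_{\ell_i}(\mathbf A,B)=0\ (i=1,\dots,r),\ \sum_iA_i=0\}$; with $\deg A_i=1$, $\deg B=2$, $\overline V_{\mathbf n,\mathbf p}(\tau)$ is its compactification (closure) in the weighted projective stack $\mathbb P(1^{r+1},2)$ with coordinates $[A_0:A_1:\dots:A_r:B]$ and affine chart $A_0=1$. The Hilbert quasi-polynomial is the quasi-polynomial in $m$ equal, for $m\gg0$, to the dimension of the degree-$m$ piece of the homogeneous coordinate ring (with $\deg B=2$, other variables degree $1$). *)

theory Defs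
  imports
    "HOL-Complex_Analysis.Complex_Analysis"
    "HOL-Algebra.Algebraic_Closure_Type"
    "HOL-Algebra.QuotRing"
    "HOL-Algebra.Embedded_Algebras"
    "HOL-Library.Poly_Mapping"
begin

section \<open>Weierstrass functions\<close>

definition lattice :: "complex \<Rightarrow> complex set" where
  "lattice \<tau> = {of_int a + of_int b * \<tau> | a b :: int. True}"

text \<open>The values at lattice points are artefacts of division by zero; only
  the values off the lattice matter for Laurent expansions.\<close>

definition wp :: "complex \<Rightarrow> complex \<Rightarrow> complex" where
  "wp \<tau> z = 1 / z ^ 2 + (\<Sum>\<^sub>\<infinity>\<omega>\<in>lattice \<tau> - {0}. 1 / (z - \<omega>) ^ 2 - 1 / \<omega> ^ 2)"

definition wzeta :: "complex \<Rightarrow> complex \<Rightarrow> complex" where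
  "wzeta \<tau> z = 1 / z + (\<Sum>\<^sub>\<infinity>\<omega>\<in>lattice \<tau> - {0}. 1 / (z - \<omega>) + 1 / \<omega> + z / \<omega> ^ 2)"

lemma lattice_coord_bound:
  assumes "Im \<tau> > 0"
  obtains K where "K \<ge> 1"
    "\<And>a b :: int. \<bar>real_of_int a\<bar> \<le> K * norm (of_int a + of_int b * \<tau>)"
    "\<And>a b :: int. \<bar>real_of_int b\<bar> \<le> K * norm (of_int a + of_int b * \<tau>)"
proof
  define K where "K = 1 + norm \<tau> / Im \<tau> + 1 / Im \<tau>"
  show "K \<ge> 1" using assms by (simp add: K_def)
  have b: "\<bar>real_of_int b\<bar> \<le> norm (of_int a + of_int b * \<tau>) / Im \<tau>" for a b :: int
  proof -
    have "\<bar>real_of_int b * Im \<tau>\<bar> \<le> norm (of_int a + of_int b * \<tau>)"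
      using abs_Im_le_cmod[of "of_int a + of_int b * \<tau>"] by simp
    then show ?thesis using assms by (simp add: abs_mult field_simps)
  qed
  show "\<bar>real_of_int b\<bar> \<le> K * norm (of_int a + of_int b * \<tau>)" for a b :: int
  proof -
    have "0 \<le> (1 + norm \<tau> / Im \<tau>) * norm (of_int a + of_int b * \<tau>)"
      using assms by (intro mult_nonneg_nonneg add_nonneg_nonneg) auto
    with b[of b a] show ?thesis by (simp add: K_def algebra_simps)
  qed
  show "\<bar>real_of_int a\<bar> \<le> K * norm (of_int a + of_int b * \<tau>)" for a b :: int
  proof -
    let ?w = "of_int a + of_int b * \<tau>"
    have "\<bar>real_of_int a\<bar> = norm (?w - of_int b * \<tau>)" by simp
    also have "\<dots> \<le> norm ?w + \<bar>real_of_int b\<bar> * norm \<tau>"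
      by (metis norm_mult norm_of_int norm_triangle_ineq4)
    also have "\<dots> \<le> norm ?w + norm ?w / Im \<tau> * norm \<tau>"
      using b[of b a] by (intro add_left_mono mult_right_mono) auto
    also have "\<dots> \<le> K * norm ?w"
    proof -
      have "0 \<le> norm ?w / Im \<tau>" using assms by auto
      then show ?thesis by (simp add: K_def algebra_simps)
    qed
    finally show ?thesis .
  qed
qed

lemma finite_lattice_bounded:
  assumes "Im \<tau> > 0"
  shows "finite {\<omega>\<in>lattice \<tau>. norm \<omega> \<le> R}"
proof -
  obtain K where K: "K \<ge> 1"
    "\<And>a b :: int. \<bar>real_of_int a\<bar> \<le> K * norm (of_int a + of_int b * \<tau>)"
    "\<And>a b :: int. \<bar>real_of_int b\<bar> \<le> K * norm (of_int a + of_int b * \<tau>)"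
    using lattice_coord_bound[OF assms] by blast
  define N where "N = \<lceil>K * R\<rceil>"
  have "{\<omega>\<in>lattice \<tau>. norm \<omega> \<le> R} \<subseteq> (\<lambda>(a, b). of_int a + of_int b * \<tau>) ` ({-N..N} \<times> {-N..N})"
  proof
    fix \<omega> assume "\<omega> \<in> {\<omega>\<in>lattice \<tau>. norm \<omega> \<le> R}"
    then obtain a b :: int where ab: "\<omega> = of_int a + of_int b * \<tau>" "norm \<omega> \<le> R"
      by (auto simp: lattice_def)
    have *: "K * norm \<omega> \<le> K * R" using ab K(1) by (intro mult_left_mono) auto
    have "\<bar>real_of_int a\<bar> \<le> K * R" "\<bar>real_of_int b\<bar> \<le> K * R"
      using K(2)[of a b] K(3)[of b a] * ab(1) by auto
    then have "a \<in> {-N..N}" "b \<in> {-N..N}" unfolding N_def by (auto; linarith)+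
    then show "\<omega> \<in> (\<lambda>(a, b). of_int a + of_int b * \<tau>) ` ({-N..N} \<times> {-N..N})"
      using ab(1) by (auto intro!: image_eqI[of _ _ "(a, b)"])
  qed
  then show ?thesis by (rule finite_subset) auto
qed

lemma int_powr_summable: "(\<lambda>a::int. (1 + \<bar>real_of_int a\<bar>) powr (-3/2)) summable_on UNIV"
proof -
  let ?u = "\<lambda>a::int. (1 + \<bar>real_of_int a\<bar>) powr (-3/2)"
  have s: "summable (\<lambda>k. real (k + j) powr (-3/2))" for j
    using summable_ignore_initial_segment[of "\<lambda>k. real k powr (-3/2)" j]
    by (simp add: summable_real_powr_iff)
  have "(?u \<circ> int) summable_on UNIV"
    using s[of 1] by (subst summable_on_UNIV_nonneg_real_iff) (auto simp: o_def add_ac)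
  then have 1: "?u summable_on range int" by (subst summable_on_reindex) auto
  have "(?u \<circ> (\<lambda>k. - int k - 1)) summable_on UNIV"
    using s[of 2] by (subst summable_on_UNIV_nonneg_real_iff) (auto simp: o_def add_ac)
  then have 2: "?u summable_on range (\<lambda>k. - int k - 1)"
    by (subst summable_on_reindex) (auto simp: inj_on_def)
  have "a \<in> range int \<union> range (\<lambda>k. - int k - 1)" for a
  proof (cases "a \<ge> 0")
    case True
    then have "a = int (nat a)" by simp
    then show ?thesis by blast
  next
    case False
    then have "a = - int (nat (- a - 1)) - 1" by simp
    then show ?thesis by blast
  qed
  then have U: "UNIV = range int \<union> range (\<lambda>k. - int k - 1)" by blast
  show ?thesis unfolding U by (intro summable_on_Un_disjoint 1 2) auto
qed

lemma lattice_summable: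
  assumes "Im \<tau> > 0"
  shows "(\<lambda>\<omega>. 1 / norm \<omega> ^ 3) summable_on (lattice \<tau> - {0})"
proof -
  let ?u = "\<lambda>a::int. (1 + \<bar>real_of_int a\<bar>) powr (-3/2)"
  let ?h = "\<lambda>(a, b). of_int a + of_int b * \<tau> :: complex"
  obtain K where K: "K \<ge> 1"
    "\<And>a b :: int. \<bar>real_of_int a\<bar> \<le> K * norm (of_int a + of_int b * \<tau>)"
    "\<And>a b :: int. \<bar>real_of_int b\<bar> \<le> K * norm (of_int a + of_int b * \<tau>)"
    using lattice_coord_bound[OF assms] by blast
  have "(\<lambda>(a, b). ?u a * ?u b) summable_on (UNIV \<times> UNIV)"
    using int_powr_summable
    by (intro summable_on_SigmaI[where g = "\<lambda>a. ?u a * infsum ?u UNIV"])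
       (auto intro!: has_sum_cmult_right summable_on_cmult_left simp: has_sum_infsum)
  then have "(\<lambda>(a, b). (2 * K) ^ 3 * (?u a * ?u b)) summable_on (UNIV \<times> UNIV)"
    unfolding case_prod_unfold by (rule summable_on_cmult_right)
  then have sm: "(\<lambda>(a, b). (2 * K) ^ 3 * (?u a * ?u b)) summable_on (UNIV - {(0, 0)})"
    by (rule summable_on_subset) auto
  have inj: "inj_on ?h (UNIV - {(0, 0)})"
  proof (rule inj_onI)
    fix x y :: "int \<times> int"
    assume *: "?h x = ?h y"
    obtain a b c d where xy: "x = (a, b)" "y = (c, d)" by (cases x, cases y)
    have e: "of_int a + of_int b * \<tau> = of_int c + of_int d * \<tau>" using * xy by simp
    then have "Im (of_int a + of_int b * \<tau>) = Im (of_int c + of_int d * \<tau>)" by simp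
    then have "b = d" using assms by simp
    with e show "x = y" by (simp add: xy)
  qed
  have img: "lattice \<tau> - {0} = ?h ` (UNIV - {(0, 0)})"
  proof -
    have "of_int a + of_int b * \<tau> = 0 \<longleftrightarrow> a = 0 \<and> b = 0" for a b :: int
    proof
      assume 0: "of_int a + of_int b * \<tau> = 0"
      show "a = 0 \<and> b = 0" using K(2)[of a b] K(3)[of b a] unfolding 0 by simp
    qed auto
    then show ?thesis by (force simp: lattice_def)
  qed
  show ?thesis unfolding img
  proof (subst summable_on_reindex[OF inj], rule summable_on_comparison_test[OF sm])
    fix x :: "int \<times> int" assume x: "x \<in> UNIV - {(0, 0)}"
    obtain a b where ab: "x = (a, b)" by (cases x)
    define w where "w = norm (of_int a + of_int b * \<tau>)"
    have "\<bar>real_of_int a\<bar> \<ge> 1 \<or> \<bar>real_of_int b\<bar> \<ge> 1" using x ab by auto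
    then have "1 \<le> K * w" using K(2)[of a b] K(3)[of b a] unfolding w_def by linarith
    then have w: "1 + \<bar>real_of_int a\<bar> \<le> 2 * K * w" "1 + \<bar>real_of_int b\<bar> \<le> 2 * K * w" "w > 0"
      using K(1) K(2)[of a b] K(3)[of b a] zero_less_mult_pos[of K w] unfolding w_def by auto
    have "(2 * K * w) powr (-3) = (2 * K * w) powr (-3/2) * (2 * K * w) powr (-3/2)"
      by (simp flip: powr_add)
    also have "\<dots> \<le> ?u a * ?u b" using w by (intro mult_mono powr_mono2') auto
    finally have "1 / (2 * K * w) ^ 3 \<le> ?u a * ?u b"
      using w K(1) by (simp add: powr_minus_divide)
    then have "(2 * K) ^ 3 * (1 / (2 * K * w) ^ 3) \<le> (2 * K) ^ 3 * (?u a * ?u b)"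
      using K(1) by (intro mult_left_mono) auto
    moreover have "(2 * K) ^ 3 * (1 / (2 * K * w) ^ 3) = 1 / w ^ 3"
      using w(3) K(1) by (simp add: field_simps)
    ultimately show "((\<lambda>\<omega>. 1 / norm \<omega> ^ 3) \<circ> ?h) x \<le> (case x of (a, b) \<Rightarrow> (2 * K) ^ 3 * (?u a * ?u b))"
      by (simp add: ab w_def)
  qed (auto simp: o_def)
qed

lemma meromorphic_lattice_sum:
  fixes g :: "complex \<Rightarrow> complex \<Rightarrow> complex"
  assumes \<tau>: "Im \<tau> > 0"
    and mero: "\<And>\<omega>. g \<omega> meromorphic_on UNIV"
    and holo: "\<And>\<omega> R. norm \<omega> > R \<Longrightarrow> g \<omega> holomorphic_on cball 0 R"
    and bound: "\<And>\<omega> R z. 0 < R \<Longrightarrow> 2 * R < norm \<omega> \<Longrightarrow> norm z \<le> R \<Longrightarrow> norm (g \<omega> z) \<le> C R / norm \<omega> ^ 3"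
  shows "(\<lambda>z. \<Sum>\<^sub>\<infinity>\<omega>\<in>lattice \<tau> - {0}. g \<omega> z) meromorphic_on UNIV"
proof (subst meromorphic_on_meromorphic_at, rule ballI)
  fix z0 :: complex
  define R where "R = norm z0 + 1"
  have R: "R > 0" "z0 \<in> ball 0 R" by (auto simp: R_def add_nonneg_pos)
  define L where "L = lattice \<tau> - {0}"
  define L1 where "L1 = {\<omega>\<in>L. norm \<omega> \<le> 2 * R}"
  define L2 where "L2 = {\<omega>\<in>L. norm \<omega> > 2 * R}"
  have fin: "finite L1"
    by (rule finite_subset[OF _ finite_lattice_bounded[OF \<tau>, of "2 * R"]]) (auto simp: L1_def L_def)
  have sum2: "(\<lambda>\<omega>. C R / norm \<omega> ^ 3) summable_on L2"
  proof -
    have "(\<lambda>\<omega>. 1 / norm \<omega> ^ 3) summable_on L2"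
      by (rule summable_on_subset[OF lattice_summable[OF \<tau>]]) (auto simp: L2_def L_def)
    then have "(\<lambda>\<omega>. C R * (1 / norm \<omega> ^ 3)) summable_on L2" by (rule summable_on_cmult_right)
    then show ?thesis by simp
  qed
  have bd: "norm (g \<omega> z) \<le> C R / norm \<omega> ^ 3" if "\<omega> \<in> L2" "z \<in> cball 0 R" for \<omega> z
    using that R by (intro bound) (auto simp: L2_def)
  have ul: "uniform_limit (cball 0 R) (\<lambda>T z. \<Sum>\<omega>\<in>T. g \<omega> z) (\<lambda>z. \<Sum>\<^sub>\<infinity>\<omega>\<in>L2. g \<omega> z)
      (finite_subsets_at_top L2)"
    by (rule Weierstrass_m_test_general[OF bd sum2])
  have gh: "g \<omega> holomorphic_on cball 0 R" if "\<omega> \<in> L2" for \<omega>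
    using that R by (intro holo) (auto simp: L2_def)
  have ev: "\<forall>\<^sub>F T in finite_subsets_at_top L2.
      continuous_on (cball 0 R) (\<lambda>z. \<Sum>\<omega>\<in>T. g \<omega> z) \<and> (\<lambda>z. \<Sum>\<omega>\<in>T. g \<omega> z) holomorphic_on ball 0 R"
  proof (rule eventually_finite_subsets_at_top_weakI)
    fix T assume T: "finite T" "T \<subseteq> L2"
    then have "(\<lambda>z. \<Sum>\<omega>\<in>T. g \<omega> z) holomorphic_on cball 0 R"
      by (intro holomorphic_on_sum gh) auto
    then show "continuous_on (cball 0 R) (\<lambda>z. \<Sum>\<omega>\<in>T. g \<omega> z) \<and> (\<lambda>z. \<Sum>\<omega>\<in>T. g \<omega> z) holomorphic_on ball 0 R"
      by (meson ball_subset_cball holomorphic_on_imp_continuous_on holomorphic_on_subset)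
  qed
  have h2: "(\<lambda>z. \<Sum>\<^sub>\<infinity>\<omega>\<in>L2. g \<omega> z) holomorphic_on ball 0 R"
    by (rule holomorphic_uniform_limit[OF ev ul]) auto
  then have "(\<lambda>z. \<Sum>\<^sub>\<infinity>\<omega>\<in>L2. g \<omega> z) analytic_on {z0}"
    using R(2) analytic_on_holomorphic by (metis empty_subsetI insert_subset open_ball)
  then have m2: "(\<lambda>z. \<Sum>\<^sub>\<infinity>\<omega>\<in>L2. g \<omega> z) meromorphic_on {z0}"
    by (rule analytic_on_imp_meromorphic_on)
  have m1: "(\<lambda>z. \<Sum>\<omega>\<in>L1. g \<omega> z) meromorphic_on {z0}"
    by (intro meromorphic_intros meromorphic_on_subset[OF mero]) auto
  have eq: "(\<Sum>\<^sub>\<infinity>\<omega>\<in>L. g \<omega> z) = (\<Sum>\<omega>\<in>L1. g \<omega> z) + (\<Sum>\<^sub>\<infinity>\<omega>\<in>L2. g \<omega> z)" if "z \<in> ball 0 R" for z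
  proof -
    have L: "L = L1 \<union> L2" by (auto simp: L1_def L2_def)
    have "(\<lambda>\<omega>. norm (g \<omega> z)) summable_on L2"
      using that by (intro Infinite_Sum.abs_summable_on_comparison_test'[OF sum2] bd) auto
    then have "(\<lambda>\<omega>. g \<omega> z) summable_on L2" by (rule abs_summable_summable)
    then have "infsum (\<lambda>\<omega>. g \<omega> z) (L1 \<union> L2) = infsum (\<lambda>\<omega>. g \<omega> z) L1 + infsum (\<lambda>\<omega>. g \<omega> z) L2"
      by (intro infsum_Un_disjoint summable_on_finite[OF fin]) (auto simp: L1_def L2_def)
    then show ?thesis using fin L by simp
  qed
  have "\<forall>\<^sub>F z in at z0. z \<in> ball 0 R"
    using R(2) by (intro eventually_at_in_open') auto
  then have "\<forall>\<^sub>F z in at z0. (\<Sum>\<^sub>\<infinity>\<omega>\<in>L. g \<omega> z) = (\<Sum>\<omega>\<in>L1. g \<omega> z) + (\<Sum>\<^sub>\<infinity>\<omega>\<in>L2. g \<omega> z)"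
    by eventually_elim (rule eq)
  then show "(\<lambda>z. \<Sum>\<^sub>\<infinity>\<omega>\<in>lattice \<tau> - {0}. g \<omega> z) meromorphic_on {z0}"
    using meromorphic_on_add[OF m1 m2] unfolding L_def[symmetric]
    by (subst meromorphic_on_cong) auto
qed

lemma lattice_far:
  assumes "0 < R" "2 * R < norm \<omega>" "norm z \<le> R"
  shows "norm (z - \<omega>) \<ge> norm \<omega> / 2" "z - \<omega> \<noteq> 0" "\<omega> \<noteq> 0"
proof -
  show 1: "norm (z - \<omega>) \<ge> norm \<omega> / 2"
    using assms norm_triangle_ineq2[of \<omega> z] by (simp add: norm_minus_commute)
  show "\<omega> \<noteq> 0" "z - \<omega> \<noteq> 0" using assms by auto
qed

lemma wp_meromorphic:
  assumes "Im \<tau> > 0"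
  shows "wp \<tau> meromorphic_on UNIV"
proof -
  have "(\<lambda>z. \<Sum>\<^sub>\<infinity>\<omega>\<in>lattice \<tau> - {0}. 1 / (z - \<omega>) ^ 2 - 1 / \<omega> ^ 2) meromorphic_on UNIV"
  proof (rule meromorphic_lattice_sum[OF assms, where C = "\<lambda>R. 10 * R"])
    fix \<omega> z :: complex and R :: real
    assume R: "0 < R" "2 * R < norm \<omega>" "norm z \<le> R"
    note far = lattice_far[OF R]
    have "1 / (z - \<omega>) ^ 2 - 1 / \<omega> ^ 2 = z * (2 * \<omega> - z) / ((z - \<omega>) ^ 2 * \<omega> ^ 2)"
      using far by (simp add: divide_simps) (simp add: power2_eq_square algebra_simps)
    also have "norm \<dots> = norm z * norm (2 * \<omega> - z) / (norm (z - \<omega>) ^ 2 * norm \<omega> ^ 2)"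
      by (simp add: norm_mult norm_divide norm_power)
    also have "\<dots> \<le> R * (5 / 2 * norm \<omega>) / ((norm \<omega> / 2) ^ 2 * norm \<omega> ^ 2)"
    proof (intro frac_le mult_mono power_mono)
      show "norm (2 * \<omega> - z) \<le> 5 / 2 * norm \<omega>"
        using norm_triangle_ineq4[of "2 * \<omega>" z] R by (simp add: norm_mult)
    qed (use R far in auto)
    also have "\<dots> = 10 * R / norm \<omega> ^ 3"
      using far by (simp add: field_simps power2_eq_square power3_eq_cube)
    finally show "norm (1 / (z - \<omega>) ^ 2 - 1 / \<omega> ^ 2) \<le> 10 * R / norm \<omega> ^ 3" .
  qed (auto intro!: meromorphic_intros holomorphic_intros)
  then show ?thesis unfolding wp_def[abs_def] by (intro meromorphic_intros)
qed

lemma wzeta_meromorphic: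
  assumes "Im \<tau> > 0"
  shows "wzeta \<tau> meromorphic_on UNIV"
proof -
  have "(\<lambda>z. \<Sum>\<^sub>\<infinity>\<omega>\<in>lattice \<tau> - {0}. 1 / (z - \<omega>) + 1 / \<omega> + z / \<omega> ^ 2) meromorphic_on UNIV"
  proof (rule meromorphic_lattice_sum[OF assms, where C = "\<lambda>R. 2 * R ^ 2"])
    fix \<omega> z :: complex and R :: real
    assume R: "0 < R" "2 * R < norm \<omega>" "norm z \<le> R"
    note far = lattice_far[OF R]
    have "1 / u + 1 / \<omega> + (u + \<omega>) / \<omega> ^ 2 = (u + \<omega>) ^ 2 / (u * \<omega> ^ 2)" if "u \<noteq> 0" for u
    proof -
      have "1 / u = \<omega> ^ 2 / (u * \<omega> ^ 2)" "1 / \<omega> = u * \<omega> / (u * \<omega> ^ 2)"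
        "(u + \<omega>) / \<omega> ^ 2 = u * (u + \<omega>) / (u * \<omega> ^ 2)"
        using that far by (auto simp: power2_eq_square)
      then have "1 / u + 1 / \<omega> + (u + \<omega>) / \<omega> ^ 2 = (\<omega> ^ 2 + u * \<omega> + u * (u + \<omega>)) / (u * \<omega> ^ 2)"
        by (simp only: add_divide_distrib)
      also have "\<omega> ^ 2 + u * \<omega> + u * (u + \<omega>) = (u + \<omega>) ^ 2"
        by (simp add: power2_eq_square algebra_simps)
      finally show ?thesis .
    qed
    from this[of "z - \<omega>"] far
    have "1 / (z - \<omega>) + 1 / \<omega> + z / \<omega> ^ 2 = z ^ 2 / ((z - \<omega>) * \<omega> ^ 2)" by simp
    also have "norm \<dots> = norm z ^ 2 / (norm (z - \<omega>) * norm \<omega> ^ 2)"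
      by (simp add: norm_mult norm_divide norm_power)
    also have "\<dots> \<le> R ^ 2 / ((norm \<omega> / 2) * norm \<omega> ^ 2)"
      by (intro frac_le mult_mono power_mono) (use R far in auto)
    also have "\<dots> = 2 * R ^ 2 / norm \<omega> ^ 3"
      using far by (simp add: field_simps power2_eq_square power3_eq_cube)
    finally show "norm (1 / (z - \<omega>) + 1 / \<omega> + z / \<omega> ^ 2) \<le> 2 * R ^ 2 / norm \<omega> ^ 3" .
  next
    show "(\<lambda>z. 1 / (z - \<omega>) + 1 / \<omega> + z / \<omega> ^ 2) meromorphic_on UNIV" for \<omega>
      unfolding divide_inverse by (intro meromorphic_intros)
  next
    show "(\<lambda>z. 1 / (z - \<omega>) + 1 / \<omega> + z / \<omega> ^ 2) holomorphic_on cball 0 R"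
      if "norm \<omega> > R" for \<omega> R
      unfolding divide_inverse using that by (intro holomorphic_intros) auto
  qed
  then show ?thesis unfolding wzeta_def[abs_def] by (intro meromorphic_intros)
qed


section \<open>Weighted polynomial rings\<close>

type_synonym 'v cpoly = "('v \<Rightarrow>\<^sub>0 nat) \<Rightarrow>\<^sub>0 complex"

definition Const :: "complex \<Rightarrow> 'v cpoly" where
  "Const c = Poly_Mapping.single 0 c"

definition Var :: "'v \<Rightarrow> 'v cpoly" where
  "Var v = Poly_Mapping.single (Poly_Mapping.single v 1) 1"

definition cpoly_eval :: "('v \<Rightarrow> complex) \<Rightarrow> 'v cpoly \<Rightarrow> complex" where
  "cpoly_eval x f = (\<Sum>t\<in>Poly_Mapping.keys f. Poly_Mapping.lookup f t *
      (\<Prod>v\<in>Poly_Mapping.keys t. x v ^ Poly_Mapping.lookup t v))"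

definition wdeg_mon :: "('v \<Rightarrow> nat) \<Rightarrow> ('v \<Rightarrow>\<^sub>0 nat) \<Rightarrow> nat" where
  "wdeg_mon wt t = (\<Sum>v\<in>Poly_Mapping.keys t. wt v * Poly_Mapping.lookup t v)"

definition wdeg :: "('v \<Rightarrow> nat) \<Rightarrow> 'v cpoly \<Rightarrow> nat" where
  "wdeg wt f = Max (insert 0 (wdeg_mon wt ` Poly_Mapping.keys f))"

definition homogeneous_piece :: "('v \<Rightarrow> nat) \<Rightarrow> nat \<Rightarrow> 'v cpoly set" where
  "homogeneous_piece wt m = {f. \<forall>t\<in>Poly_Mapping.keys f. wdeg_mon wt t = m}"

abbreviation cpoly_ring :: "'v cpoly ring" where
  "cpoly_ring \<equiv> ring_of_type_algebra"

text \<open>Coordinates \<open>A\<^sub>i\<close>, \<open>B\<close> of the affine space, and \<open>A\<^sub>0\<close> together with these for the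
  weighted projective stack.\<close>

datatype 'i aff_var = VarA 'i | VarB
datatype 'i proj_var = VarA0 | Aff "'i aff_var"

fun aff_weight :: "'i aff_var \<Rightarrow> nat" where
  "aff_weight (VarA i) = 1"
| "aff_weight VarB = 2"

fun proj_weight :: "'i proj_var \<Rightarrow> nat" where
  "proj_weight VarA0 = 1"
| "proj_weight (Aff v) = aff_weight v"

definition lift_mon :: "('i aff_var \<Rightarrow>\<^sub>0 nat) \<Rightarrow> ('i proj_var \<Rightarrow>\<^sub>0 nat)" where
  "lift_mon t = (\<Sum>v\<in>Poly_Mapping.keys t. Poly_Mapping.single (Aff v) (Poly_Mapping.lookup t v))"

text \<open>\<open>A\<^sub>0\<^sup>d f(A\<^sub>1/A\<^sub>0, \<dots>, A\<^sub>r/A\<^sub>0, B/A\<^sub>0\<^sup>2)\<close> where \<open>d\<close> is the weighted degree of \<open>f\<close>.\<close>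

definition homogenize :: "'i aff_var cpoly \<Rightarrow> 'i proj_var cpoly" where
  "homogenize f = (\<Sum>t\<in>Poly_Mapping.keys f.
     Poly_Mapping.single
       (lift_mon t + Poly_Mapping.single VarA0 (wdeg aff_weight f - wdeg_mon aff_weight t))
       (Poly_Mapping.lookup f t))"

text \<open>A closed subscheme of affine space is given by its ideal \<open>I\<close>; its scheme-theoretic closure in
  the weighted projective stack is given by the homogeneous ideal generated by the homogenizations
  of all elements of \<open>I\<close>.\<close>

definition closure_ideal :: "'i aff_var cpoly set \<Rightarrow> 'i proj_var cpoly set" where
  "closure_ideal I = Idl\<^bsub>cpoly_ring\<^esub> (homogenize ` I)"


section \<open>Hilbert quasi-polynomials\<close>

definition quasi_polynomial :: "(int \<Rightarrow> real) \<Rightarrow> bool" where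
  "quasi_polynomial f \<longleftrightarrow>
     (\<exists>N>0. \<exists>P :: int \<Rightarrow> real poly. \<forall>m. f m = poly (P (m mod N)) (of_int m))"

lemma quasi_polynomial_unique:
  assumes "quasi_polynomial f" "quasi_polynomial g"
    and "\<forall>m\<ge>M. f (int m) = g (int m)"
  shows "f = g"
proof
  fix m :: int
  obtain N P where N: "N > 0" "\<And>m. f m = poly (P (m mod N)) (of_int m)"
    using assms(1) unfolding quasi_polynomial_def by blast
  obtain N' P' where N': "N' > 0" "\<And>m. g m = poly (P' (m mod N')) (of_int m)"
    using assms(2) unfolding quasi_polynomial_def by blast
  define a where "a k = m + (\<bar>m\<bar> + int M + int k) * (N * N')" for k :: nat
  have NN: "N * N' \<ge> 1" using N(1) N'(1) by (simp add: int_one_le_iff_zero_less)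
  have a: "a k \<ge> int M" for k
  proof -
    have "(\<bar>m\<bar> + int M + int k) * 1 \<le> (\<bar>m\<bar> + int M + int k) * (N * N')"
      using NN by (intro mult_left_mono) auto
    then have "- m + int M \<le> (\<bar>m\<bar> + int M + int k) * (N * N')" by (rule order_trans[rotated]) simp
    then show ?thesis unfolding a_def by simp
  qed
  have "poly (P (m mod N)) (of_int (a k)) = poly (P' (m mod N')) (of_int (a k))" for k
  proof -
    have "f (a k) = g (a k)"
      using assms(3)[rule_format, of "nat (a k)"] a[of k] by auto
    moreover have "a k = m + (\<bar>m\<bar> + int M + int k) * N' * N" "a k = m + (\<bar>m\<bar> + int M + int k) * N * N'"
      unfolding a_def by (simp_all only: mult_ac)
    then have "a k mod N = m mod N" "a k mod N' = m mod N'"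
      by (metis mod_mult_self1)+
    ultimately show ?thesis using N(2)[of "a k"] N'(2)[of "a k"] by simp
  qed
  then have sub: "range (\<lambda>k. real_of_int (a k)) \<subseteq> {x. poly (P (m mod N) - P' (m mod N')) x = 0}"
    by auto
  have "inj (\<lambda>k. real_of_int (a k))"
    using NN by (auto simp: inj_def a_def)
  then have "infinite (range (\<lambda>k. real_of_int (a k)))" by (simp add: finite_image_iff)
  then have "P (m mod N) - P' (m mod N') = 0"
    using poly_roots_finite finite_subset[OF sub] by blast
  then show "f m = g m" using N(2)[of m] N'(2)[of m] by simp
qed

text \<open>The degree-\<open>m\<close> piece of the homogeneous coordinate ring, the quotient by \<open>J\<close>, has
  dimension \<open>d\<close> over the image of the constants.\<close>

definition graded_piece_dim :: "('v \<Rightarrow> nat) \<Rightarrow> 'v cpoly set \<Rightarrow> nat \<Rightarrow> nat \<Rightarrow> bool" where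
  "graded_piece_dim wt J m d \<longleftrightarrow>
     ring.dimension (cpoly_ring Quot J) d
       (range (\<lambda>c. J +>\<^bsub>cpoly_ring\<^esub> Const c))
       ((\<lambda>f. J +>\<^bsub>cpoly_ring\<^esub> f) ` homogeneous_piece wt m)"

definition is_hilbert_quasi_polynomial ::
  "('v \<Rightarrow> nat) \<Rightarrow> 'v cpoly set \<Rightarrow> (int \<Rightarrow> real) \<Rightarrow> bool" where
  "is_hilbert_quasi_polynomial wt J h \<longleftrightarrow> quasi_polynomial h \<and>
     (\<exists>M. \<forall>m\<ge>M. \<exists>d. graded_piece_dim wt J m d \<and> h (int m) = real d)"


section \<open>The log-free variety\<close>

text \<open>The potential \<open>Q\<close> for given complex values of the parameters.\<close>

definition potential ::
  "complex \<Rightarrow> ('i::finite \<Rightarrow> real) \<Rightarrow> ('i \<Rightarrow> complex) \<Rightarrow> ('i \<Rightarrow> complex) \<Rightarrow> complex \<Rightarrow> complex \<Rightarrow> complex" where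
  "potential \<tau> n p A B z =
     (\<Sum>j\<in>UNIV. of_real (n j * (n j + 1)) * wp \<tau> (z - p j)) +
     (\<Sum>j\<in>UNIV. A j * wzeta \<tau> (z - p j)) + B"

text \<open>The coefficient \<open>q\<^sub>s\<close> of the expansion of \<open>Q\<close> at \<open>p\<^sub>i\<close>, as a polynomial in \<open>(A, B)\<close>:
  lemma \<open>cpoly_eval_potential_coeff\<close> below shows that its values are the Laurent
  coefficients of the function \<^const>\<open>potential\<close>.\<close>

definition potential_coeff ::
  "complex \<Rightarrow> ('i::finite \<Rightarrow> real) \<Rightarrow> ('i \<Rightarrow> complex) \<Rightarrow> 'i \<Rightarrow> int \<Rightarrow> 'i aff_var cpoly" where
  "potential_coeff \<tau> n p i s =
     (\<Sum>j\<in>UNIV. Const (of_real (n j * (n j + 1)) *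
        fls_nth (laurent_expansion (\<lambda>z. wp \<tau> (z - p j)) (p i)) s)) +
     (\<Sum>j\<in>UNIV. Const (fls_nth (laurent_expansion (\<lambda>z. wzeta \<tau> (z - p j)) (p i)) s) * Var (VarA j)) +
     (if s = 0 then Var VarB else 0)"

lemma cpoly_eval_superset:
  assumes "finite S" "Poly_Mapping.keys f \<subseteq> S"
  shows "cpoly_eval x f = (\<Sum>t\<in>S. Poly_Mapping.lookup f t *
      (\<Prod>v\<in>Poly_Mapping.keys t. x v ^ Poly_Mapping.lookup t v))"
  unfolding cpoly_eval_def using assms
  by (intro sum.mono_neutral_left) (auto simp: in_keys_iff)

lemma cpoly_eval_0 [simp]: "cpoly_eval x 0 = 0"
  by (simp add: cpoly_eval_def)

lemma cpoly_eval_add: "cpoly_eval x (f + g) = cpoly_eval x f + cpoly_eval x g"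
proof -
  let ?S = "Poly_Mapping.keys f \<union> Poly_Mapping.keys g"
  have "Poly_Mapping.keys (f + g) \<subseteq> ?S" by (rule Poly_Mapping.keys_add)
  then show ?thesis
    by (simp add: cpoly_eval_superset[of ?S] lookup_add algebra_simps sum.distrib)
qed

lemma cpoly_eval_sum: "cpoly_eval x (\<Sum>i\<in>I. f i) = (\<Sum>i\<in>I. cpoly_eval x (f i))"
  by (induction I rule: infinite_finite_induct) (auto simp: cpoly_eval_add)

lemma cpoly_eval_Const [simp]: "cpoly_eval x (Const c) = c"
  by (simp add: cpoly_eval_def Const_def)

lemma cpoly_eval_Const_Var [simp]: "cpoly_eval x (Const c * Var v) = c * x v"
  by (simp add: cpoly_eval_def Const_def Var_def mult_single)

lemma cpoly_eval_Var [simp]: "cpoly_eval x (Var v) = x v"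
  by (simp add: cpoly_eval_def Var_def)

lemma cpoly_eval_potential_coeff:
  assumes "Im \<tau> > 0"
  shows "cpoly_eval (\<lambda>v. case v of VarA j \<Rightarrow> A j | VarB \<Rightarrow> B) (potential_coeff \<tau> n p i s) =
         fls_nth (laurent_expansion (potential \<tau> n p A B) (p i)) s"
proof -
  have ex: "(\<lambda>w. f (p i + w - p j)) has_laurent_expansion laurent_expansion (\<lambda>z. f (z - p j)) (p i)"
    if f: "f meromorphic_on UNIV" for f j
  proof -
    obtain F where "(\<lambda>w. f (p i - p j + w)) has_laurent_expansion F"
      using f unfolding meromorphic_on_def by blast
    then have F: "(\<lambda>w. f (p i + w - p j)) has_laurent_expansion F"
      by (simp add: algebra_simps)
    then show ?thesis using laurent_expansion_eqI[of "\<lambda>z. f (z - p j)" "p i" F] by simp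
  qed
  let ?P = "\<lambda>j. laurent_expansion (\<lambda>z. wp \<tau> (z - p j)) (p i)"
  let ?Z = "\<lambda>j. laurent_expansion (\<lambda>z. wzeta \<tau> (z - p j)) (p i)"
  have "(\<lambda>w. potential \<tau> n p A B (p i + w)) has_laurent_expansion
     (\<Sum>j\<in>UNIV. fls_const (of_real (n j * (n j + 1))) * ?P j) +
     (\<Sum>j\<in>UNIV. fls_const (A j) * ?Z j) + fls_const B"
    unfolding potential_def
    by (intro has_laurent_expansion_add has_laurent_expansion_sum has_laurent_expansion_cmult_left
        has_laurent_expansion_const ex wp_meromorphic wzeta_meromorphic assms)
  then have "laurent_expansion (potential \<tau> n p A B) (p i) =
     (\<Sum>j\<in>UNIV. fls_const (of_real (n j * (n j + 1))) * ?P j) +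
     (\<Sum>j\<in>UNIV. fls_const (A j) * ?Z j) + fls_const B"
    by (rule laurent_expansion_eqI)
  then show ?thesis
    by (simp add: potential_coeff_def cpoly_eval_add cpoly_eval_sum fls_nth_sum mult.commute[of _ "A _"]
        del: of_real_mult of_real_add)
qed

text \<open>For coefficients \<open>q\<close> and \<open>\<ell>\<close> fixed: the \<open>c\<^sub>k\<close> and the obstruction \<open>F\<^sub>\<ell>\<close>. The recursion is
  only used for \<open>k \<le> \<ell>\<close>, where the denominators do not vanish.\<close>

function frobenius_coeff :: "(int \<Rightarrow> 'v cpoly) \<Rightarrow> nat \<Rightarrow> nat \<Rightarrow> 'v cpoly" where
  "frobenius_coeff q l k =
     (if k = 0 then 1
      else Const (1 / (of_nat k * (of_nat k - 1 - of_nat l))) *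
           (\<Sum>s\<in>{-1..int k - 2}. q s * frobenius_coeff q l (nat (int k - 2 - s))))"
  by pat_completeness auto
termination by (relation "Wellfounded.measure (\<lambda>(q, l, k). k)") auto

declare frobenius_coeff.simps [simp del]

definition log_obstruction :: "(int \<Rightarrow> 'v cpoly) \<Rightarrow> nat \<Rightarrow> 'v cpoly" where
  "log_obstruction q l = (\<Sum>s\<in>{-1..int l - 1}. q s * frobenius_coeff q l (nat (int l - 1 - s)))"

definition log_free_ideal ::
  "complex \<Rightarrow> ('i::finite \<Rightarrow> real) \<Rightarrow> ('i \<Rightarrow> complex) \<Rightarrow> 'i aff_var cpoly set" where
  "log_free_ideal \<tau> n p = Idl\<^bsub>cpoly_ring\<^esub>
     (insert (\<Sum>i\<in>UNIV. Var (VarA i))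
       (range (\<lambda>i. log_obstruction (potential_coeff \<tau> n p i) (nat \<lfloor>2 * n i\<rfloor>))))"

abbreviation pos_nats :: "real set" where
  "pos_nats \<equiv> real ` {1..}"

definition F_count :: "('i::finite \<Rightarrow> real) \<Rightarrow> nat" where
  "F_count n = card {k :: 'i \<Rightarrow> nat.
     (\<Sum>i\<in>UNIV. real (k i)) = (\<Sum>i\<in>UNIV. n i) \<and> (\<forall>i. real (k i) \<le> 2 * n i)}"

end

(*
  Weighted leading forms turn F_{l_i} into A_i^{l_i+1} + B (...), so modulo B the ideal becomes
  (A_i^{l_i+1}, A_1 + ... + A_r).  By the strong Lefschetz property the quotient by the latter has a
  basis of F(n) monomials A^a, with f_d - f_{d-1} of them in degree d <= n, where f_d counts the
  exponents of degree d in the box.  Hence the monomials A^a B^b span the coordinate ring of V,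
  compatibly with the filtration by weighted degree.

  They are independent because V has a formal branch at each of the F(n) points k at infinity:
  put B = kappa^2 and A_i = sum_j a_ij kappa^(1-j), and expand the logarithmic derivative of a
  solution as w'/w = kappa + v_0 + v_1/kappa + ...  The coefficients a_ij can be chosen successively
  so that only v_0 has residues, namely n_i - k_i at p_i.  The residue theorem for the elliptic
  functions v_a v_b then gives sum_i a_ij = 0, and the absence of residues makes w a Laurent series
  at p_i whose recursion forces it to be a genuine Frobenius solution without logarithm, so that
  F_{l_i} = 0 on the branch.  The leading coefficients of A^a B^b along the branches are the values
  of A^a at the F(n) points A_i = l_i - 2 k_i, where the basis monomials are linearly independent.
*)
theory Submission
  imports Defs "HOL-Library.Function_Algebras"
begin

section \<open>Weierstrass functions as lattice sums\<close>

text \<open>The \<open>r + 1\<close> equations in \<open>r + 1\<close> unknowns would naively cut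
  out points, yet the Hilbert function grows linearly: the intersection is not proper, and no
  complete-intersection or Bezout count applies. The leading forms give only an upper bound, since
  the ideal could contain further leading terms; the branches at infinity supply the lower bound.
  The two meet because the differences \<open>f_d - f_(d-1)\<close> telescope to
  \<open>F(n)\<close>, the number of branches. The residue \<open>n_i - k_i\<close> comes from the
  local exponents \<open>- n_i\<close> and \<open>n_i + 1\<close> at \<open>p_i\<close>: once
  \<open>e^(\<kappa> z)\<close> is split off, the terms of the expansion in
  \<open>1/\<kappa>\<close> have poles of growing order, and the indicial polynomial stops this
  growth at order \<open>2 n_i - k_i\<close>, so that the solution starts at the exponent
  \<open>- n_i\<close>. That the residues add up to 0 on the torus is the equation
  \<open>k_1 + ... + k_r = n\<close> in the definition of \<open>F(n)\<close>, and
  \<open>k_i \<le> 2 n_i\<close> makes \<open>2 n_i - k_i\<close> a natural number.\<close>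

lemma lattice_sum_analytic:
  fixes g :: "complex \<Rightarrow> complex \<Rightarrow> complex"
  assumes \<tau>: "Im \<tau> > 0" and L: "L \<subseteq> lattice \<tau>"
    and holo: "\<And>\<omega>. g \<omega> holomorphic_on (- {\<omega>})"
    and bound: "\<And>\<omega> R z. 0 < R \<Longrightarrow> 2 * R < norm \<omega> \<Longrightarrow> norm z \<le> R \<Longrightarrow> norm (g \<omega> z) \<le> C R / norm \<omega> ^ 3"
  shows lattice_sum_summable: "(\<lambda>\<omega>. g \<omega> z0) summable_on L"
    and "z0 \<notin> L \<Longrightarrow> (\<lambda>z. \<Sum>\<^sub>\<infinity>\<omega>\<in>L. g \<omega> z) analytic_on {z0}"
proof -
  define R where "R = norm z0 + 1"
  have R: "R > 0" "z0 \<in> ball 0 R" by (auto simp: R_def add_nonneg_pos)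
  \<comment> \<open>Only the finitely many terms in \<open>L1\<close> can be singular in the ball;
    the tail \<open>L2\<close> converges uniformly there by comparison with
    \<open>1 / norm \<omega> ^ 3\<close>. The set \<open>L\<close> is arbitrary so that both the
    whole lattice and the lattice without 0 are covered, the latter for expansions at the
    origin.\<close>
  define L1 where "L1 = {\<omega>\<in>L. norm \<omega> \<le> 2 * R}"
  define L2 where "L2 = {\<omega>\<in>L. norm \<omega> > 2 * R}"
  have LL: "L = L1 \<union> L2" and disj: "L1 \<inter> L2 = {}" by (auto simp: L1_def L2_def)
  have fin: "finite L1"
    by (rule finite_subset[OF _ finite_lattice_bounded[OF \<tau>, of "2 * R"]]) (use L in \<open>auto simp: L1_def\<close>)
  have sum2: "(\<lambda>\<omega>. C R / norm \<omega> ^ 3) summable_on L2"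
  proof -
    have "(\<lambda>\<omega>. 1 / norm \<omega> ^ 3) summable_on L2"
      by (rule summable_on_subset[OF lattice_summable[OF \<tau>]]) (use L R in \<open>auto simp: L2_def\<close>)
    then have "(\<lambda>\<omega>. C R * (1 / norm \<omega> ^ 3)) summable_on L2" by (rule summable_on_cmult_right)
    then show ?thesis by simp
  qed
  have bd: "norm (g \<omega> z) \<le> C R / norm \<omega> ^ 3" if "\<omega> \<in> L2" "z \<in> cball 0 R" for \<omega> z
    using that R by (intro bound) (auto simp: L2_def)
  have sm2: "(\<lambda>\<omega>. g \<omega> z) summable_on L2" if "z \<in> ball 0 R" for z
  proof -
    have "(\<lambda>\<omega>. norm (g \<omega> z)) summable_on L2"
      using that by (intro Infinite_Sum.abs_summable_on_comparison_test'[OF sum2] bd) auto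
    then show ?thesis by (rule abs_summable_summable)
  qed
  show "(\<lambda>\<omega>. g \<omega> z0) summable_on L"
    unfolding LL by (intro summable_on_Un_disjoint sm2 summable_on_finite fin R) (auto simp: L1_def L2_def)
  have gh: "g \<omega> holomorphic_on cball 0 R" if "\<omega> \<in> L2" for \<omega>
    using that R by (intro holomorphic_on_subset[OF holo]) (auto simp: L2_def)
  have ev: "\<forall>\<^sub>F T in finite_subsets_at_top L2.
      continuous_on (cball 0 R) (\<lambda>z. \<Sum>\<omega>\<in>T. g \<omega> z) \<and> (\<lambda>z. \<Sum>\<omega>\<in>T. g \<omega> z) holomorphic_on ball 0 R"
  proof (rule eventually_finite_subsets_at_top_weakI)
    fix T assume T: "finite T" "T \<subseteq> L2"
    then have "(\<lambda>z. \<Sum>\<omega>\<in>T. g \<omega> z) holomorphic_on cball 0 R"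
      by (intro holomorphic_on_sum gh) auto
    then show "continuous_on (cball 0 R) (\<lambda>z. \<Sum>\<omega>\<in>T. g \<omega> z) \<and> (\<lambda>z. \<Sum>\<omega>\<in>T. g \<omega> z) holomorphic_on ball 0 R"
      by (meson ball_subset_cball holomorphic_on_imp_continuous_on holomorphic_on_subset)
  qed
  have h2: "(\<lambda>z. \<Sum>\<^sub>\<infinity>\<omega>\<in>L2. g \<omega> z) holomorphic_on ball 0 R"
    by (rule holomorphic_uniform_limit[OF ev Weierstrass_m_test_general[OF bd sum2]]) auto
  assume z0: "z0 \<notin> L"
  define U where "U = ball 0 R - L1"
  have U: "open U" "z0 \<in> U"
    using fin R z0 by (auto simp: U_def L1_def intro!: open_Diff finite_imp_closed)
  have "(\<lambda>z. (\<Sum>\<omega>\<in>L1. g \<omega> z) + (\<Sum>\<^sub>\<infinity>\<omega>\<in>L2. g \<omega> z)) holomorphic_on U"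
    by (intro holomorphic_intros holomorphic_on_subset[OF h2] holomorphic_on_subset[OF holo])
       (auto simp: U_def)
  moreover have "(\<Sum>\<omega>\<in>L1. g \<omega> z) + (\<Sum>\<^sub>\<infinity>\<omega>\<in>L2. g \<omega> z) = (\<Sum>\<^sub>\<infinity>\<omega>\<in>L. g \<omega> z)" if "z \<in> U" for z
    using that fin sm2[of z] disj unfolding LL
    by (subst infsum_Un_disjoint) (auto simp: U_def)
  ultimately have "(\<lambda>z. \<Sum>\<^sub>\<infinity>\<omega>\<in>L. g \<omega> z) holomorphic_on U"
    by (simp cong: holomorphic_cong)
  then show "(\<lambda>z. \<Sum>\<^sub>\<infinity>\<omega>\<in>L. g \<omega> z) analytic_on {z0}"
    using U analytic_at by blast
qed

lemma wp_term_bound: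
  fixes \<omega> z :: complex
  assumes R: "0 < R" "2 * R < norm \<omega>" "norm z \<le> R"
  shows "norm (1 / (z - \<omega>) ^ 2 - 1 / \<omega> ^ 2) \<le> (10 * R) / norm \<omega> ^ 3"
proof -
  note far = lattice_far[OF R]
  have "1 / (z - \<omega>) ^ 2 - 1 / \<omega> ^ 2 = z * (2 * \<omega> - z) / ((z - \<omega>) ^ 2 * \<omega> ^ 2)"
    using far by (simp add: divide_simps) (simp add: power2_eq_square algebra_simps)
  also have "norm \<dots> = norm z * norm (2 * \<omega> - z) / (norm (z - \<omega>) ^ 2 * norm \<omega> ^ 2)"
    by (simp add: norm_mult norm_divide norm_power)
  also have "\<dots> \<le> R * (5 / 2 * norm \<omega>) / ((norm \<omega> / 2) ^ 2 * norm \<omega> ^ 2)"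
  proof (intro frac_le mult_mono power_mono)
    show "norm (2 * \<omega> - z) \<le> 5 / 2 * norm \<omega>"
      using norm_triangle_ineq4[of "2 * \<omega>" z] R by (simp add: norm_mult)
  qed (use R far in auto)
  also have "\<dots> = 10 * R / norm \<omega> ^ 3"
    using far by (simp add: field_simps power2_eq_square power3_eq_cube)
  finally show ?thesis .
qed

lemma wzeta_term_bound:
  fixes \<omega> z :: complex
  assumes R: "0 < R" "2 * R < norm \<omega>" "norm z \<le> R"
  shows "norm (1 / (z - \<omega>) + 1 / \<omega> + z / \<omega> ^ 2) \<le> (2 * R ^ 2) / norm \<omega> ^ 3"
proof -
  note far = lattice_far[OF R]
  define u where "u = z - \<omega>"
  have u: "u \<noteq> 0" "\<omega> \<noteq> 0" "z = u + \<omega>" using far by (auto simp: u_def)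
  have "(1 / u + 1 / \<omega> + (u + \<omega>) / \<omega> ^ 2) * (u * \<omega> ^ 2) = (u + \<omega>) ^ 2"
  proof -
    have "1 / u * (u * \<omega> ^ 2) = \<omega> ^ 2" "1 / \<omega> * (u * \<omega> ^ 2) = u * \<omega>"
      "(u + \<omega>) / \<omega> ^ 2 * (u * \<omega> ^ 2) = (u + \<omega>) * u"
      using u(1,2) by (simp_all add: power2_eq_square)
    then have "(1 / u + 1 / \<omega> + (u + \<omega>) / \<omega> ^ 2) * (u * \<omega> ^ 2) = \<omega> ^ 2 + u * \<omega> + (u + \<omega>) * u"
      by (simp only: distrib_right)
    then show ?thesis by (simp add: power2_eq_square algebra_simps)
  qed
  then have "1 / (z - \<omega>) + 1 / \<omega> + z / \<omega> ^ 2 = z ^ 2 / ((z - \<omega>) * \<omega> ^ 2)"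
    unfolding u_def[symmetric] using u by (intro eq_divide_imp) auto
  also have "norm \<dots> = norm z ^ 2 / (norm (z - \<omega>) * norm \<omega> ^ 2)"
    by (simp add: norm_mult norm_divide norm_power)
  also have "\<dots> \<le> R ^ 2 / ((norm \<omega> / 2) * norm \<omega> ^ 2)"
    by (intro frac_le mult_mono power_mono) (use R far in auto)
  also have "\<dots> = 2 * R ^ 2 / norm \<omega> ^ 3"
    using far by (simp add: field_simps power2_eq_square power3_eq_cube)
  finally show ?thesis .
qed

lemma
  assumes "Im \<tau> > 0" "L \<subseteq> lattice \<tau>"
  shows wp_summable: "(\<lambda>\<omega>. 1 / (z - \<omega>) ^ 2 - 1 / \<omega> ^ 2) summable_on L"
    and wp_sum_analytic: "z \<notin> L \<Longrightarrow> (\<lambda>z. \<Sum>\<^sub>\<infinity>\<omega>\<in>L. 1 / (z - \<omega>) ^ 2 - 1 / \<omega> ^ 2) analytic_on {z}"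
proof -
  have "(\<lambda>z. 1 / (z - \<omega>) ^ 2 - 1 / \<omega> ^ 2) holomorphic_on (- {\<omega>})" for \<omega> :: complex
    by (intro holomorphic_intros) auto
  then show "(\<lambda>\<omega>. 1 / (z - \<omega>) ^ 2 - 1 / \<omega> ^ 2) summable_on L"
    "z \<notin> L \<Longrightarrow> (\<lambda>z. \<Sum>\<^sub>\<infinity>\<omega>\<in>L. 1 / (z - \<omega>) ^ 2 - 1 / \<omega> ^ 2) analytic_on {z}"
    using lattice_sum_analytic[OF assms, of "\<lambda>\<omega> z. 1 / (z - \<omega>) ^ 2 - 1 / \<omega> ^ 2" "\<lambda>R. 10 * R" z]
      wp_term_bound by auto
qed

lemma
  assumes "Im \<tau> > 0" "L \<subseteq> lattice \<tau>"
  shows wzeta_summable: "(\<lambda>\<omega>. 1 / (z - \<omega>) + 1 / \<omega> + z / \<omega> ^ 2) summable_on L"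
    and wzeta_sum_analytic: "z \<notin> L \<Longrightarrow> (\<lambda>z. \<Sum>\<^sub>\<infinity>\<omega>\<in>L. 1 / (z - \<omega>) + 1 / \<omega> + z / \<omega> ^ 2) analytic_on {z}"
proof -
  have "(\<lambda>z. 1 / (z - \<omega>) + 1 / \<omega> + z / \<omega> ^ 2) holomorphic_on (- {\<omega>})" for \<omega> :: complex
    unfolding divide_inverse by (intro holomorphic_intros) auto
  then show "(\<lambda>\<omega>. 1 / (z - \<omega>) + 1 / \<omega> + z / \<omega> ^ 2) summable_on L"
    "z \<notin> L \<Longrightarrow> (\<lambda>z. \<Sum>\<^sub>\<infinity>\<omega>\<in>L. 1 / (z - \<omega>) + 1 / \<omega> + z / \<omega> ^ 2) analytic_on {z}"
    using lattice_sum_analytic[OF assms, of "\<lambda>\<omega> z. 1 / (z - \<omega>) + 1 / \<omega> + z / \<omega> ^ 2" "\<lambda>R. 2 * R ^ 2" z]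
      wzeta_term_bound by auto
qed

section \<open>The lattice as a group, and the periods of the Weierstrass functions\<close>

lemma zero_in_lattice: "0 \<in> lattice \<tau>"
  unfolding lattice_def by (rule CollectI, rule exI[of _ 0], rule exI[of _ 0]) simp

lemma lattice_add: "a \<in> lattice \<tau> \<Longrightarrow> b \<in> lattice \<tau> \<Longrightarrow> a + b \<in> lattice \<tau>"
  unfolding lattice_def
proof clarify
  fix a b a' b' :: int
  show "\<exists>c d. of_int a + of_int b * \<tau> + (of_int a' + of_int b' * \<tau>) = of_int c + of_int d * \<tau> \<and> True"
    by (intro exI[of _ "a + a'"] exI[of _ "b + b'"]) (simp add: algebra_simps)
qed

lemma lattice_minus: "a \<in> lattice \<tau> \<Longrightarrow> - a \<in> lattice \<tau>"
  unfolding lattice_def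
proof clarify
  fix a b :: int
  show "\<exists>c d. - (of_int a + of_int b * \<tau>) = of_int c + of_int d * \<tau> \<and> True"
    by (intro exI[of _ "- a"] exI[of _ "- b"]) (simp add: algebra_simps)
qed

lemma lattice_diff: "a \<in> lattice \<tau> \<Longrightarrow> b \<in> lattice \<tau> \<Longrightarrow> a - b \<in> lattice \<tau>"
  using lattice_add[of a \<tau> "- b"] lattice_minus[of b \<tau>] by simp

lemma lattice_add_iff: "\<omega> \<in> lattice \<tau> \<Longrightarrow> z + \<omega> \<in> lattice \<tau> \<longleftrightarrow> z \<in> lattice \<tau>"
  using lattice_add[of z \<tau> \<omega>] lattice_diff[of "z + \<omega>" \<tau> \<omega>] by auto

lemma lattice_1: "1 \<in> lattice \<tau>"
  unfolding lattice_def by (rule CollectI, rule exI[of _ 1], rule exI[of _ 0]) simp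

lemma lattice_tau: "\<tau> \<in> lattice \<tau>"
  unfolding lattice_def by (rule CollectI, rule exI[of _ 0], rule exI[of _ 1]) simp

text \<open>With \<open>1 / 0 = 0\<close> the term at \<open>\<omega> = 0\<close> is exactly the
  principal part \<open>1 / z ^ 2\<close>. The sum then runs over a group and can be reindexed by
  translations.\<close>

lemma wp_eq_lattice_sum:
  assumes "Im \<tau> > 0"
  shows "wp \<tau> z = (\<Sum>\<^sub>\<infinity>\<omega>\<in>lattice \<tau>. 1 / (z - \<omega>) ^ 2 - 1 / \<omega> ^ 2)"
proof -
  have "lattice \<tau> = insert 0 (lattice \<tau> - {0})" using zero_in_lattice by auto
  then show ?thesis unfolding wp_def
    using infsum_insert[OF wp_summable[OF assms, of "lattice \<tau> - {0}" z], of 0] by simp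
qed

lemma wzeta_eq_lattice_sum:
  assumes "Im \<tau> > 0"
  shows "wzeta \<tau> z = (\<Sum>\<^sub>\<infinity>\<omega>\<in>lattice \<tau>. 1 / (z - \<omega>) + 1 / \<omega> + z / \<omega> ^ 2)"
proof -
  have "lattice \<tau> = insert 0 (lattice \<tau> - {0})" using zero_in_lattice by auto
  then show ?thesis unfolding wzeta_def
    using infsum_insert[OF wzeta_summable[OF assms, of "lattice \<tau> - {0}" z], of 0] by simp
qed

lemma bij_lattice_add: "\<omega>0 \<in> lattice \<tau> \<Longrightarrow> bij_betw (\<lambda>\<omega>. \<omega> + \<omega>0) (lattice \<tau>) (lattice \<tau>)"
  by (rule bij_betwI[where g = "\<lambda>\<omega>. \<omega> - \<omega>0"]) (auto simp: lattice_add lattice_diff)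

lemma bij_lattice_reflect: "\<omega>0 \<in> lattice \<tau> \<Longrightarrow> bij_betw (\<lambda>\<omega>. - \<omega>0 - \<omega>) (lattice \<tau>) (lattice \<tau>)"
  by (rule bij_betwI[where g = "\<lambda>\<omega>. - \<omega>0 - \<omega>"]) (auto simp: lattice_diff lattice_minus)

lemma infsum_minus:
  fixes f g :: "'a \<Rightarrow> complex"
  assumes "f summable_on A" "g summable_on A"
  shows "(\<lambda>x. f x - g x) summable_on A" "infsum (\<lambda>x. f x - g x) A = infsum f A - infsum g A"
  using assms summable_on_add[of f A "\<lambda>x. - g x"] infsum_add[of f A "\<lambda>x. - g x"]
  by (simp_all add: summable_on_uminus infsum_uminus)

context
  fixes \<tau> \<omega>0 :: complex
  assumes \<tau>: "Im \<tau> > 0" and \<omega>0: "\<omega>0 \<in> lattice \<tau>"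
begin

text \<open>The reflection \<open>\<omega> \<mapsto> - \<omega>0 - \<omega>\<close> of the lattice
  swaps the two fractions, so the sum is its own negative. Fractions with vanishing denominator take
  part with value 0, which the reflection respects.\<close>

lemma lattice_inverse_square_shift:
  "(\<lambda>\<omega>. 1 / \<omega> ^ 2 - 1 / (\<omega> + \<omega>0) ^ 2) summable_on lattice \<tau>"
  "(\<Sum>\<^sub>\<infinity>\<omega>\<in>lattice \<tau>. 1 / \<omega> ^ 2 - 1 / (\<omega> + \<omega>0) ^ 2) = 0"
proof -
  let ?r = "\<lambda>\<omega>. 1 / \<omega> ^ 2 - 1 / (\<omega> + \<omega>0) ^ 2"
  have "(\<lambda>\<omega>. 1 / (- \<omega>0 - \<omega>) ^ 2 - 1 / \<omega> ^ 2) summable_on lattice \<tau>"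
    by (rule wp_summable[OF \<tau>]) simp
  then have "(\<lambda>\<omega>. - 1 * (1 / (- \<omega>0 - \<omega>) ^ 2 - 1 / \<omega> ^ 2)) summable_on lattice \<tau>"
    by (rule summable_on_cmult_right)
  moreover have "(- \<omega>0 - \<omega>) ^ 2 = (\<omega> + \<omega>0) ^ 2" for \<omega>
    by (simp add: power2_eq_square algebra_simps)
  ultimately show "?r summable_on lattice \<tau>" by simp
  have "infsum ?r (lattice \<tau>) = (\<Sum>\<^sub>\<infinity>\<omega>\<in>lattice \<tau>. ?r (- \<omega>0 - \<omega>))"
    by (rule infsum_reindex_bij_betw[OF bij_lattice_reflect[OF \<omega>0], symmetric])
  also have "(\<lambda>\<omega>. ?r (- \<omega>0 - \<omega>)) = (\<lambda>\<omega>. - ?r \<omega>)"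
    by (rule ext) (simp add: power2_eq_square algebra_simps)
  finally have "infsum ?r (lattice \<tau>) = - infsum ?r (lattice \<tau>)" unfolding infsum_uminus .
  then have "2 * infsum ?r (lattice \<tau>) = 0" unfolding mult_2 eq_neg_iff_add_eq_0 .
  then show "infsum ?r (lattice \<tau>) = 0" by simp
qed

lemma wp_periodic: "wp \<tau> (z + \<omega>0) = wp \<tau> z"
proof -
  let ?t = "\<lambda>z \<omega>. 1 / (z - \<omega>) ^ 2 - 1 / \<omega> ^ 2"
  have "wp \<tau> (z + \<omega>0) = (\<Sum>\<^sub>\<infinity>\<omega>\<in>lattice \<tau>. ?t (z + \<omega>0) (\<omega> + \<omega>0))"
    unfolding wp_eq_lattice_sum[OF \<tau>]
    by (rule infsum_reindex_bij_betw[OF bij_lattice_add[OF \<omega>0], symmetric])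
  also have "(\<lambda>\<omega>. ?t (z + \<omega>0) (\<omega> + \<omega>0)) = (\<lambda>\<omega>. ?t z \<omega> + (1 / \<omega> ^ 2 - 1 / (\<omega> + \<omega>0) ^ 2))"
    by (rule ext) simp
  also have "infsum \<dots> (lattice \<tau>) = wp \<tau> z + 0"
    using wp_summable[OF \<tau>, of "lattice \<tau>" z] lattice_inverse_square_shift
    by (subst infsum_add) (auto simp: wp_eq_lattice_sum[OF \<tau>])
  finally show ?thesis by simp
qed

text \<open>Reindexing by \<open>\<omega>0\<close> changes each term by
  \<open>s \<omega> - z * ?r \<omega>\<close>. The part linear in \<open>z\<close> sums to 0 by
  \<open>lattice_inverse_square_shift\<close>, which is why the increment does not depend on
  \<open>z\<close>.\<close>

lemma wzeta_quasiperiodic: "\<exists>\<eta>. \<forall>z. wzeta \<tau> (z + \<omega>0) = wzeta \<tau> z + \<eta>"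
proof -
  let ?t = "\<lambda>z \<omega>. 1 / (z - \<omega>) + 1 / \<omega> + z / \<omega> ^ 2"
  let ?r = "\<lambda>\<omega>. 1 / \<omega> ^ 2 - 1 / (\<omega> + \<omega>0) ^ 2"
  define s where "s \<omega> = ?t \<omega>0 (\<omega> + \<omega>0) - ?t 0 \<omega>" for \<omega>
  have sh: "(\<lambda>\<omega>. ?t (z + \<omega>0) (\<omega> + \<omega>0)) summable_on lattice \<tau>"
    "(\<Sum>\<^sub>\<infinity>\<omega>\<in>lattice \<tau>. ?t (z + \<omega>0) (\<omega> + \<omega>0)) = wzeta \<tau> (z + \<omega>0)" for z
    using wzeta_summable[OF \<tau>, of "lattice \<tau>" "z + \<omega>0"]
      summable_on_reindex_bij_betw[OF bij_lattice_add[OF \<omega>0], of "?t (z + \<omega>0)"]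
      infsum_reindex_bij_betw[OF bij_lattice_add[OF \<omega>0], of "?t (z + \<omega>0)"]
    by (simp_all add: wzeta_eq_lattice_sum[OF \<tau>])
  have s: "s summable_on lattice \<tau>"
    unfolding s_def using sh(1)[of 0] wzeta_summable[OF \<tau>, of "lattice \<tau>" 0]
    by (intro infsum_minus) auto
  have "wzeta \<tau> (z + \<omega>0) = wzeta \<tau> z + infsum s (lattice \<tau>)" for z
  proof -
    have "(\<lambda>\<omega>. ?t (z + \<omega>0) (\<omega> + \<omega>0)) = (\<lambda>\<omega>. (?t z \<omega> + s \<omega>) - z * ?r \<omega>)"
      by (rule ext) (simp add: s_def diff_divide_distrib add_divide_distrib algebra_simps)
    then have "wzeta \<tau> (z + \<omega>0) = infsum (\<lambda>\<omega>. (?t z \<omega> + s \<omega>) - z * ?r \<omega>) (lattice \<tau>)"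
      using sh(2)[of z] by simp
    also have "\<dots> = infsum (\<lambda>\<omega>. ?t z \<omega> + s \<omega>) (lattice \<tau>) - infsum (\<lambda>\<omega>. z * ?r \<omega>) (lattice \<tau>)"
      by (rule infsum_minus(2)[OF summable_on_add[OF wzeta_summable[OF \<tau> order.refl] s]
            summable_on_cmult_right[OF lattice_inverse_square_shift(1)]])
    also have "infsum (\<lambda>\<omega>. z * ?r \<omega>) (lattice \<tau>) = 0"
      by (simp only: infsum_cmult_right' lattice_inverse_square_shift) simp
    also have "infsum (\<lambda>\<omega>. ?t z \<omega> + s \<omega>) (lattice \<tau>) = wzeta \<tau> z + infsum s (lattice \<tau>)"
      using wzeta_summable[OF \<tau>, of "lattice \<tau>" z] s
      by (subst infsum_add) (auto simp: wzeta_eq_lattice_sum[OF \<tau>])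
    finally show ?thesis by simp
  qed
  then show ?thesis by blast
qed

end

lemma
  assumes "Im \<tau> > 0" "z \<notin> lattice \<tau>"
  shows wp_analytic: "wp \<tau> analytic_on {z}" and wzeta_analytic: "wzeta \<tau> analytic_on {z}"
  using wp_sum_analytic[OF assms(1) order.refl assms(2)] wzeta_sum_analytic[OF assms(1) order.refl assms(2)]
  by (simp_all add: wp_eq_lattice_sum[OF assms(1), abs_def] wzeta_eq_lattice_sum[OF assms(1), abs_def])

lemma
  assumes "Im \<tau> > 0"
  shows wp_expansion_0: "\<exists>F. (\<lambda>w. wp \<tau> w) has_laurent_expansion fls_X_inv ^ 2 + fps_to_fls F"
    and wzeta_expansion_0: "\<exists>F. (\<lambda>w. wzeta \<tau> w) has_laurent_expansion fls_X_inv + fps_to_fls F"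
proof -
  have "(\<lambda>w. 1 / w ^ 2 + f w) has_laurent_expansion fls_X_inv ^ 2 + fps_to_fls (fps_expansion f 0)"
    and "(\<lambda>w. 1 / w + f w) has_laurent_expansion fls_X_inv + fps_to_fls (fps_expansion f 0)"
    if "f analytic_on {0}" for f :: "complex \<Rightarrow> complex"
    unfolding inverse_eq_divide[symmetric] power_inverse[symmetric]
    by (intro laurent_expansion_intros has_laurent_expansion_fps analytic_at_imp_has_fps_expansion_0 that)+
  then show "\<exists>F. (\<lambda>w. wp \<tau> w) has_laurent_expansion fls_X_inv ^ 2 + fps_to_fls F"
    "\<exists>F. (\<lambda>w. wzeta \<tau> w) has_laurent_expansion fls_X_inv + fps_to_fls F"
    unfolding wp_def wzeta_def
    using wp_sum_analytic[OF assms, of "lattice \<tau> - {0}" 0] wzeta_sum_analytic[OF assms, of "lattice \<tau> - {0}" 0]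
    by blast+
qed

section \<open>Residues of elliptic functions\<close>

lemma contour_integral_linepath_translate:
  "contour_integral (linepath (a + c) (b + c)) f = contour_integral (linepath a b) (\<lambda>z. f (z + c))"
proof -
  have "linepath (a + c) (b + c) x = linepath a b x + c" for x :: real
    by (simp add: linepath_def scaleR_conv_of_real algebra_simps)
  then show ?thesis by (simp add: contour_integral_integral)
qed

text \<open>The residue theorem will be applied to an axis-parallel rectangle, although a period
  cell is a parallelogram: translation by \<open>\<tau>\<close> takes the bottom side to the height
  of the top side, but displaced by \<open>Re \<tau>\<close>. This lemma removes the
  displacement.\<close>

lemma horizontal_period_integral:
  fixes f :: "complex \<Rightarrow> complex" and \<rho> :: real
  assumes cont: "continuous_on {z. Im z = Im c} f"
    and per: "\<And>z. Im z = Im c \<Longrightarrow> f (z + 1) = f z"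
  shows "contour_integral (linepath (c + \<rho>) (c + \<rho> + 1)) f = contour_integral (linepath c (c + 1)) f"
proof -
  have *: "contour_integral (linepath (c + \<rho>) (c + \<rho> + 1)) f = contour_integral (linepath c (c + 1)) f"
    if "\<rho> \<ge> 0" and cont: "continuous_on {z. Im z = Im c} f"
      and per: "\<And>z. Im z = Im c \<Longrightarrow> f (z + 1) = f z" for c and \<rho> :: real
  proof -
    have co: "continuous_on (closed_segment (c + of_real a) (c + of_real b)) f" for a b :: real
      by (rule continuous_on_subset[OF cont])
         (auto simp: closed_segment_same_Im)
    have seg: "c + of_real x \<in> closed_segment c (c + of_real y)" if "0 \<le> x" "x \<le> y" for x y :: real
      using that by (auto simp: closed_segment_same_Im closed_segment_eq_real_ivl)
    have "contour_integral (linepath c (c + of_real (1 + \<rho>))) f =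
      contour_integral (linepath c (c + of_real 1)) f + contour_integral (linepath (c + of_real 1) (c + of_real (1 + \<rho>))) f"
      using co[of 0 "1 + \<rho>"] seg[of 1 "1 + \<rho>"] \<open>\<rho> \<ge> 0\<close> by (intro contour_integral_split_linepath) auto
    moreover have "contour_integral (linepath c (c + of_real (1 + \<rho>))) f =
      contour_integral (linepath c (c + of_real \<rho>)) f + contour_integral (linepath (c + of_real \<rho>) (c + of_real (1 + \<rho>))) f"
      using co[of 0 "1 + \<rho>"] seg[of \<rho> "1 + \<rho>"] \<open>\<rho> \<ge> 0\<close> by (intro contour_integral_split_linepath) auto
    moreover have "contour_integral (linepath (c + 1) (c + of_real \<rho> + 1)) f = contour_integral (linepath c (c + of_real \<rho>)) f"
      unfolding contour_integral_linepath_translate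
      by (rule contour_integral_cong) (auto simp: closed_segment_same_Im per)
    ultimately show ?thesis by (simp add: algebra_simps)
  qed
  show ?thesis
  proof (cases "\<rho> \<ge> 0")
    case True then show ?thesis using * cont per by blast
  next
    case False
    then show ?thesis using *[of "- \<rho>" "c + \<rho>"] cont per by auto
  qed
qed

lemma countable_lattice: "countable (lattice \<tau>)"
proof -
  have "lattice \<tau> = (\<lambda>(a, b). of_int a + of_int b * \<tau>) ` (UNIV :: (int \<times> int) set)"
    by (auto simp: lattice_def)
  then show ?thesis by simp
qed

lemma closed_lattice:
  assumes "Im \<tau> > 0"
  shows "closed (lattice \<tau>)"
proof -
  have "\<exists>T. open T \<and> z \<in> T \<and> T \<subseteq> - lattice \<tau>" if z: "z \<in> - lattice \<tau>" for z
  proof -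
    define U where "U = ball 0 (norm z + 1) - {\<omega>\<in>lattice \<tau>. norm \<omega> \<le> norm z + 1}"
    have "open U" using finite_lattice_bounded[OF assms, of "norm z + 1"]
      unfolding U_def by (intro open_Diff finite_imp_closed) auto
    moreover have "z \<in> U" "U \<subseteq> - lattice \<tau>" using z by (auto simp: U_def)
    ultimately show ?thesis by blast
  qed
  then have "open (- lattice \<tau>)" using open_subopen[of "- lattice \<tau>"] by blast
  then show ?thesis by (simp add: closed_def)
qed

lemma avoid_countable: "countable A \<Longrightarrow> \<exists>x::real. x \<notin> A"
  by (metis UNIV_eq_I uncountable_UNIV_real)

definition pole_free :: "complex \<Rightarrow> ('i::finite \<Rightarrow> complex) \<Rightarrow> complex set" where
  "pole_free \<tau> p = {z. \<forall>i. z - p i \<notin> lattice \<tau>}"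

lemma pole_free_shift: "\<omega> \<in> lattice \<tau> \<Longrightarrow> z + \<omega> \<in> pole_free \<tau> p \<longleftrightarrow> z \<in> pole_free \<tau> p"
  using lattice_add_iff[of \<omega> \<tau> "z - p _"] by (simp add: pole_free_def algebra_simps)

lemma open_pole_free:
  assumes "Im \<tau> > 0"
  shows "open (pole_free \<tau> p)"
proof -
  have "pole_free \<tau> p = (\<Inter>i. - ((\<lambda>z. z - p i) -` lattice \<tau>))" by (auto simp: pole_free_def)
  moreover have "open (- ((\<lambda>z. z - p i) -` lattice \<tau>))" for i
    by (intro open_Compl closed_vimage[OF closed_lattice[OF assms]] continuous_intros)
  ultimately show ?thesis by (simp add: open_INT)
qed

text \<open>Periodicity cancels the integrals over opposite sides of a rectangle of width 1 and
  height \<open>Im \<tau>\<close>. Each class \<open>p i + lattice \<tau>\<close> meets its interior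
  in exactly one point \<open>q i\<close>, where the residue is the same as at
  \<open>p i\<close>.\<close>

theorem sum_residues_elliptic:
  fixes p :: "'i::finite \<Rightarrow> complex" and f :: "complex \<Rightarrow> complex"
  assumes \<tau>: "Im \<tau> > 0" and p: "\<And>i j. i \<noteq> j \<Longrightarrow> p i - p j \<notin> lattice \<tau>"
    and holo: "f holomorphic_on pole_free \<tau> p"
    and per: "\<And>z \<omega>. z \<in> pole_free \<tau> p \<Longrightarrow> \<omega> \<in> lattice \<tau> \<Longrightarrow> f (z + \<omega>) = f z"
  shows "(\<Sum>i\<in>UNIV. residue f (p i)) = 0"
proof -
  let ?D = "pole_free \<tau> p" and ?\<sigma> = "Im \<tau>"
  have cP: "countable (\<Union>i. (\<lambda>\<omega>. p i + \<omega>) ` lattice \<tau>)"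
    using countable_lattice by auto
  \<comment> \<open>There are only countably many poles, so the corner \<open>(x0, y0)\<close> can
    be chosen such that none of them lies on a side of the rectangle.\<close>
  then obtain x0 where x0: "x0 \<notin> Re ` (\<Union>i. (\<lambda>\<omega>. p i + \<omega>) ` lattice \<tau>)"
    using avoid_countable[OF countable_image[OF cP]] by blast
  obtain y0 where y0: "y0 \<notin> Im ` (\<Union>i. (\<lambda>\<omega>. p i + \<omega>) ` lattice \<tau>)"
    using avoid_countable[OF countable_image[OF cP]] by blast
  have pole: "\<exists>i. \<exists>\<omega>\<in>lattice \<tau>. z = p i + \<omega>" if z: "z \<notin> ?D" for z
  proof -
    obtain i where "z - p i \<in> lattice \<tau>" using z by (auto simp: pole_free_def)
    then show ?thesis by (intro exI[of _ i] bexI[of _ "z - p i"]) auto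
  qed
  have Re_ne: "Re z \<noteq> x0" and Im_ne: "Im z \<noteq> y0" if "z \<notin> ?D" for z
  proof -
    have "z \<in> (\<Union>i. (\<lambda>\<omega>. p i + \<omega>) ` lattice \<tau>)" using pole[OF that] by blast
    then show "Re z \<noteq> x0" "Im z \<noteq> y0" using x0 y0 by blast+
  qed
  define a b where "a = Complex x0 y0" and "b = Complex (x0 + 1) (y0 + ?\<sigma>)"
  define a2 a4 where "a2 = Complex (x0 + 1) y0" and "a4 = Complex x0 (y0 + ?\<sigma>)"
  have bd: "z \<in> ?D" if "Re z \<in> {x0, x0 + 1} \<or> Im z \<in> {y0, y0 + ?\<sigma>}" for z
  proof (rule ccontr)
    assume z: "z \<notin> ?D"
    then have "z - 1 \<notin> ?D" "z - \<tau> \<notin> ?D"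
      using pole_free_shift[of "-1" \<tau> z p] pole_free_shift[of "-\<tau>" \<tau> z p] lattice_1 lattice_tau lattice_minus
      by auto
    then show False using that Re_ne[OF z] Im_ne[OF z] Re_ne[of "z - 1"] Im_ne[of "z - \<tau>"] by auto
  qed
  have cont: "continuous_on S f" if "S \<subseteq> ?D" for S
    using holomorphic_on_imp_continuous_on[OF holo] continuous_on_subset that by blast
  have segs: "closed_segment a a2 \<subseteq> ?D" "closed_segment a2 b \<subseteq> ?D" "closed_segment b a4 \<subseteq> ?D"
    "closed_segment a4 a \<subseteq> ?D" "closed_segment a4 b \<subseteq> ?D" "closed_segment a a4 \<subseteq> ?D"
    using bd by (auto simp: a_def b_def a2_def a4_def closed_segment_same_Re closed_segment_same_Im)
  have sh: "a + \<tau> = a4 + of_real (Re \<tau>)" "a2 + \<tau> = a4 + of_real (Re \<tau>) + 1" "a4 + 1 = b"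
    by (auto simp: a_def a2_def a4_def b_def complex_eq_iff)
  have "contour_integral (linepath a a2) f = contour_integral (linepath a a2) (\<lambda>z. f (z + \<tau>))"
    using segs(1) per lattice_tau by (intro contour_integral_cong refl) auto
  also have "\<dots> = contour_integral (linepath (a + \<tau>) (a2 + \<tau>)) f"
    by (rule contour_integral_linepath_translate[symmetric])
  also have "\<dots> = contour_integral (linepath a4 (a4 + 1)) f"
    unfolding sh(1,2)
  proof (rule horizontal_period_integral)
    have line: "z \<in> ?D" if "Im z = Im a4" for z using bd[of z] that by (simp add: a4_def)
    show "continuous_on {z. Im z = Im a4} f" by (rule cont) (use line in auto)
    show "f (z + 1) = f z" if "Im z = Im a4" for z by (rule per[OF line[OF that] lattice_1])
  qed
  also have "\<dots> = contour_integral (linepath a4 b) f" by (simp only: sh(3))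
  also have "\<dots> = - contour_integral (linepath b a4) f"
    using segs by (intro contour_integral_reverse_linepath cont)
  finally have hor: "contour_integral (linepath a a2) f + contour_integral (linepath b a4) f = 0" by simp
  have sh': "a2 = a + 1" "b = a4 + 1" by (auto simp: a_def a2_def a4_def b_def complex_eq_iff)
  have "contour_integral (linepath a2 b) f = contour_integral (linepath a a4) (\<lambda>z. f (z + 1))"
    unfolding sh' by (rule contour_integral_linepath_translate)
  also have "\<dots> = contour_integral (linepath a a4) f"
    using segs(6) per lattice_1 by (intro contour_integral_cong refl) auto
  also have "\<dots> = - contour_integral (linepath a4 a) f"
    using segs by (intro contour_integral_reverse_linepath cont)
  finally have ver: "contour_integral (linepath a2 b) f + contour_integral (linepath a4 a) f = 0" by simp
  have "contour_integral (rectpath a b) f = contour_integral (linepath a a2) f + (contour_integral (linepath a2 b) f +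
      (contour_integral (linepath b a4) f + contour_integral (linepath a4 a) f))"
  proof -
    have "rectpath a b = linepath a a2 +++ linepath a2 b +++ linepath b a4 +++ linepath a4 a"
      by (simp add: rectpath_def a_def b_def a2_def a4_def Let_def)
    then show ?thesis
      using segs by (simp add: cont contour_integrable_continuous_linepath)
  qed
  then have int0: "contour_integral (rectpath a b) f = 0" using hor ver by (simp add: algebra_simps)

  have "\<exists>\<omega>\<in>lattice \<tau>. p i + \<omega> \<in> box a b" for i
  proof -
    \<comment> \<open>The imaginary part is reduced first, by \<open>k\<close> periods
      \<open>\<tau>\<close>; the \<open>m\<close> unit shifts then adjust the real part without
      changing it.\<close>
    define k where "k = \<lfloor>(Im (p i) - y0) / ?\<sigma>\<rfloor>"
    define m where "m = \<lfloor>Re (p i - of_int k * \<tau>) - x0\<rfloor>"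
    define \<omega> where "\<omega> = of_int (- m) + of_int (- k) * \<tau>"
    have \<omega>: "\<omega> \<in> lattice \<tau>" 
      unfolding lattice_def \<omega>_def by (rule CollectI, rule exI[of _ "- m"], rule exI[of _ "- k"]) simp
    then have nD: "p i + \<omega> \<notin> ?D" unfolding pole_free_def by (auto intro: exI[of _ i])
    have "of_int k * ?\<sigma> \<le> Im (p i) - y0" "Im (p i) - y0 < (of_int k + 1) * ?\<sigma>"
      using \<tau> floor_correct[of "(Im (p i) - y0) / ?\<sigma>"] unfolding k_def[symmetric]
      by (simp_all add: pos_le_divide_eq pos_divide_less_eq)
    then have "y0 \<le> Im (p i + \<omega>)" "Im (p i + \<omega>) < y0 + ?\<sigma>" by (auto simp: \<omega>_def algebra_simps)
    moreover have "x0 \<le> Re (p i + \<omega>)" "Re (p i + \<omega>) < x0 + 1"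
      using floor_correct[of "Re (p i - of_int k * \<tau>) - x0"] unfolding m_def[symmetric]
      by (auto simp: \<omega>_def)
    ultimately have "p i + \<omega> \<in> box a b"
      using Re_ne[OF nD] Im_ne[OF nD] by (auto simp: in_box_complex_iff a_def b_def)
    then show ?thesis using \<omega> by blast
  qed
  then have "\<forall>i. \<exists>\<omega>. \<omega> \<in> lattice \<tau> \<and> p i + \<omega> \<in> box a b" by blast
  from choice[OF this] obtain \<omega> where \<omega>: "\<And>i. \<omega> i \<in> lattice \<tau>" "\<And>i. p i + \<omega> i \<in> box a b" by blast
  define q where "q i = p i + \<omega> i" for i
  have q_iff: "z \<notin> ?D \<and> z \<in> box a b \<longleftrightarrow> z \<in> range q" for z
  proof
    assume z: "z \<notin> ?D \<and> z \<in> box a b"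
    then obtain i \<omega>' where i: "\<omega>' \<in> lattice \<tau>" "z = p i + \<omega>'" using pole by blast
    then have "z - q i \<in> lattice \<tau>" using lattice_diff[OF i(1) \<omega>(1)[of i]] by (simp add: q_def)
    then obtain c d :: int where cd: "z - q i = of_int c + of_int d * \<tau>" by (auto simp: lattice_def)
    have "\<bar>Im (z - q i)\<bar> < ?\<sigma>" "\<bar>Re (z - q i)\<bar> < 1"
      using z \<omega>(2)[of i] by (auto simp: in_box_complex_iff a_def b_def q_def abs_less_iff)
    then have "\<bar>of_int d * ?\<sigma>\<bar> < 1 * ?\<sigma>" "\<bar>Re (of_int c + of_int d * \<tau>)\<bar> < 1" by (simp_all add: cd)
    then have "\<bar>real_of_int d\<bar> < 1" "\<bar>Re (of_int c + of_int d * \<tau>)\<bar> < 1"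
      using \<tau> by (simp_all add: abs_mult)
    then have "d = 0" by linarith
    moreover have "c = 0" using \<open>\<bar>Re (of_int c + of_int d * \<tau>)\<bar> < 1\<close> \<open>d = 0\<close> by simp
    ultimately have "d = 0" "c = 0" by blast+
    then show "z \<in> range q" using cd by auto
  next
    assume "z \<in> range q"
    then obtain i where i: "z = p i + \<omega> i" by (auto simp: q_def)
    then have "z - p i \<in> lattice \<tau>" using \<omega>(1) by simp
    then have "z \<notin> ?D" unfolding pole_free_def by blast
    then show "z \<notin> ?D \<and> z \<in> box a b" using \<omega>(2) i by simp
  qed
  have inj: "inj q"
  proof (rule injI, rule ccontr)
    fix i j assume "q i = q j" "i \<noteq> j"
    then have "p i - p j = \<omega> j - \<omega> i" by (simp add: q_def algebra_simps)
    then show False using p[OF \<open>i \<noteq> j\<close>] lattice_diff[OF \<omega>(1)[of j] \<omega>(1)[of i]] by simp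
  qed
  define S where "S = box (a - Complex 1 1) (b + Complex 1 1)"
  define pts where "pts = S - ?D"
  have "cbox a b \<subseteq> S"
    by (auto simp: S_def in_box_complex_iff in_cbox_complex_iff a_def b_def)
  then have S: "open S" "connected S" "bounded S" "cbox a b \<subseteq> S"
    by (simp_all add: S_def open_box convex_connected convex_box bounded_box)
  have finpts: "finite pts"
  proof -
    obtain B where B: "\<And>z. z \<in> S \<Longrightarrow> norm z \<le> B" using S(3) by (auto simp: bounded_iff)
    have "pts \<subseteq> (\<Union>i. (\<lambda>\<omega>. p i + \<omega>) ` {\<omega>\<in>lattice \<tau>. norm \<omega> \<le> B + norm (p i)})"
    proof
      fix z assume z: "z \<in> pts"
      then have "z \<notin> ?D" by (simp add: pts_def)
      from pole[OF this] obtain i \<omega>' where i: "\<omega>' \<in> lattice \<tau>" "z = p i + \<omega>'" by blast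
      have "norm \<omega>' \<le> norm z + norm (p i)" using norm_triangle_ineq4[of z "p i"] i by simp
      also have "\<dots> \<le> B + norm (p i)" using z B by (auto simp: pts_def)
      finally show "z \<in> (\<Union>i. (\<lambda>\<omega>. p i + \<omega>) ` {\<omega>\<in>lattice \<tau>. norm \<omega> \<le> B + norm (p i)})"
        using i by blast
    qed
    then show ?thesis by (rule finite_subset) (simp add: finite_lattice_bounded[OF \<tau>])
  qed
  have le: "Re a \<le> Re b" "Im a \<le> Im b" using \<tau> by (auto simp: a_def b_def)
  have img: "path_image (rectpath a b) \<subseteq> ?D"
    using bd unfolding path_image_rectpath[OF le] by (auto simp: a_def b_def)
  have "contour_integral (rectpath a b) f =
      2 * pi * \<i> * (\<Sum>z\<in>pts. winding_number (rectpath a b) z * residue f z)"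
  proof (rule Residue_theorem[OF S(1,2) finpts])
    show "f holomorphic_on S - pts" by (rule holomorphic_on_subset[OF holo]) (auto simp: pts_def)
    show "path_image (rectpath a b) \<subseteq> S - pts"
      using img path_image_rectpath_subset_cbox[OF le] S(4) by (auto simp: pts_def)
    show "\<forall>z. z \<notin> S \<longrightarrow> winding_number (rectpath a b) z = 0"
      using S(4) by (auto intro!: winding_number_rectpath_outside[OF le])
  qed auto
  also have "(\<Sum>z\<in>pts. winding_number (rectpath a b) z * residue f z) = (\<Sum>z\<in>range q. residue f z)"
  proof (rule sum.mono_neutral_cong_right[OF finpts])
    show "range q \<subseteq> pts"
    proof
      fix z assume "z \<in> range q"
      then have "z \<notin> ?D" "z \<in> box a b" using q_iff by blast+
      then show "z \<in> pts" using S(4) box_subset_cbox by (auto simp: pts_def)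
    qed
    show "\<forall>z\<in>pts - range q. winding_number (rectpath a b) z * residue f z = 0"
    proof
      fix z assume z: "z \<in> pts - range q"
      then have "z \<notin> box a b" using q_iff by (auto simp: pts_def)
      moreover have "z \<notin> path_image (rectpath a b)" using z img by (auto simp: pts_def)
      ultimately have "z \<notin> cbox a b" using path_image_rectpath_cbox_minus_box[OF le] by auto
      then show "winding_number (rectpath a b) z * residue f z = 0"
        using winding_number_rectpath_outside[OF le] by simp
    qed
    show "winding_number (rectpath a b) z * residue f z = residue f z" if "z \<in> range q" for z
    proof -
      have "z \<in> box a b" using that q_iff[of z] by blast
      then show ?thesis by (simp add: winding_number_rectpath)
    qed
  qed
  also have "\<dots> = (\<Sum>i\<in>UNIV. residue f (q i))" using inj by (simp add: sum.reindex)
  also have "\<dots> = (\<Sum>i\<in>UNIV. residue f (p i))"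
  proof (rule sum.cong)
    fix i
    \<comment> \<open>Periodicity is known only on \<open>pole_free\<close>. As finitely many poles
      lie within distance 1 of \<open>p i\<close>, a punctured neighbourhood avoids them all, and
      that suffices to compare residues.\<close>
    define A where "A = {z. norm (z - p i) \<le> 1 \<and> z \<notin> ?D}"
    have "A \<subseteq> (\<Union>j. (\<lambda>\<omega>. p j + \<omega>) ` {\<omega>\<in>lattice \<tau>. norm \<omega> \<le> 1 + norm (p i - p j)})"
    proof
      fix z assume z: "z \<in> A"
      then have "z \<notin> ?D" by (simp add: A_def)
      from pole[OF this] obtain j \<omega>' where j: "\<omega>' \<in> lattice \<tau>" "z = p j + \<omega>'" by blast
      have "norm \<omega>' \<le> norm (z - p i) + norm (p i - p j)"
        using norm_triangle_ineq[of "z - p i" "p i - p j"] j by simp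
      then have "norm \<omega>' \<le> 1 + norm (p i - p j)" using z by (auto simp: A_def)
      then show "z \<in> (\<Union>j. (\<lambda>\<omega>. p j + \<omega>) ` {\<omega>\<in>lattice \<tau>. norm \<omega> \<le> 1 + norm (p i - p j)})"
        using j by blast
    qed
    then have "finite A" by (rule finite_subset) (simp add: finite_lattice_bounded[OF \<tau>])
    then have "\<forall>\<^sub>F z in at (p i). z \<in> (ball (p i) 1 - (A - {p i})) - {p i}"
      by (intro eventually_at_in_open open_Diff finite_imp_closed) auto
    then have "\<forall>\<^sub>F z in at (p i). z \<in> ?D"
      by eventually_elim (auto simp: A_def dist_norm norm_minus_commute)
    then have "\<forall>\<^sub>F z in at (p i). f (z + \<omega> i) = f z"
      by eventually_elim (rule per[OF _ \<omega>(1)])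
    then have "residue (\<lambda>z. f (z + \<omega> i)) (p i) = residue f (p i)"
      by (intro residue_cong) auto
    moreover have "residue f (q i) = residue (\<lambda>z. f (z + \<omega> i)) (p i)"
      unfolding q_def using residue_shift_0'[of "p i + \<omega> i" f] residue_shift_0'[of "p i" "\<lambda>z. f (z + \<omega> i)"]
      by (simp add: algebra_simps)
    ultimately show "residue f (q i) = residue f (p i)" by simp
  qed simp
  finally show ?thesis using int0 by simp
qed

section \<open>The formal logarithmic derivative of a solution\<close>

lemma laurent_expansion_wp_wzeta:
  fixes p :: "'i::finite \<Rightarrow> complex"
  assumes \<tau>: "Im \<tau> > 0" and p: "\<And>i j. i \<noteq> j \<Longrightarrow> p i - p j \<notin> lattice \<tau>"
  defines "W \<equiv> \<lambda>i j. laurent_expansion (\<lambda>z. wp \<tau> (z - p j)) (p i)"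
    and "Z \<equiv> \<lambda>i j. laurent_expansion (\<lambda>z. wzeta \<tau> (z - p j)) (p i)"
  shows "s < 0 \<Longrightarrow> fls_nth (W i j) s = (if i = j \<and> s = -2 then 1 else 0)"
    and "s < 0 \<Longrightarrow> fls_nth (Z i j) s = (if i = j \<and> s = -1 then 1 else 0)"
proof -
  assume s: "s < 0"
  show "fls_nth (W i j) s = (if i = j \<and> s = -2 then 1 else 0)"
  proof (cases "i = j")
    case True
    obtain F where "(\<lambda>w. wp \<tau> w) has_laurent_expansion fls_X_inv ^ 2 + fps_to_fls F"
      using wp_expansion_0[OF \<tau>] by blast
    then have "W i j = fls_X_inv ^ 2 + fps_to_fls F"
      unfolding W_def using True by (intro laurent_expansion_eqI) simp
    then show ?thesis using s True by (simp add: fls_X_inv_power_nth)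
  next
    case False
    have "(\<lambda>w. wp \<tau> (p i - p j + w)) has_laurent_expansion fps_to_fls (fps_expansion (wp \<tau>) (p i - p j))"
      by (intro has_laurent_expansion_fps analytic_at_imp_has_fps_expansion wp_analytic \<tau> p False)
    then have "W i j = fps_to_fls (fps_expansion (wp \<tau>) (p i - p j))"
      unfolding W_def by (intro laurent_expansion_eqI) (simp add: algebra_simps)
    then show ?thesis using s False by simp
  qed
  show "fls_nth (Z i j) s = (if i = j \<and> s = -1 then 1 else 0)"
  proof (cases "i = j")
    case True
    obtain F where "(\<lambda>w. wzeta \<tau> w) has_laurent_expansion fls_X_inv + fps_to_fls F"
      using wzeta_expansion_0[OF \<tau>] by blast
    then have "Z i j = fls_X_inv + fps_to_fls F"
      unfolding Z_def using True by (intro laurent_expansion_eqI) simp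
    then show ?thesis using s True by simp
  next
    case False
    have "(\<lambda>w. wzeta \<tau> (p i - p j + w)) has_laurent_expansion fps_to_fls (fps_expansion (wzeta \<tau>) (p i - p j))"
      by (intro has_laurent_expansion_fps analytic_at_imp_has_fps_expansion wzeta_analytic \<tau> p False)
    then have "Z i j = fps_to_fls (fps_expansion (wzeta \<tau>) (p i - p j))"
      unfolding Z_def by (intro laurent_expansion_eqI) (simp add: algebra_simps)
    then show ?thesis using s False by simp
  qed
qed

section \<open>Elliptic functions with poles at the given points\<close>

locale elliptic_poles =
  fixes \<tau> :: complex and p :: "'i::finite \<Rightarrow> complex"
  assumes Im_tau: "Im \<tau> > 0"
    and distinct: "\<And>i j. i \<noteq> j \<Longrightarrow> p i - p j \<notin> lattice \<tau>"
begin

definition elliptic :: "(complex \<Rightarrow> complex) \<Rightarrow> bool" where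
  "elliptic f \<longleftrightarrow> f holomorphic_on pole_free \<tau> p \<and> f meromorphic_on UNIV \<and>
     (\<forall>z\<in>pole_free \<tau> p. \<forall>\<omega>\<in>lattice \<tau>. f (z + \<omega>) = f z)"

lemma elliptic_sum_residues: "elliptic f \<Longrightarrow> (\<Sum>i\<in>UNIV. residue f (p i)) = 0"
  by (rule sum_residues_elliptic[OF Im_tau distinct]) (auto simp: elliptic_def)

lemma elliptic_const: "elliptic (\<lambda>z. c)"
  by (auto simp: elliptic_def)

lemma elliptic_add: "elliptic f \<Longrightarrow> elliptic g \<Longrightarrow> elliptic (\<lambda>z. f z + g z)"
  by (auto simp: elliptic_def intro!: holomorphic_intros meromorphic_intros)

lemma elliptic_mult: "elliptic f \<Longrightarrow> elliptic g \<Longrightarrow> elliptic (\<lambda>z. f z * g z)"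
  by (auto simp: elliptic_def intro!: holomorphic_intros meromorphic_intros)

lemma elliptic_diff: "elliptic f \<Longrightarrow> elliptic g \<Longrightarrow> elliptic (\<lambda>z. f z - g z)"
  by (auto simp: elliptic_def intro!: holomorphic_intros meromorphic_intros)

lemma elliptic_sum: "(\<And>x. x \<in> A \<Longrightarrow> elliptic (f x)) \<Longrightarrow> elliptic (\<lambda>z. \<Sum>x\<in>A. f x z)"
  by (induction A rule: infinite_finite_induct) (auto intro: elliptic_const elliptic_add)

lemma elliptic_deriv:
  assumes "elliptic f"
  shows "elliptic (deriv f)"
proof -
  have op: "open (pole_free \<tau> p)" by (rule open_pole_free[OF Im_tau])
  have "deriv f (z + \<omega>) = deriv f z" if z: "z \<in> pole_free \<tau> p" and \<omega>: "\<omega> \<in> lattice \<tau>" for z \<omega>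
  proof -
    have "z + \<omega> \<in> pole_free \<tau> p" using z \<omega> by (simp add: pole_free_shift)
    then have "(f has_field_derivative deriv f (z + \<omega>)) (at (z + \<omega>))"
      using assms op unfolding elliptic_def by (auto intro: holomorphic_derivI)
    then have "((\<lambda>w. f (w + \<omega>)) has_field_derivative deriv f (z + \<omega>)) (at z)"
      by (subst (asm) DERIV_shift)
    then have "deriv (\<lambda>w. f (w + \<omega>)) z = deriv f (z + \<omega>)" by (rule DERIV_imp_deriv)
    moreover have "deriv (\<lambda>w. f (w + \<omega>)) z = deriv f z"
    proof (rule deriv_cong_ev)
      show "\<forall>\<^sub>F w in nhds z. f (w + \<omega>) = f w"
        using eventually_nhds_in_open[OF op z] assms \<omega> unfolding elliptic_def
        by (auto elim!: eventually_mono)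
    qed simp
    ultimately show ?thesis by simp
  qed
  then show ?thesis using assms op
    by (auto simp: elliptic_def intro!: holomorphic_deriv meromorphic_intros)
qed

lemma pole_free_minus: "z \<in> pole_free \<tau> p \<Longrightarrow> z - p i \<notin> lattice \<tau>"
  by (simp add: pole_free_def)

lemma holomorphic_wp: "(\<lambda>z. wp \<tau> (z - p i)) holomorphic_on pole_free \<tau> p"
  and holomorphic_wzeta: "(\<lambda>z. wzeta \<tau> (z - p i)) holomorphic_on pole_free \<tau> p"
proof -
  have an: "wp \<tau> analytic_on (- lattice \<tau>)" "wzeta \<tau> analytic_on (- lattice \<tau>)"
    by (rule analytic_on_analytic_at[THEN iffD2]; use wp_analytic[OF Im_tau] wzeta_analytic[OF Im_tau] in simp)+
  have "(\<lambda>z. z - p i) ` pole_free \<tau> p \<subseteq> - lattice \<tau>" using pole_free_minus by auto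
  then have "(f \<circ> (\<lambda>z. z - p i)) holomorphic_on pole_free \<tau> p" if "f analytic_on (- lattice \<tau>)" for f
    by (intro holomorphic_on_compose_gen[where t = "- lattice \<tau>"] holomorphic_intros analytic_imp_holomorphic that)
  from this[OF an(1)] this[OF an(2)]
  show "(\<lambda>z. wp \<tau> (z - p i)) holomorphic_on pole_free \<tau> p"
    "(\<lambda>z. wzeta \<tau> (z - p i)) holomorphic_on pole_free \<tau> p" by (simp_all add: o_def)
qed

lemma meromorphic_shift:
  fixes f :: "complex \<Rightarrow> complex"
  assumes "f meromorphic_on UNIV"
  shows "(\<lambda>z. f (z - c)) meromorphic_on UNIV"
  unfolding meromorphic_on_def
proof
  fix z :: complex
  obtain F where "(\<lambda>w. f (z - c + w)) has_laurent_expansion F"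
    using assms unfolding meromorphic_on_def by blast
  then show "\<exists>L. (\<lambda>w. f (z + w - c)) has_laurent_expansion L" by (auto simp: algebra_simps)
qed

lemma elliptic_wp: "elliptic (\<lambda>z. wp \<tau> (z - p i))"
proof -
  have "wp \<tau> (z + \<omega> - p i) = wp \<tau> (z - p i)" if "\<omega> \<in> lattice \<tau>" for z \<omega>
    using wp_periodic[OF Im_tau that, of "z - p i"] by (simp add: algebra_simps)
  then show ?thesis
    by (simp add: elliptic_def holomorphic_wp meromorphic_shift wp_meromorphic[OF Im_tau])
qed

text \<open>The quasi-period increments add up to \<open>\<eta>\<close> times the sum of the
  \<open>a i\<close>, which is 0. On the branches this is the role of the equation
  \<open>A_1 + ... + A_r = 0\<close>.\<close>

lemma elliptic_wzeta_sum:
  assumes "(\<Sum>i\<in>UNIV. a i) = 0"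
  shows "elliptic (\<lambda>z. \<Sum>i\<in>UNIV. a i * wzeta \<tau> (z - p i))"
proof -
  have "(\<Sum>i\<in>UNIV. a i * wzeta \<tau> (z + \<omega> - p i)) = (\<Sum>i\<in>UNIV. a i * wzeta \<tau> (z - p i))"
    if \<omega>: "\<omega> \<in> lattice \<tau>" for z \<omega>
  proof -
    obtain \<eta> where \<eta>: "\<And>z. wzeta \<tau> (z + \<omega>) = wzeta \<tau> z + \<eta>"
      using wzeta_quasiperiodic[OF Im_tau \<omega>] by blast
    have "(\<Sum>i\<in>UNIV. a i * wzeta \<tau> (z + \<omega> - p i)) = (\<Sum>i\<in>UNIV. a i * wzeta \<tau> (z - p i) + a i * \<eta>)"
    proof (rule sum.cong)
      fix i
      have "z + \<omega> - p i = z - p i + \<omega>" by simp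
      then show "a i * wzeta \<tau> (z + \<omega> - p i) = a i * wzeta \<tau> (z - p i) + a i * \<eta>"
        by (simp only: \<eta> distrib_left)
    qed simp
    also have "\<dots> = (\<Sum>i\<in>UNIV. a i * wzeta \<tau> (z - p i))"
      by (simp add: sum.distrib assms flip: sum_distrib_right)
    finally show ?thesis .
  qed
  then show ?thesis
    by (auto simp: elliptic_def intro!: holomorphic_intros meromorphic_intros holomorphic_wzeta meromorphic_shift wzeta_meromorphic[OF Im_tau])
qed

lemma laurent_expansion_meromorphic:
  "f meromorphic_on UNIV \<Longrightarrow> (\<lambda>w. f (z + w)) has_laurent_expansion laurent_expansion f z"
  by (simp add: meromorphic_on_def')

end

text \<open>The logarithmic derivative \<open>w'/w = \<kappa> + v\<^sub>0 + v\<^sub>1/\<kappa> + \<dots>\<close> of a formal solution of \<open>w'' = Qw\<close> with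
  \<open>B = \<kappa>\<^sup>2\<close> and \<open>A\<^sub>i = \<Sum>\<^sub>j a\<^sub>i\<^sub>j \<kappa>\<^sup>1\<^sup>-\<^sup>j\<close>. The \<open>a\<^sub>i\<^sub>j\<close> are chosen so that only \<open>v\<^sub>0\<close> has residues.\<close>

function wkb :: "complex \<Rightarrow> ('i::finite \<Rightarrow> complex) \<Rightarrow> ('i \<Rightarrow> complex) \<Rightarrow> ('i \<Rightarrow> complex) \<Rightarrow> nat \<Rightarrow> complex \<Rightarrow> complex" where
  "wkb \<tau> p \<nu> c 0 = (\<lambda>z. \<Sum>i\<in>UNIV. \<nu> i * wzeta \<tau> (z - p i))"
| "wkb \<tau> p \<nu> c (Suc j) = (\<lambda>z. ((\<Sum>i\<in>UNIV. residue (\<lambda>z. \<Sum>b\<le>j. wkb \<tau> p \<nu> c b z * wkb \<tau> p \<nu> c (j - b) z) (p i) * wzeta \<tau> (z - p i)) +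
     (\<Sum>i\<in>UNIV. (if j = 0 then c i else 0) * wp \<tau> (z - p i)) -
     deriv (wkb \<tau> p \<nu> c j) z - (\<Sum>b\<le>j. wkb \<tau> p \<nu> c b z * wkb \<tau> p \<nu> c (j - b) z)) * (1 / 2))"
  by pat_completeness auto
termination by (relation "Wellfounded.measure (\<lambda>(\<tau>, p, \<nu>, c, j). j)") auto

context elliptic_poles
begin

text \<open>The induction closes because the coefficients of the zeta functions at the next order
  are the residues of an elliptic function, hence sum to 0, hence give an elliptic function
  again.\<close>

lemma elliptic_wkb:
  assumes "(\<Sum>i\<in>UNIV. \<nu> i) = 0"
  shows "elliptic (wkb \<tau> p \<nu> c j)"
proof (induction j rule: less_induct)
  case (less j)
  show ?case
  proof (cases j)
    case 0
    then show ?thesis by (simp add: elliptic_wzeta_sum assms)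
  next
    case (Suc m)
    have sq: "elliptic (\<lambda>z. \<Sum>b\<le>m. wkb \<tau> p \<nu> c b z * wkb \<tau> p \<nu> c (m - b) z)"
      using less Suc by (intro elliptic_sum elliptic_mult) auto
    show ?thesis
      unfolding Suc wkb.simps
      by (intro elliptic_mult elliptic_const elliptic_diff elliptic_add elliptic_wzeta_sum elliptic_sum_residues sq
          elliptic_sum elliptic_wp elliptic_deriv less) (simp add: Suc)
  qed
qed

text \<open>The last equation is the coefficient of \<open>\<kappa>^(-j)\<close> in the Riccati
  equation \<open>v' + v^2 = Q\<close> for \<open>v = w'/w\<close>, where \<open>\<kappa>^2\<close>
  has cancelled against \<open>B\<close>; the one for \<open>L i 0\<close> is the coefficient of
  \<open>\<kappa>\<close>. Derivatives and \<open>wp\<close> have no residues, so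
  \<open>a i (Suc j)\<close> only has to cancel the residue of the products
  \<open>v_b v_(j-b)\<close>.\<close>

theorem wkb_expansion:
  fixes \<nu> c :: "'i \<Rightarrow> complex"
  assumes \<nu>: "(\<Sum>i\<in>UNIV. \<nu> i) = 0"
  defines "W \<equiv> \<lambda>i j. laurent_expansion (\<lambda>z. wp \<tau> (z - p j)) (p i)"
    and "Z \<equiv> \<lambda>i j. laurent_expansion (\<lambda>z. wzeta \<tau> (z - p j)) (p i)"
  obtains a :: "'i \<Rightarrow> nat \<Rightarrow> complex" and L :: "'i \<Rightarrow> nat \<Rightarrow> complex fls" where
    "\<And>i. a i 0 = 2 * \<nu> i" "\<And>j. (\<Sum>i\<in>UNIV. a i j) = 0"
    "\<And>i j. fls_residue (L i j) = (if j = 0 then \<nu> i else 0)"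
    "\<And>i. 2 * L i 0 = (\<Sum>l\<in>UNIV. fls_const (a l 0) * Z i l)"
    "\<And>i j. 2 * L i (Suc j) = (\<Sum>l\<in>UNIV. fls_const (a l (Suc j)) * Z i l) +
        (\<Sum>l\<in>UNIV. fls_const (if j = 0 then c l else 0) * W i l) -
        fls_deriv (L i j) - (\<Sum>b\<le>j. L i b * L i (j - b))"
proof -
  define v where "v = wkb \<tau> p \<nu> c"
  define sq where "sq j = (\<lambda>z. \<Sum>b\<le>j. v b z * v (j - b) z)" for j
  define a where "a i j = (case j of 0 \<Rightarrow> 2 * \<nu> i | Suc m \<Rightarrow> residue (sq m) (p i))" for i j
  define L where "L i j = laurent_expansion (v j) (p i)" for i j
  have ev: "elliptic (v j)" for j unfolding v_def by (rule elliptic_wkb[OF \<nu>])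
  have es: "elliptic (sq j)" for j unfolding sq_def by (intro elliptic_sum elliptic_mult ev)
  have L: "(\<lambda>w. v j (p i + w)) has_laurent_expansion L i j" for i j
    unfolding L_def using ev[of j] by (intro laurent_expansion_meromorphic) (simp add: elliptic_def)
  have Z: "(\<lambda>w. wzeta \<tau> (p i + w - p j)) has_laurent_expansion Z i j" for i j
    unfolding Z_def using laurent_expansion_meromorphic[OF meromorphic_shift[OF wzeta_meromorphic[OF Im_tau]]] by simp
  have W: "(\<lambda>w. wp \<tau> (p i + w - p j)) has_laurent_expansion W i j" for i j
    unfolding W_def using laurent_expansion_meromorphic[OF meromorphic_shift[OF wp_meromorphic[OF Im_tau]]] by simp
  have Sq: "(\<lambda>w. sq j (p i + w)) has_laurent_expansion (\<Sum>b\<le>j. L i b * L i (j - b))" for i j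
    unfolding sq_def by (intro laurent_expansion_intros L)
  have L': "(\<lambda>w. deriv (v j) (p i + w)) has_laurent_expansion fls_deriv (L i j)" for i j
  proof -
    have "deriv (\<lambda>w. v j (w + p i)) = (\<lambda>w. deriv (v j) (w + p i))"
      by (rule ext) (simp only: deriv_def DERIV_shift)
    then show ?thesis
      using has_laurent_expansion_deriv[OF L[of j i]] by (simp add: add.commute)
  qed
  have sum0: "(\<Sum>i\<in>UNIV. a i j) = 0" for j
    using \<nu> elliptic_sum_residues[OF es] by (cases j) (auto simp: a_def simp flip: sum_distrib_left)
  have L0: "2 * L i 0 = (\<Sum>l\<in>UNIV. fls_const (a l 0) * Z i l)" for i
  proof -
    have "(\<lambda>w. v 0 (p i + w)) has_laurent_expansion (\<Sum>l\<in>UNIV. fls_const (\<nu> l) * Z i l)"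
      unfolding v_def wkb.simps by (intro laurent_expansion_intros Z)
    then have "L i 0 = (\<Sum>l\<in>UNIV. fls_const (\<nu> l) * Z i l)"
      unfolding L_def by (rule laurent_expansion_eqI)
    moreover have "fls_const (2 * x) = 2 * fls_const x" for x :: complex
      by (simp add: fls_const_mult_const[symmetric] del: fls_const_mult_const)
    ultimately show ?thesis by (simp add: a_def sum_distrib_left mult.assoc)
  qed
  have LS: "2 * L i (Suc j) = (\<Sum>l\<in>UNIV. fls_const (a l (Suc j)) * Z i l) +
        (\<Sum>l\<in>UNIV. fls_const (if j = 0 then c l else 0) * W i l) -
        fls_deriv (L i j) - (\<Sum>b\<le>j. L i b * L i (j - b))" (is "_ = ?R") for i j
  proof -
    have "(\<lambda>w. v (Suc j) (p i + w)) has_laurent_expansion ?R * fls_const (1 / 2)"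
      unfolding v_def wkb.simps
      unfolding v_def[symmetric] sq_def[symmetric]
      unfolding a_def nat.case
      by (intro has_laurent_expansion_mult has_laurent_expansion_const has_laurent_expansion_diff has_laurent_expansion_add
          has_laurent_expansion_sum Z W Sq L') (rule L)+
    then have "L i (Suc j) = ?R * fls_const (1 / 2)"
      unfolding L_def by (rule laurent_expansion_eqI)
    then have "2 * L i (Suc j) = ?R * (fls_const (1 / 2) * 2)" by (simp only: mult_ac)
    also have "fls_const (1 / 2) * 2 = (1 :: complex fls)"
      by (simp only: fls_const_numeral[symmetric] fls_const_mult_const) simp
    finally show ?thesis by simp
  qed
  have Zres: "fls_residue (Z i l) = (if i = l then 1 else 0)" "fls_residue (W i l) = 0" for i l
    using laurent_expansion_wp_wzeta[where p = p and \<tau> = \<tau> and s = "-1", OF Im_tau distinct] by (auto simp: Z_def W_def)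
  have res: "fls_residue (L i j) = (if j = 0 then \<nu> i else 0)" for i j
  proof -
    have "fls_residue (2 * L i j) = (if j = 0 then 2 * \<nu> i else 0)"
    proof (cases j)
      case 0
      have "fls_residue (2 * L i 0) = (\<Sum>l\<in>UNIV. a l 0 * (if i = l then 1 else 0))"
        using Zres unfolding L0 by (simp add: fls_nth_sum)
      then show ?thesis using 0 by (simp add: a_def if_distrib cong: if_cong)
    next
      case (Suc m)
      have "fls_residue (\<Sum>b\<le>m. L i b * L i (m - b)) = residue (sq m) (p i)"
        using has_laurent_expansion_residue[OF Sq] by simp
      then have "fls_residue (2 * L i (Suc m)) = (\<Sum>l\<in>UNIV. a l (Suc m) * (if i = l then 1 else 0)) - residue (sq m) (p i)"
        using Zres unfolding LS by (simp add: fls_nth_sum)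
      then show ?thesis using Suc by (simp add: a_def if_distrib cong: if_cong)
    qed
    then show ?thesis by (auto split: if_splits)
  qed
  show ?thesis by (rule that[of a L]) (use sum0 L0 LS res in \<open>auto simp: a_def\<close>)
qed

end

section \<open>Formal power series with Laurent coefficients\<close>

unbundle fps_syntax
unbundle no vec_syntax

text \<open>For the series in question only bounds on the pole orders are known, not the exact
  subdegrees; any such bounds may delimit the convolution.\<close>

lemma fls_times_nth_cutoff:
  fixes f g :: "'a::comm_ring_1 fls"
  assumes "\<And>s. s < a \<Longrightarrow> f $$ s = 0" "\<And>s. s < b \<Longrightarrow> g $$ s = 0"
  shows "(f * g) $$ n = (\<Sum>i\<in>{a..n - b}. f $$ i * g $$ (n - i))"
proof -
  let ?S = "{min a (fls_subdegree f)..max (n - b) (n - fls_subdegree g)}"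
  have z: "f $$ i * g $$ (n - i) = 0" if "i < a \<or> i < fls_subdegree f \<or> n - b < i \<or> n - fls_subdegree g < i" for i
    using that assms(1)[of i] assms(2)[of "n - i"] fls_eq0_below_subdegree[of i f]
      fls_eq0_below_subdegree[of "n - i" g] by auto
  have "(f * g) $$ n = (\<Sum>i\<in>{fls_subdegree f..n - fls_subdegree g}. f $$ i * g $$ (n - i))"
    by (rule fls_times_nth(2))
  also have "\<dots> = (\<Sum>i\<in>?S. f $$ i * g $$ (n - i))"
    by (rule sum.mono_neutral_left) (use z in auto)
  also have "\<dots> = (\<Sum>i\<in>{a..n - b}. f $$ i * g $$ (n - i))"
    by (rule sum.mono_neutral_right) (use z in auto)
  finally show ?thesis .
qed

lemma fls_times_nth_zero:
  fixes f g :: "'a::comm_ring_1 fls"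
  assumes "\<And>i. f $$ i * g $$ (n - i) = 0"
  shows "(f * g) $$ n = 0"
  unfolding fls_times_nth(2) using assms by (intro sum.neutral) auto

lemma fls_times_nth_below:
  fixes f g :: "'a::comm_ring_1 fls"
  assumes "\<And>s. s < a \<Longrightarrow> f $$ s = 0" "\<And>s. s < b \<Longrightarrow> g $$ s = 0" "n < a + b"
  shows "(f * g) $$ n = 0"
proof (rule fls_times_nth_zero)
  fix i
  show "f $$ i * g $$ (n - i) = 0"
    using assms(1)[of i] assms(2)[of "n - i"] assms(3) by (cases "i < a") auto
qed

text \<open>Power series in a variable \<open>h\<close> whose coefficients are Laurent series in \<open>z\<close>: the derivative
  \<open>\<partial>/\<partial>z\<close> acts coefficientwise, while \<^const>\<open>fps_deriv\<close> is \<open>\<partial>/\<partial>h\<close>.\<close>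

definition fps_fls_deriv :: "complex fls fps \<Rightarrow> complex fls fps" where
  "fps_fls_deriv F = Abs_fps (\<lambda>j. fls_deriv (F $ j))"

lemma fps_fls_deriv_nth [simp]: "fps_fls_deriv F $ j = fls_deriv (F $ j)"
  by (simp add: fps_fls_deriv_def)

lemma fls_deriv_sum: "fls_deriv (\<Sum>i\<in>A. f i) = (\<Sum>i\<in>A. fls_deriv (f i))"
  by (induction A rule: infinite_finite_induct) auto

lemma fps_fls_deriv_add: "fps_fls_deriv (F + G) = fps_fls_deriv F + fps_fls_deriv G"
  by (rule fps_ext) simp

lemma fps_fls_deriv_mult: "fps_fls_deriv (F * G) = fps_fls_deriv F * G + F * fps_fls_deriv G"
  by (rule fps_ext) (simp add: fps_mult_nth fls_deriv_sum sum.distrib add.commute)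

lemma fps_fls_deriv_fps_deriv: "fps_fls_deriv (fps_deriv F) = fps_deriv (fps_fls_deriv F)"
  by (rule fps_ext) (simp add: fls_of_nat flip: of_nat_Suc)

lemma fps_linear_ode_zero:
  fixes D G :: "'a::{field_char_0} fps"
  assumes "fps_deriv D = G * D" "D $ 0 = 0"
  shows "D = 0"
proof -
  have "D $ j = 0" for j
  proof (induction j rule: less_induct)
    case (less j)
    show ?case
    proof (cases j)
      case (Suc m)
      have "fps_deriv D $ m = (\<Sum>i=0..m. G $ i * D $ (m - i))" by (simp add: assms fps_mult_nth)
      also have "\<dots> = 0" using less Suc by (intro sum.neutral) auto
      finally have "of_nat (Suc m) * D $ Suc m = 0" by simp
      then show ?thesis using Suc of_nat_neq_0[of m] by (simp del: of_nat_Suc)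
    qed (use assms in simp)
  qed
  then show ?thesis by (simp add: fps_eq_iff)
qed

text \<open>A formal substitute for \<open>exp (\<integral> \<Sum>\<^sub>j h\<^sup>j U\<^sub>j dz)\<close>. The pole orders in \<open>z\<close> grow at most
  linearly in the power of \<open>h\<close>.\<close>

lemma formal_exp_integral:
  fixes U :: "complex fls fps"
  assumes U0: "\<And>s. s < 0 \<Longrightarrow> U $ 0 $$ s = 0"
    and res: "\<And>j. fls_residue (U $ j) = 0"
    and pole: "\<And>j s. s < - int j - 1 \<Longrightarrow> U $ j $$ s = 0"
  obtains Y :: "complex fls fps" where "fps_fls_deriv Y = U * Y" "Y $ 0 $$ 0 = 1"
    "\<And>j s. s < - int j \<Longrightarrow> Y $ j $$ s = 0"
proof -
  \<comment> \<open>Composition with \<open>fps_exp 1\<close> needs \<open>T $ 0 = 0\<close>, so the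
    part of \<open>U\<close> constant in \<open>h\<close> is split off; it has no pole by
    \<open>U0\<close> and exponentiates to the ordinary power series \<open>e\<close>. The other
    coefficients have antiderivatives because their residues vanish.\<close>
  define T where "T = Abs_fps (\<lambda>j. if j = 0 then 0 else fls_integral (U $ j))"
  define u where "u = fls_regpart (U $ 0)"
  have U0u: "U $ 0 = fps_to_fls u"
    by (rule fls_eqI) (use U0 in \<open>auto simp: u_def\<close>)
  define e where "e = fps_exp 1 oo fps_integral0 u"
  have e: "fps_deriv e = u * e" "e $ 0 = 1"
    by (simp_all add: e_def fps_compose_deriv fps_deriv_fps_integral mult.commute)
  define Y where "Y = fps_const (fps_to_fls e) * (fps_exp 1 oo T)"
  have T0: "T $ 0 = 0" by (simp add: T_def)
  have dT: "fps_fls_deriv T = U - fps_const (U $ 0)"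
    using res by (intro fps_ext) (simp add: T_def fls_deriv_fls_integral)
  have DY: "fps_deriv Y = fps_deriv T * Y"
    by (simp add: Y_def fps_compose_deriv T0 mult_ac)
  have Y0: "Y $ 0 = fps_to_fls e" by (simp add: Y_def fps_compose_nth)
  \<comment> \<open>The derivatives in \<open>z\<close> and \<open>h\<close> commute, so the defect
    \<open>D\<close> of the equation in \<open>z\<close> satisfies a homogeneous linear equation in
    \<open>h\<close>. It vanishes at \<open>h = 0\<close>, hence identically.\<close>
  define D where "D = fps_fls_deriv Y - U * Y"
  have "fps_deriv D = fps_fls_deriv (fps_deriv Y) - (fps_deriv U * Y + U * fps_deriv Y)"
    by (simp add: D_def fps_fls_deriv_fps_deriv algebra_simps)
  also have "\<dots> = fps_deriv T * D"
    unfolding DY by (simp add: D_def fps_fls_deriv_mult fps_fls_deriv_fps_deriv dT algebra_simps)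
  finally have "fps_deriv D = fps_deriv T * D" .
  moreover have "D $ 0 = 0"
    by (simp add: D_def Y0 U0u fls_deriv_fps_to_fls e fls_times_fps_to_fls)
  ultimately have "D = 0" by (rule fps_linear_ode_zero)
  \<comment> \<open>Integration turns a pole of order \<open>j + 1\<close> into one of order
    \<open>j\<close>, and the recursion from \<open>fps_deriv Y = fps_deriv T * Y\<close> adds these
    orders.\<close>
  moreover have "Y $ j $$ s = 0" if "s < - int j" for j s
    using that
  proof (induction j arbitrary: s rule: less_induct)
    case (less j)
    show ?case
    proof (cases j)
      case 0
      then show ?thesis using less by (simp add: Y0)
    next
      case (Suc m)
      have "fps_deriv Y $ m $$ s = (\<Sum>i=0..m. (fps_deriv T $ i * Y $ (m - i)) $$ s)"
        by (simp add: DY fps_mult_nth fls_nth_sum)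
      also have "\<dots> = 0"
      proof (rule sum.neutral, rule ballI)
        fix i assume i: "i \<in> {0..m}"
        show "(fps_deriv T $ i * Y $ (m - i)) $$ s = 0"
        proof (rule fls_times_nth_below)
          show "Y $ (m - i) $$ s = 0" if "s < - int (m - i)" for s
            using that less Suc by auto
          show "fps_deriv T $ i $$ s = 0" if "s < - int (Suc i)" for s
            using that pole[of "s - 1" "Suc i"] by (simp add: T_def fls_of_nat flip: of_nat_Suc)
          show "s < - int (Suc i) + - int (m - i)" using less(2) Suc i by auto
        qed
      qed
      finally have "of_nat (Suc m) * Y $ Suc m $$ s = 0" by (simp add: fls_of_nat flip: of_nat_Suc)
      then show ?thesis using Suc of_nat_neq_0[of m, where 'a = complex] by (simp del: of_nat_Suc)
    qed
  qed
  ultimately show ?thesis using that[of Y] by (simp add: D_def Y0 e)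
qed

text \<open>The situation at one pole, with \<open>z\<close> centred there and
  \<open>h = 1/\<kappa>\<close>. Here \<open>l = 2n\<close>, \<open>c = n(n+1)\<close> and
  \<open>\<nu> = n - k\<close>; \<open>Q j\<close> is the coefficient of
  \<open>\<kappa>^(1-j)\<close> in the potential without \<open>B = \<kappa>^2\<close>, and
  \<open>R j\<close> is what remains of it after the leading simple pole and the double pole have
  been removed.\<close>

locale local_wkb =
  fixes l k :: nat and \<nu> c :: complex and Q L R :: "nat \<Rightarrow> complex fls"
  assumes kl: "k \<le> l" and nu: "2 * \<nu> = of_nat l - 2 * of_nat k"
    and c: "4 * c = of_nat l * (of_nat l + 2)"
    and residue_L: "\<And>j. fls_residue (L j) = (if j = 0 then \<nu> else 0)"
    and L_0: "2 * L 0 = Q 0"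
    and L_Suc: "\<And>j. 2 * L (Suc j) = Q (Suc j) - fls_deriv (L j) - (\<Sum>b\<le>j. L b * L (j - b))"
    and Q_eq: "\<And>j. Q j = R j + fls_const (if j = 0 then 2 * \<nu> else 0) * fls_X_inv
        + fls_const (if j = 1 then c else 0) * fls_X_inv ^ 2"
    and R_pole: "\<And>j s. s < -1 \<Longrightarrow> R j $$ s = 0" and R_0: "R 0 $$ (-1) = 0"
begin

lemma Q_pole: "s < (if j = 0 then -1 else -2) \<Longrightarrow> Q j $$ s = 0"
  using R_pole[of s j] by (auto simp: Q_eq fls_X_inv_power_nth split: if_splits)

lemma L_pole: "s < - int j - 1 \<Longrightarrow> L j $$ s = 0"
proof (induction j arbitrary: s rule: less_induct)
  case (less j)
  have "2 * L j $$ s = 0"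
  proof (cases j)
    case 0
    then show ?thesis using less.prems Q_pole[of s 0] arg_cong[OF L_0, of "\<lambda>f. f $$ s"] by simp
  next
    case (Suc m)
    have "(L b * L (m - b)) $$ s = 0" if "b \<le> m" for b
      by (rule fls_times_nth_below[of "- int b - 1" _ "- int (m - b) - 1"])
         (use that Suc less in auto)
    moreover have "L m $$ (s + 1) = 0" using Suc less by auto
    moreover have "Q j $$ s = 0" using Suc less.prems by (intro Q_pole) auto
    ultimately show ?thesis
      using arg_cong[OF L_Suc[of m], of "\<lambda>f. f $$ s"] Suc by (simp add: fls_nth_sum)
  qed
  then show ?case by simp
qed

text \<open>This is \<open>h w'' = h Q w\<close> for \<open>w = z^\<nu> e^(\<kappa> z) Y\<close>.
  The exponent \<open>\<nu>\<close> may be half-integral, so \<open>z^\<nu>\<close> never appears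
  itself, only its logarithmic derivative \<open>N\<close>.\<close>

lemma wkb_linear_equation:
  obtains Y :: "complex fls fps" where "Y $ 0 $$ 0 = 1" "\<And>j s. s < - int j \<Longrightarrow> Y $ j $$ s = 0"
    "fps_X * fps_fls_deriv (fps_fls_deriv Y) + 2 * fps_fls_deriv Y
      + 2 * fps_X * fps_const (fls_const \<nu> * fls_X_inv) * fps_fls_deriv Y
      + fps_X * fps_const (fls_const (\<nu>\<^sup>2 - \<nu> - c) * fls_X_inv ^ 2) * Y = Abs_fps R * Y"
proof -
  define N where "N = fps_const (fls_const \<nu> * fls_X_inv)"
  define V where "V = Abs_fps L"
  define U where "U = V - N"
  define C where "C = fps_const (fls_const c * fls_X_inv ^ 2)"
  have U0: "U $ 0 $$ s = 0" if "s < 0" for s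
    using that L_pole[of s 0] residue_L[of 0] by (cases "s = -1") (auto simp: U_def V_def N_def)
  have res: "fls_residue (U $ j) = 0" for j
    using residue_L[of j] by (cases j) (simp_all add: U_def V_def N_def)
  have pole: "U $ j $$ s = 0" if "s < - int j - 1" for j s
    using that L_pole[of s j] by (cases j) (auto simp: U_def V_def N_def)
  obtain Y where Y: "fps_fls_deriv Y = U * Y" "Y $ 0 $$ 0 = 1" "\<And>j s. s < - int j \<Longrightarrow> Y $ j $$ s = 0"
    using formal_exp_integral[OF U0 res pole] by blast
  have dN: "fps_fls_deriv N = - fps_const (fls_const \<nu> * fls_X_inv ^ 2)"
  proof (rule fps_ext)
    fix j
    have "fls_deriv fls_X_inv = - (fls_X_inv ^ 2 :: complex fls)"
      by (rule fls_eqI) (auto simp: fls_X_inv_power_nth)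
    then show "fps_fls_deriv N $ j = (- fps_const (fls_const \<nu> * fls_X_inv ^ 2)) $ j"
      by (cases j) (simp_all add: N_def)
  qed
  have N2: "N * N = fps_const (fls_const (\<nu>\<^sup>2) * fls_X_inv ^ 2)"
    by (simp add: N_def power2_eq_square mult_ac flip: fls_const_mult_const)
  have NC: "fps_const (fls_const (\<nu>\<^sup>2 - \<nu> - c) * fls_X_inv ^ 2) = fps_fls_deriv N + N * N - C"
    unfolding dN N2 C_def
  proof (rule fps_ext)
    fix j
    show "fps_const (fls_const (\<nu>\<^sup>2 - \<nu> - c) * fls_X_inv ^ 2) $ j =
      (- fps_const (fls_const \<nu> * fls_X_inv ^ 2) + fps_const (fls_const (\<nu>\<^sup>2) * fls_X_inv ^ 2)
        - fps_const (fls_const c * fls_X_inv ^ 2)) $ j"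
      by (cases j) (auto intro!: fls_eqI simp: algebra_simps)
  qed
  have Vn: "V $ m = L m" for m by (simp add: V_def)
  have VV: "(V * V) $ m = (\<Sum>b\<le>m. L b * L (m - b))" for m
    by (simp add: Vn fps_mult_nth atMost_atLeast0)
  \<comment> \<open>\<open>V\<close> is \<open>w'/w - \<kappa>\<close>: in
    \<open>v' + v^2 = Q\<close> the squares of \<open>\<kappa>\<close> cancel, and multiplication by
    \<open>h\<close> leaves this equation.\<close>
  have ricc: "2 * V + fps_X * (fps_fls_deriv V + V * V) = Abs_fps Q"
  proof (rule fps_ext)
    fix j
    show "(2 * V + fps_X * (fps_fls_deriv V + V * V)) $ j = Abs_fps Q $ j"
    proof (cases j)
      case 0
      then show ?thesis using L_0 by (simp add: V_def numeral_fps_const)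
    next
      case (Suc m)
      then show ?thesis using L_Suc[of m]
        by (simp add: Vn VV numeral_fps_const)
    qed
  qed
  have QR: "Abs_fps Q = Abs_fps R + 2 * N + fps_X * C"
  proof (rule fps_ext)
    fix j show "Abs_fps Q $ j = (Abs_fps R + 2 * N + fps_X * C) $ j"
    proof (cases j)
      case 0
      then show ?thesis
        by (auto simp: Q_eq N_def numeral_fps_const intro!: fls_eqI)
    next
      case (Suc m)
      then show ?thesis by (cases m) (auto simp: Q_eq N_def C_def numeral_fps_const)
    qed
  qed
  have VU: "V = U + N" by (simp add: U_def)
  have ddY: "fps_fls_deriv (fps_fls_deriv Y) = fps_fls_deriv U * Y + U * (U * Y)"
    by (simp add: Y(1) fps_fls_deriv_mult)
  have "fps_X * fps_fls_deriv (fps_fls_deriv Y) + 2 * fps_fls_deriv Y + 2 * fps_X * N * fps_fls_deriv Y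
      + fps_X * (fps_fls_deriv N + N * N - C) * Y =
    (2 * V + fps_X * (fps_fls_deriv V + V * V)) * Y - 2 * N * Y - fps_X * C * Y"
    unfolding ddY unfolding VU fps_fls_deriv_add Y(1) by (simp add: algebra_simps)
  also have "\<dots> = Abs_fps R * Y" unfolding ricc QR by (simp add: algebra_simps)
  finally show ?thesis using that[of Y] Y(2,3) unfolding NC N_def by blast
qed

text \<open>\<open>y j s\<close> is the coefficient of \<open>h^j z^s\<close> in \<open>Y\<close>.
  The quadratic factor is the indicial polynomial at the exponent \<open>\<nu> + s + 1\<close>, with
  roots \<open>- l/2\<close> and \<open>l/2 + 1\<close>. Its zero at \<open>s = -(l-k) - 1\<close>
  stops the growth of the poles, so the bound \<open>j\<close> on their order improves to
  \<open>l - k\<close> for all \<open>j\<close>. This bound is attained, and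
  \<open>\<nu> - (l-k) = - l/2\<close>: the formal solution starts at the lower Frobenius
  exponent.\<close>

lemma wkb_coefficients:
  obtains y :: "nat \<Rightarrow> int \<Rightarrow> complex" where
    "y 0 0 = 1" "\<And>j s. s < - int j \<Longrightarrow> y j s = 0" "\<And>j s. s < - int (l - k) \<Longrightarrow> y j s = 0"
    "y (l - k) (- int (l - k)) \<noteq> 0"
    "\<And>j s. 2 * of_int s * y j s + (if j = 0 then 0 else
        of_int ((s + int (l - k) + 1) * (s - int k)) * y (j - 1) (s + 1)) =
      (\<Sum>a\<le>j. \<Sum>r\<in>{-1..s - 1 + int (l - k)}. R a $$ r * y (j - a) (s - 1 - r))"
proof -
  obtain Y where Y: "Y $ 0 $$ 0 = 1" "\<And>j s. s < - int j \<Longrightarrow> Y $ j $$ s = 0"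
    and eq: "fps_X * fps_fls_deriv (fps_fls_deriv Y) + 2 * fps_fls_deriv Y
      + 2 * fps_X * fps_const (fls_const \<nu> * fls_X_inv) * fps_fls_deriv Y
      + fps_X * fps_const (fls_const (\<nu>\<^sup>2 - \<nu> - c) * fls_X_inv ^ 2) * Y = Abs_fps R * Y"
    using wkb_linear_equation by blast
  define y where "y j s = Y $ j $$ s" for j s
  define T where "T j s = (\<Sum>a\<le>j. (R a * Y $ (j - a)) $$ (s - 1))" for j s
  have ev: "(of_int (s + 1) * of_int s + 2 * \<nu> * of_int (s + 1) + (\<nu>\<^sup>2 - \<nu> - c)) = (of_int ((s + int (l - k) + 1) * (s - int k)) :: complex)" for s
  proof -
    have "\<nu> = of_nat l / 2 - of_nat k" "c = of_nat l * (of_nat l + 2) / 4"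
      using nu c by (auto simp: field_simps)
    then have "of_int (s + 1) * of_int s + 2 * \<nu> * of_int (s + 1) + (\<nu>\<^sup>2 - \<nu> - c) =
      (of_int s + (of_nat l - of_nat k) + 1) * (of_int s - of_nat k :: complex)"
      by (simp only:) (simp add: field_simps power2_eq_square)
    then show ?thesis using kl by (simp add: of_nat_diff)
  qed
  have rec: "2 * of_int s * y j s + (if j = 0 then 0 else
        of_int ((s + int (l - k) + 1) * (s - int k)) * y (j - 1) (s + 1)) = T j s" for j s
  proof -
    have rhs: "(Abs_fps R * Y) $ j $$ (s - 1) = T j s"
      by (simp add: T_def fps_mult_nth fls_nth_sum atMost_atLeast0)
    have "(fps_X * fps_fls_deriv (fps_fls_deriv Y) + 2 * fps_fls_deriv Y
      + 2 * fps_X * fps_const (fls_const \<nu> * fls_X_inv) * fps_fls_deriv Y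
      + fps_X * fps_const (fls_const (\<nu>\<^sup>2 - \<nu> - c) * fls_X_inv ^ 2) * Y) $ j $$ (s - 1)
      = 2 * of_int s * y j s + (if j = 0 then 0 else
        (of_int (s + 1) * of_int s + 2 * \<nu> * of_int (s + 1) + (\<nu>\<^sup>2 - \<nu> - c)) * y (j - 1) (s + 1))"
    proof (cases j)
      case 0
      then show ?thesis by (simp add: y_def numeral_fps_const mult.assoc)
    next
      case (Suc m)
      have X2: "fls_X_inv ^ 2 * f = fls_shift 2 f" for f :: "complex fls"
      proof -
        have "fls_X_inv ^ 2 * f = fls_X_inv * (fls_X_inv * f)" by (simp only: power2_eq_square mult.assoc)
        also have "\<dots> = fls_shift 2 f" by (simp add: fls_X_inv_times_conv_shift)
        finally show ?thesis .
      qed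
      show ?thesis using Suc
        by (simp add: y_def numeral_fps_const mult.assoc X2 fls_X_inv_times_conv_shift)
           (simp add: algebra_simps fls_shifted_times_simps)
    qed
    then show ?thesis using rhs unfolding eq ev by simp
  qed
  \<comment> \<open>The pair \<open>a = 0\<close>, \<open>r = -1\<close> is the only one that would
    refer back to \<open>y j s\<close> itself; it drops out because \<open>R_0\<close> leaves
    \<open>R 0\<close> without a pole.\<close>
  have Tzero: "T j s = 0" if "\<And>a r. a \<le> j \<Longrightarrow> r \<ge> -1 \<Longrightarrow> a \<noteq> 0 \<or> r \<noteq> -1 \<Longrightarrow> y (j - a) (s - 1 - r) = 0" for j s
    unfolding T_def
  proof (rule sum.neutral, rule ballI, rule fls_times_nth_zero)
    fix a r assume a: "a \<in> {..j}"
    show "R a $$ r * Y $ (j - a) $$ (s - 1 - r) = 0"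
    proof (cases "r < -1 \<or> a = 0 \<and> r = -1")
      case True then show ?thesis using R_pole[of r a] R_0 by auto
    next
      case False then show ?thesis using that[of a r] a by (auto simp: y_def)
    qed
  qed
  have low: "y j s = 0" if "s < - int j" for j s using that Y by (simp add: y_def)
  have poly: "y j s = 0" if "s < - int (l - k)" for j s
  proof -
    \<comment> \<open>Outer induction on \<open>t = j + s\<close>, inner induction on the depth
      \<open>i\<close> of \<open>s\<close> below the cut-off. All terms of \<open>T j s\<close> have
      smaller \<open>t\<close>; the indicial term \<open>y (j - 1) (s + 1)\<close> has the same
      \<open>t\<close> but is one step closer to the cut-off, and at depth 0 its factor is
      0.\<close>
    have "\<forall>i j s. int t = int j + s \<longrightarrow> s = - int (l - k) - 1 - int i \<longrightarrow> y j s = 0" for t :: nat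
    proof (induction t rule: less_induct)
      case (less t)
      show ?case
      proof (rule allI)
        fix i
        show "\<forall>j s. int t = int j + s \<longrightarrow> s = - int (l - k) - 1 - int i \<longrightarrow> y j s = 0"
        proof (induction i)
          have *: "y j s = 0" if ts: "int t = int j + s" "s < - int (l - k)"
            and nxt: "j > 0 \<Longrightarrow> of_int ((s + int (l - k) + 1) * (s - int k)) * y (j - 1) (s + 1) = 0" for j s
          proof -
            have "T j s = 0"
            proof (rule Tzero)
              fix a :: nat and r :: int assume ar: "a \<le> j" "-1 \<le> r" "a \<noteq> 0 \<or> r \<noteq> -1"
              define s' where "s' = s - 1 - r"
              show "y (j - a) (s - 1 - r) = 0"
              proof (cases "int (j - a) + s' < 0")
                case True then show ?thesis using low[of s' "j - a"] by (simp add: s'_def)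
              next
                case False
                define t' where "t' = nat (int (j - a) + s')"
                have t': "t' < t" "int t' = int (j - a) + s'"
                  using ar ts False by (auto simp: t'_def s'_def)
                have "s' = - int (l - k) - 1 - int (nat (- int (l - k) - 1 - s'))"
                  using ar ts by (auto simp: s'_def)
                then show ?thesis using less.IH[OF t'(1)] t'(2) unfolding s'_def by blast
              qed
            qed
            then have "2 * of_int s * y j s = 0" using rec[of s j] nxt by (cases "j = 0") auto
            moreover have "s \<noteq> 0" using ts by auto
            ultimately show ?thesis by simp
          qed
          {
            case 0
            show ?case
            proof (intro allI impI)
              fix j s assume ts: "int t = int j + s" "s = - int (l - k) - 1 - int 0"
              show "y j s = 0"
              proof (rule *)
                show "int t = int j + s" "s < - int (l - k)" using ts by auto
                have "s + int (l - k) + 1 = 0" using ts by simp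
                then show "of_int ((s + int (l - k) + 1) * (s - int k)) * y (j - 1) (s + 1) = 0" by simp
              qed
            qed
          next
            case (Suc i)
            show ?case
            proof (intro allI impI)
              fix j s assume ts: "int t = int j + s" "s = - int (l - k) - 1 - int (Suc i)"
              show "y j s = 0"
              proof (rule *)
                show "int t = int j + s" "s < - int (l - k)" using ts by auto
                assume "j > 0"
                then have "int t = int (j - 1) + (s + 1)" "s + 1 = - int (l - k) - 1 - int i" using ts by auto
                from Suc[rule_format, OF this]
                show "of_int ((s + int (l - k) + 1) * (s - int k)) * y (j - 1) (s + 1) = 0" by simp
              qed
            qed
          }
        qed
      qed
    qed
    from this[of "nat (int j + s)"] show ?thesis
    proof (cases "int j + s < 0")
      case True then show ?thesis using low by simp
    next
      case False
      moreover have "s = - int (l - k) - 1 - int (nat (- int (l - k) - 1 - s))" using that by simp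
      ultimately show ?thesis
        using \<open>\<forall>i j' s'. int (nat (int j + s)) = int j' + s' \<longrightarrow> s' = - int (l - k) - 1 - int i \<longrightarrow> y j' s' = 0\<close>
        by (metis int_nat_eq not_less)
    qed
  qed
  \<comment> \<open>On the diagonal \<open>s = - j\<close> the right-hand side vanishes, and before
    \<open>m = l - k\<close> neither factor of the indicial polynomial is 0, so nonvanishing
    propagates from \<open>y 0 0 = 1\<close>.\<close>
  have diag: "y m (- int m) \<noteq> 0" if "m \<le> l - k" for m
    using that
  proof (induction m)
    case 0 then show ?case using Y by (simp add: y_def)
  next
    case (Suc m)
    have "T (Suc m) (- int (Suc m)) = 0"
      by (rule Tzero, rule low) auto
    then have "2 * of_int (- int (Suc m)) * y (Suc m) (- int (Suc m)) =
        - of_int ((- int (Suc m) + int (l - k) + 1) * (- int (Suc m) - int k)) * y m (- int m)"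
      using rec[of "- int (Suc m)" "Suc m"] by (simp add: eq_neg_iff_add_eq_0)
    moreover have "(- int (Suc m) + int (l - k) + 1) * (- int (Suc m) - int k) \<noteq> 0"
      using Suc.prems by auto
    then have "(of_int ((- int (Suc m) + int (l - k) + 1) * (- int (Suc m) - int k)) :: complex) \<noteq> 0"
      by (simp only: of_int_eq_0_iff) simp
    ultimately show ?case using Suc by auto
  qed
  show ?thesis
  proof (rule that[of y])
    fix j s
    have "T j s = (\<Sum>a\<le>j. \<Sum>r\<in>{-1..s - 1 + int (l - k)}. R a $$ r * y (j - a) (s - 1 - r))"
      unfolding T_def
    proof (rule sum.cong[OF refl])
      fix a assume "a \<in> {..j}"
      show "(R a * Y $ (j - a)) $$ (s - 1) = (\<Sum>r\<in>{-1..s - 1 + int (l - k)}. R a $$ r * y (j - a) (s - 1 - r))"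
        using fls_times_nth_cutoff[of "-1" "R a" "- int (l - k)" "Y $ (j - a)" "s - 1"] R_pole[of _ a] poly[of _ "j - a"]
        by (simp add: y_def)
    qed
    then show "2 * of_int s * y j s + (if j = 0 then 0 else
        of_int ((s + int (l - k) + 1) * (s - int k)) * y (j - 1) (s + 1)) =
      (\<Sum>a\<le>j. \<Sum>r\<in>{-1..s - 1 + int (l - k)}. R a $$ r * y (j - a) (s - 1 - r))"
      using rec by simp
  qed (use Y low poly diag in \<open>auto simp: y_def\<close>)
qed

end

lemma fps_to_fls_sum: "fps_to_fls (\<Sum>i\<in>A. f i) = (\<Sum>i\<in>A. fps_to_fls (f i))" for f :: "'b \<Rightarrow> complex fps"
  by (induction A rule: infinite_finite_induct) (simp_all add: fps_to_fls_plus)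

context local_wkb
begin

text \<open>The roles of \<open>z\<close> and \<open>h\<close> are exchanged: the poles of
  \<open>Y\<close> in \<open>z\<close> being bounded uniformly in \<open>j\<close>, \<open>Y\<close>
  is also a series in \<open>z\<close> whose coefficients are power series in \<open>h\<close>.
  Multiplied by \<open>e^(\<kappa> z)\<close>, which exists over the Laurent series in
  \<open>h\<close>, it becomes \<open>U = z^(l/2) w\<close>. The recursion holds for every
  \<open>m\<close>, in particular for \<open>m = l + 1\<close>, where its left side is 0.
  \<open>q i\<close> is the coefficient of \<open>z^(i-1)\<close> in the potential.\<close>

theorem log_free_series:
  fixes q :: "nat \<Rightarrow> complex fls"
  assumes q: "\<And>i. q i = fls_X_inv * fps_to_fls (Abs_fps (\<lambda>j. R j $$ (int i - 1)))
      + (if i = 0 then fls_X_inv * fls_const (2 * \<nu>) else 0) + (if i = 1 then fls_X_inv ^ 2 else 0)"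
  obtains U :: "nat \<Rightarrow> complex fls" where "U 0 \<noteq> 0"
    "\<And>m. of_nat m * (of_nat m - 1 - of_nat l) * U m = (\<Sum>i<m. q i * U (m - 1 - i))"
proof -
  obtain y where y: "y 0 0 = 1" "\<And>j s. s < - int j \<Longrightarrow> y j s = 0" "\<And>j s. s < - int (l - k) \<Longrightarrow> y j s = 0"
    and y0: "y (l - k) (- int (l - k)) \<noteq> 0"
    and rec: "\<And>j s. 2 * of_int s * y j s + (if j = 0 then 0 else
        of_int ((s + int (l - k) + 1) * (s - int k)) * y (j - 1) (s + 1)) =
      (\<Sum>a\<le>j. \<Sum>r\<in>{-1..s - 1 + int (l - k)}. R a $$ r * y (j - a) (s - 1 - r))"
    by (rule wkb_coefficients, rule that) assumption+
  define p where "p d = Abs_fps (\<lambda>j. y j (int d - int (l - k)))" for d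
  define r where "r i = Abs_fps (\<lambda>j. R j $$ (int i - 1))" for i
  \<comment> \<open>The recursion for \<open>y\<close> at \<open>s = d - (l - k)\<close>, where the
    indicial factor becomes \<open>(d + 1) * (d - l)\<close>.\<close>
  have p: "fps_X * (of_nat (d + 1) * (of_nat d - of_nat l) * p (d + 1)) + 2 * (of_nat d - of_nat (l - k)) * p d =
      (\<Sum>i\<le>d. r i * p (d - i))" for d
  proof (rule fps_ext)
    fix j
    define s where "s = int d - int (l - k)"
    have "(\<Sum>i\<le>d. r i * p (d - i)) $ j = (\<Sum>i\<le>d. \<Sum>a\<le>j. R a $$ (int i - 1) * y (j - a) (s - int i))"
      by (simp add: fps_sum_nth fps_mult_nth r_def p_def s_def of_nat_diff atMost_atLeast0 algebra_simps)
    also have "\<dots> = (\<Sum>a\<le>j. \<Sum>i\<le>d. R a $$ (int i - 1) * y (j - a) (s - int i))"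
      by (rule sum.swap)
    also have "\<dots> = (\<Sum>a\<le>j. \<Sum>r\<in>{-1..s - 1 + int (l - k)}. R a $$ r * y (j - a) (s - 1 - r))"
    proof (rule sum.cong[OF refl], rule sum.reindex_bij_witness[of _ "\<lambda>r. nat (r + 1)" "\<lambda>i. int i - 1"])
    qed (auto simp: s_def algebra_simps)
    also have "\<dots> = 2 * of_int s * y j s + (if j = 0 then 0 else
        of_int ((s + int (l - k) + 1) * (s - int k)) * y (j - 1) (s + 1))"
      by (rule rec[symmetric])
    also have "of_int ((s + int (l - k) + 1) * (s - int k)) = of_nat (d + 1) * (of_nat d - of_nat l :: complex)"
      using kl by (simp add: s_def of_nat_diff)
    finally have *: "(\<Sum>i\<le>d. r i * p (d - i)) $ j = 2 * of_int s * y j s + (if j = 0 then 0 else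
        of_nat (d + 1) * (of_nat d - of_nat l) * y (j - 1) (s + 1))" .
    have c1: "of_nat (d + 1) * (of_nat d - of_nat l) = fps_const (of_nat (d + 1) * (of_nat d - of_nat l) :: complex)"
      "2 * (of_nat d - of_nat (l - k)) = fps_const (2 * (of_nat d - of_nat (l - k)) :: complex)"
      by (simp_all flip: fps_of_nat add: numeral_fps_const)
    have s: "of_int s = (of_nat d - of_nat (l - k) :: complex)" by (simp add: s_def)
    show "(fps_X * (of_nat (d + 1) * (of_nat d - of_nat l) * p (d + 1)) + 2 * (of_nat d - of_nat (l - k)) * p d) $ j =
        (\<Sum>i\<le>d. r i * p (d - i)) $ j"
      unfolding c1 * s by (cases j) (simp_all add: p_def s_def algebra_simps)
  qed
  define \<kappa> where "\<kappa> = (fls_X_inv :: complex fls)"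
  have \<kappa>X: "\<kappa> * fls_X = 1" by (rule fls_eqI) (simp add: \<kappa>_def fls_X_inv_times_conv_shift)
  \<comment> \<open>From here on the outer variable of the power series is \<open>z\<close>: now
    \<open>fps_deriv\<close> is the derivative in \<open>z\<close>, and the coefficients are Laurent
    series in \<open>h\<close>.\<close>
  define P where "P = Abs_fps (\<lambda>d. fps_to_fls (p d))"
  define G where "G = Abs_fps (\<lambda>i. fps_to_fls (r i))"
  have P: "of_nat (d + 1) * (of_nat d - of_nat l) * P $ (d + 1) + 2 * \<kappa> * (of_nat d - of_nat (l - k)) * P $ d =
      \<kappa> * (G * P) $ d" for d
  proof -
    have "fps_to_fls (fps_X * (of_nat (d + 1) * (of_nat d - of_nat l) * p (d + 1)) + 2 * (of_nat d - of_nat (l - k)) * p d) =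
        fps_to_fls (\<Sum>i\<le>d. r i * p (d - i))"
      by (simp only: p)
    then have "fls_X * (of_nat (d + 1) * (of_nat d - of_nat l) * P $ (d + 1)) + 2 * (of_nat d - of_nat (l - k)) * P $ d =
        (G * P) $ d"
      by (simp add: P_def G_def fls_times_fps_to_fls fps_mult_nth atMost_atLeast0 fps_to_fls_sum del: of_nat_Suc)
    then have "\<kappa> * (fls_X * (of_nat (d + 1) * (of_nat d - of_nat l) * P $ (d + 1)) + 2 * (of_nat d - of_nat (l - k)) * P $ d) =
        \<kappa> * (G * P) $ d" by simp
    moreover have "\<kappa> * (fls_X * A + 2 * B * C) = A + 2 * \<kappa> * B * C" for A B C
    proof -
      have "\<kappa> * (fls_X * A + 2 * B * C) = (\<kappa> * fls_X) * A + 2 * \<kappa> * B * C" by (simp only: algebra_simps)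
      then show ?thesis by (simp only: \<kappa>X mult_1)
    qed
    ultimately show ?thesis by (simp only:)
  qed
  let ?K = "fps_const \<kappa>"
  have Peq: "fps_X * fps_deriv (fps_deriv P) - of_nat l * fps_deriv P
      + 2 * ?K * (fps_X * fps_deriv P - of_nat (l - k) * P) = ?K * (G * P)"
  proof (rule fps_ext)
    fix d
    have "(fps_X * fps_deriv (fps_deriv P) - of_nat l * fps_deriv P
      + 2 * ?K * (fps_X * fps_deriv P - of_nat (l - k) * P)) $ d =
      of_nat (d + 1) * (of_nat d - of_nat l) * P $ (d + 1) + 2 * \<kappa> * (of_nat d - of_nat (l - k)) * P $ d"
      by (cases d) (simp_all add: numeral_fps_const mult.assoc algebra_simps flip: fps_of_nat)
    then show "(fps_X * fps_deriv (fps_deriv P) - of_nat l * fps_deriv P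
      + 2 * ?K * (fps_X * fps_deriv P - of_nat (l - k) * P)) $ d = (?K * (G * P)) $ d"
      unfolding P by simp
  qed
  have qG: "Abs_fps q = ?K * G + ?K * (of_nat l - 2 * of_nat k) + fps_X * ?K ^ 2"
  proof (rule fps_ext)
    fix i
    have nu': "fls_const (2 * \<nu>) = of_nat l - 2 * of_nat k"
      unfolding nu by (auto intro!: fls_eqI simp: fls_of_nat_nth)
    show "Abs_fps q $ i = (?K * G + ?K * (of_nat l - 2 * of_nat k) + fps_X * ?K ^ 2) $ i"
    proof (cases i)
      case 0
      then show ?thesis
        by (simp add: q nu' G_def r_def \<kappa>_def numeral_fps_const flip: fps_of_nat)
    next
      case (Suc m)
      then show ?thesis
        by (cases m) (simp_all add: q G_def r_def \<kappa>_def numeral_fps_const algebra_simps power2_eq_square flip: fps_of_nat)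
    qed
  qed
  define E where "E = fps_exp \<kappa>"
  have dE: "fps_deriv E = ?K * E" by (simp add: E_def)
  define U where "U = E * P"
  have lk: "of_nat (l - k) = (of_nat l - of_nat k :: complex fls fps)" using kl by (simp add: of_nat_diff)
  have "fps_X * fps_deriv (fps_deriv U) - of_nat l * fps_deriv U =
     E * (fps_X * fps_deriv (fps_deriv P) - of_nat l * fps_deriv P + 2 * ?K * (fps_X * fps_deriv P - of_nat (l - k) * P))
     + E * (2 * ?K * of_nat (l - k) * P - of_nat l * ?K * P + fps_X * ?K ^ 2 * P)"
    by (simp add: U_def dE algebra_simps power2_eq_square)
  also have "\<dots> = Abs_fps q * U"
    unfolding Peq unfolding qG lk U_def by (simp add: algebra_simps)
  finally have Ueq: "fps_X * fps_deriv (fps_deriv U) - of_nat l * fps_deriv U = Abs_fps q * U" .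
  have "of_nat m * (of_nat m - 1 - of_nat l) * U $ m = (\<Sum>i<m. q i * U $ (m - 1 - i))" for m
  proof (cases m)
    case (Suc d)
    have "(fps_X * fps_deriv (fps_deriv U) - of_nat l * fps_deriv U) $ d = of_nat m * (of_nat m - 1 - of_nat l) * U $ m"
      using Suc by (cases d) (simp_all add: algebra_simps flip: fps_of_nat)
    moreover have "(Abs_fps q * U) $ d = (\<Sum>i<m. q i * U $ (m - 1 - i))"
      using Suc by (simp add: fps_mult_nth atMost_atLeast0 lessThan_Suc_atMost)
    ultimately show ?thesis by (simp add: Ueq)
  qed simp
  moreover have "U $ 0 \<noteq> 0"
  proof -
    have "p 0 $ (l - k) \<noteq> 0" using y0 by (simp add: p_def)
    then have "p 0 \<noteq> 0" by auto
    then show ?thesis by (simp add: U_def E_def P_def)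
  qed
  ultimately show ?thesis by (intro that[of "\<lambda>m. U $ m"])
qed

end

section \<open>The Lefschetz property of monomial complete intersections\<close>

definition nbox :: "('i::finite \<Rightarrow> nat) \<Rightarrow> ('i \<Rightarrow> nat) set" where
  "nbox l = {a. \<forall>i. a i \<le> l i}"

definition level :: "('i::finite \<Rightarrow> nat) \<Rightarrow> nat \<Rightarrow> ('i \<Rightarrow> nat) set" where
  "level l d = {a\<in>nbox l. sum a UNIV = d}"

lemma finite_nbox: "finite (nbox l)"
proof -
  have "nbox l = (\<Pi>\<^sub>E i\<in>UNIV. {..l i})" by (auto simp: nbox_def)
  then show ?thesis by (simp add: finite_PiE)
qed

lemma finite_level: "finite (level l d)"
  using finite_nbox[of l] by (simp add: level_def)

lemma sum_fun_upd: "sum (a(i := x)) UNIV + a i = sum a UNIV + x" for a :: "'i::finite \<Rightarrow> nat"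
  by (simp add: sum.remove[of UNIV i])

text \<open>Multiplication by \<open>A_1 + ... + A_r\<close> modulo all
  \<open>A_i^(l_i + 1)\<close>, written on coefficient functions.\<close>

definition raise :: "('i::finite \<Rightarrow> nat) \<Rightarrow> (('i \<Rightarrow> nat) \<Rightarrow> 'a::comm_ring_1) \<Rightarrow> ('i \<Rightarrow> nat) \<Rightarrow> 'a" where
  "raise l u a = (if a \<in> nbox l then \<Sum>i\<in>UNIV. if a i > 0 then u (a(i := a i - 1)) else 0 else 0)"

text \<open>The factor \<open>(a_i + 1) (l_i - a_i)\<close> is the lowering coefficient of the
  irreducible module of dimension \<open>l_i + 1\<close> in the basis where raising has all
  coefficients 1.\<close>

definition lower :: "('i::finite \<Rightarrow> nat) \<Rightarrow> (('i \<Rightarrow> nat) \<Rightarrow> 'a::comm_ring_1) \<Rightarrow> ('i \<Rightarrow> nat) \<Rightarrow> 'a" where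
  "lower l u a = (if a \<in> nbox l then
     \<Sum>i\<in>UNIV. if a i < l i then of_nat ((a i + 1) * (l i - a i)) * u (a(i := a i + 1)) else 0 else 0)"

lemma nbox_upd_less: "a \<in> nbox l \<Longrightarrow> a i < l i \<Longrightarrow> a(i := a i + 1) \<in> nbox l"
  and nbox_upd_pred: "a \<in> nbox l \<Longrightarrow> a(i := a i - 1) \<in> nbox l"
  by (auto simp: nbox_def) (meson diff_le_self le_trans)

text \<open>The operators \<open>raise\<close> and \<open>lower\<close> generate a representation of \<open>sl\<^sub>2\<close>, the tensor product of
  irreducible ones.\<close>

lemma raise_lower_commutator:
  fixes u :: "('i::finite \<Rightarrow> nat) \<Rightarrow> 'a::comm_ring_1"
  assumes a: "a \<in> nbox l"
  shows "lower l (raise l u) a - raise l (lower l u) a = (of_nat (sum l UNIV) - 2 * of_nat (sum a UNIV)) * u a"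
proof -
  define up where "up b i = b(i := b i + 1)" for b :: "'i \<Rightarrow> nat" and i
  define dn where "dn b i = b(i := b i - 1)" for b :: "'i \<Rightarrow> nat" and i
  define c :: "('i \<Rightarrow> nat) \<Rightarrow> 'i \<Rightarrow> 'a" where "c b i = of_nat ((b i + 1) * (l i - b i))" for b i
  define S where "S i j = (if a i < l i then c a i * (if up a i j > 0 then u (dn (up a i) j) else 0) else 0)" for i j
  define Y where "Y i j = (if a j > 0 then if dn a j i < l i then c (dn a j) i * u (up (dn a j) i) else 0 else 0)" for i j
  have "lower l (raise l u) a = (\<Sum>i\<in>UNIV. \<Sum>j\<in>UNIV. S i j)"
    using a nbox_upd_less[OF a]
    by (auto simp: lower_def raise_def S_def c_def up_def dn_def sum_distrib_left simp del: of_nat_mult intro!: sum.cong)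
  moreover have "raise l (lower l u) a = (\<Sum>j\<in>UNIV. \<Sum>i\<in>UNIV. Y i j)"
    using a nbox_upd_pred[OF a]
    by (auto simp: lower_def raise_def Y_def c_def up_def dn_def simp del: of_nat_mult intro!: sum.cong)
  moreover have "(\<Sum>j\<in>UNIV. \<Sum>i\<in>UNIV. Y i j) = (\<Sum>i\<in>UNIV. \<Sum>j\<in>UNIV. Y i j)"
    by (rule sum.swap)
  ultimately have "lower l (raise l u) a - raise l (lower l u) a = (\<Sum>i\<in>UNIV. \<Sum>j\<in>UNIV. S i j - Y i j)"
    by (simp add: sum_subtractf)
  \<comment> \<open>For \<open>i \<noteq> j\<close> the two operators act on different coordinates
    and commute. The diagonal contributes \<open>(x + 1) (l - x) - x (l - x + 1) = l - 2 x\<close>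
    with \<open>x = a i\<close>.\<close>
  also have "\<dots> = (\<Sum>i\<in>UNIV. \<Sum>j\<in>UNIV. if i = j then (of_nat (l i) - 2 * of_nat (a i)) * u a else 0)"
  proof (intro sum.cong refl)
    fix i j
    show "S i j - Y i j = (if i = j then (of_nat (l i) - 2 * of_nat (a i)) * u a else 0)"
    proof (cases "i = j")
      case True
      have li: "a i \<le> l i" using a by (simp add: nbox_def)
      have Sii: "S i i = of_nat ((a i + 1) * (l i - a i)) * u a"
      proof (cases "a i < l i")
        case True then show ?thesis by (simp add: S_def c_def up_def dn_def algebra_simps)
      next
        case False then show ?thesis using li by (simp add: S_def)
      qed
      have Yii: "Y i i = of_nat (a i * (l i - a i + 1)) * u a"
        using li by (auto simp: Y_def c_def up_def dn_def Suc_diff_le)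
      have c: "(of_nat ((a i + 1) * (l i - a i)) :: 'a) - of_nat (a i * (l i - a i + 1)) = of_nat (l i) - 2 * of_nat (a i)"
        by (simp only: of_nat_mult of_nat_diff[OF li] of_nat_add of_nat_1) (simp add: algebra_simps)
      have "S i i - Y i i = (of_nat (l i) - 2 * of_nat (a i)) * u a"
        unfolding Sii Yii by (simp only: left_diff_distrib[symmetric] c)
      then show ?thesis using True by simp
    next
      case False
      then show ?thesis by (auto simp: S_def Y_def c_def up_def dn_def fun_upd_twist)
    qed
  qed
  also have "\<dots> = (\<Sum>i\<in>UNIV. (of_nat (l i) - 2 * of_nat (a i)) * u a)"
    by simp
  also have "\<dots> = (of_nat (sum l UNIV) - 2 * of_nat (sum a UNIV)) * u a"
    by (simp add: sum_subtractf sum_distrib_left flip: sum_distrib_right)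
  finally show ?thesis .
qed

text \<open>The weights that make \<open>lower\<close> the adjoint of \<open>raise\<close>.\<close>

definition nbox_weight :: "('i::finite \<Rightarrow> nat) \<Rightarrow> ('i \<Rightarrow> nat) \<Rightarrow> real" where
  "nbox_weight l a = (\<Prod>i\<in>UNIV. \<Prod>j<a i. real ((j + 1) * (l i - j)))"

definition nbox_inner :: "('i::finite \<Rightarrow> nat) \<Rightarrow> (('i \<Rightarrow> nat) \<Rightarrow> real) \<Rightarrow> (('i \<Rightarrow> nat) \<Rightarrow> real) \<Rightarrow> real" where
  "nbox_inner l u w = (\<Sum>a\<in>nbox l. nbox_weight l a * (u a * w a))"

lemma nbox_weight_pos: "a \<in> nbox l \<Longrightarrow> nbox_weight l a > 0"
  unfolding nbox_weight_def
proof (intro prod_pos ballI)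
  fix i j assume "a \<in> nbox l" "j \<in> {..<a i}"
  then have "j < l i" unfolding nbox_def by (auto intro: less_le_trans)
  then have "(j + 1) * (l i - j) > 0" by simp
  then show "real ((j + 1) * (l i - j)) > 0" by (simp only: of_nat_0_less_iff)
qed

lemma nbox_weight_upd: "nbox_weight l (a(i := a i + 1)) = real ((a i + 1) * (l i - a i)) * nbox_weight l a"
proof -
  have "nbox_weight l (a(i := a i + 1)) = (\<Prod>j<a i + 1. real ((j + 1) * (l i - j))) *
      (\<Prod>i'\<in>UNIV - {i}. \<Prod>j<a i'. real ((j + 1) * (l i' - j)))"
    unfolding nbox_weight_def by (subst prod.remove[of _ i]) (auto intro!: prod.cong)
  also have "\<dots> = real ((a i + 1) * (l i - a i)) * nbox_weight l a"
    unfolding nbox_weight_def by (subst (2) prod.remove[of _ i]) auto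
  finally show ?thesis .
qed

lemma nbox_inner_adjoint: "nbox_inner l (raise l u) w = nbox_inner l u (lower l w)"
proof -
  have "nbox_inner l (raise l u) w =
      (\<Sum>a\<in>nbox l. \<Sum>i\<in>UNIV. if a i > 0 then nbox_weight l a * (u (a(i := a i - 1)) * w a) else 0)"
    unfolding nbox_inner_def raise_def
    by (intro sum.cong refl) (auto simp: sum_distrib_left sum_distrib_right intro!: sum.cong)
  also have "\<dots> = (\<Sum>i\<in>UNIV. \<Sum>a | a \<in> nbox l \<and> a i > 0. nbox_weight l a * (u (a(i := a i - 1)) * w a))"
    by (subst sum.swap) (intro sum.cong refl sum.inter_filter[OF finite_nbox, symmetric])
  also have "\<dots> = (\<Sum>i\<in>UNIV. \<Sum>b | b \<in> nbox l \<and> b i < l i.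
      real ((b i + 1) * (l i - b i)) * nbox_weight l b * (u b * w (b(i := b i + 1))))"
  proof (rule sum.cong[OF refl])
    fix i
    show "(\<Sum>a | a \<in> nbox l \<and> a i > 0. nbox_weight l a * (u (a(i := a i - 1)) * w a)) =
      (\<Sum>b | b \<in> nbox l \<and> b i < l i. real ((b i + 1) * (l i - b i)) * nbox_weight l b * (u b * w (b(i := b i + 1))))"
    proof (rule sum.reindex_bij_witness[of _ "\<lambda>b. b(i := b i + 1)" "\<lambda>a. a(i := a i - 1)"])
      fix a
      assume a: "a \<in> {a \<in> nbox l. a i > 0}"
      show ab: "(a(i := a i - 1))(i := (a(i := a i - 1)) i + 1) = a" using a by auto
      have "a i - 1 < l i" using a by (auto simp: nbox_def Suc_le_lessD)
      then show "a(i := a i - 1) \<in> {b \<in> nbox l. b i < l i}"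
        using a nbox_upd_pred[of a l i] by simp
      show "real (((a(i := a i - 1)) i + 1) * (l i - (a(i := a i - 1)) i)) * nbox_weight l (a(i := a i - 1)) *
          (u (a(i := a i - 1)) * w ((a(i := a i - 1))(i := (a(i := a i - 1)) i + 1))) =
         nbox_weight l a * (u (a(i := a i - 1)) * w a)"
        unfolding nbox_weight_upd[symmetric] ab ..
    next
      fix b
      assume b: "b \<in> {b \<in> nbox l. b i < l i}"
      show "(b(i := b i + 1))(i := (b(i := b i + 1)) i - 1) = b" by simp
      show "b(i := b i + 1) \<in> {a \<in> nbox l. a i > 0}" using b nbox_upd_less[of b l i] by simp
    qed
  qed
  also have "\<dots> = (\<Sum>b\<in>nbox l. \<Sum>i\<in>UNIV. if b i < l i then
      real ((b i + 1) * (l i - b i)) * nbox_weight l b * (u b * w (b(i := b i + 1))) else 0)"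
    by (subst sum.swap) (intro sum.cong refl sum.inter_filter[OF finite_nbox])
  also have "\<dots> = nbox_inner l u (lower l w)"
    unfolding nbox_inner_def lower_def
    by (intro sum.cong refl) (auto simp: sum_distrib_left sum_distrib_right mult_ac intro!: sum.cong simp del: of_nat_mult)
  finally show ?thesis .
qed

lemma nbox_inner_nonneg: "nbox_inner l u u \<ge> 0"
  unfolding nbox_inner_def by (intro sum_nonneg mult_nonneg_nonneg[OF less_imp_le[OF nbox_weight_pos] zero_le_square])

lemma nbox_inner_eq_0: "nbox_inner l u u \<le> 0 \<Longrightarrow> a \<in> nbox l \<Longrightarrow> u a = 0"
proof -
  assume "nbox_inner l u u \<le> 0" and a: "a \<in> nbox l"
  then have "nbox_inner l u u = 0" using nbox_inner_nonneg[of l u] by simp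
  moreover have "nbox_weight l b * (u b * u b) \<ge> 0" if "b \<in> nbox l" for b
    using that by (intro mult_nonneg_nonneg[OF less_imp_le[OF nbox_weight_pos] zero_le_square])
  ultimately have "nbox_weight l a * (u a * u a) = 0"
    unfolding nbox_inner_def using sum_nonneg_eq_0_iff[OF finite_nbox, of l "\<lambda>b. nbox_weight l b * (u b * u b)"] a by blast
  then show ?thesis using nbox_weight_pos[OF a] by simp
qed

text \<open>Adjointness turns the commutator relation into an identity between squared norms, in
  which the sign of the weight \<open>sum l UNIV - 2 * d\<close> decides about injectivity.\<close>

lemma nbox_inner_commutator:
  fixes u :: "('i::finite \<Rightarrow> nat) \<Rightarrow> real"
  assumes supp: "\<And>a. sum a UNIV \<noteq> d \<Longrightarrow> u a = 0"
  shows "nbox_inner l (raise l u) (raise l u) =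
    nbox_inner l (lower l u) (lower l u) + (real (sum l UNIV) - 2 * real d) * nbox_inner l u u"
proof -
  have "nbox_inner l (raise l u) (raise l u) = nbox_inner l u (lower l (raise l u))"
    by (rule nbox_inner_adjoint)
  also have "\<dots> = nbox_inner l u (\<lambda>a. raise l (lower l u) a + (real (sum l UNIV) - 2 * real d) * u a)"
    unfolding nbox_inner_def
  proof (intro sum.cong refl)
    fix a assume a: "a \<in> nbox l"
    show "nbox_weight l a * (u a * lower l (raise l u) a) =
        nbox_weight l a * (u a * (raise l (lower l u) a + (real (sum l UNIV) - 2 * real d) * u a))"
    proof (cases "sum a UNIV = d")
      case True
      have "lower l (raise l u) a = raise l (lower l u) a + (real (sum l UNIV) - 2 * real d) * u a"
        using raise_lower_commutator[OF a, of u] unfolding True by (simp add: algebra_simps)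
      then show ?thesis by simp
    qed (simp add: supp)
  qed
  also have "\<dots> = nbox_inner l (raise l (lower l u)) u + (real (sum l UNIV) - 2 * real d) * nbox_inner l u u"
    unfolding nbox_inner_def by (simp add: sum_distrib_left flip: sum.distrib) (intro sum.cong refl, simp add: algebra_simps)
  finally show ?thesis by (simp add: nbox_inner_adjoint)
qed

lemma raise_support:
  assumes "\<And>a. a \<notin> level l d \<Longrightarrow> u a = 0" "a \<notin> level l (Suc d)"
  shows "raise l u a = 0"
proof -
  have "u (a(i := a i - 1)) = 0" if "a \<in> nbox l" "a i > 0" for i
  proof -
    have "sum (a(i := a i - 1)) UNIV + a i = sum a UNIV + (a i - 1)" by (rule sum_fun_upd)
    then have "a(i := a i - 1) \<notin> level l d" using assms(2) that by (auto simp: level_def)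
    then show ?thesis by (rule assms(1))
  qed
  then show ?thesis by (auto simp: raise_def intro!: sum.neutral)
qed

lemma lower_support:
  assumes "\<And>a. a \<notin> level l (Suc d) \<Longrightarrow> u a = 0" "a \<notin> level l d"
  shows "lower l u a = 0"
proof -
  have "u (a(i := a i + 1)) = 0" if "a \<in> nbox l" "a i < l i" for i
  proof -
    have "sum (a(i := a i + 1)) UNIV + a i = sum a UNIV + (a i + 1)" by (rule sum_fun_upd)
    then have "a(i := a i + 1) \<notin> level l (Suc d)" using assms(2) that by (auto simp: level_def)
    then show ?thesis by (rule assms(1))
  qed
  then show ?thesis by (auto simp: lower_def intro!: sum.neutral)
qed

text \<open>Below the middle the weight is positive, so both summands in
  \<open>nbox_inner_commutator\<close> are nonnegative and vanish together with the norm of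
  \<open>raise l u\<close>.\<close>

lemma raise_injective_real:
  fixes u :: "('i::finite \<Rightarrow> nat) \<Rightarrow> real"
  assumes "\<And>a. a \<notin> level l d \<Longrightarrow> u a = 0" "2 * d < sum l UNIV" "\<And>a. raise l u a = 0"
  shows "u a = 0"
proof (cases "a \<in> nbox l")
  case True
  have "real (2 * d) < real (sum l UNIV)" using assms(2) by (simp only: of_nat_less_iff)
  then have pos: "real (sum l UNIV) - 2 * real d > 0" by (simp del: of_nat_sum)
  have "nbox_inner l (raise l u) (raise l u) = 0" by (simp add: nbox_inner_def assms(3))
  then have "(real (sum l UNIV) - 2 * real d) * nbox_inner l u u \<le> 0"
    using nbox_inner_commutator[of d u l] nbox_inner_nonneg[of l "lower l u"] assms(1) by (simp add: level_def)
  then have "nbox_inner l u u \<le> 0" using pos by (simp add: mult_le_0_iff del: of_nat_sum)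
  then show ?thesis using True by (rule nbox_inner_eq_0)
qed (use assms(1) in \<open>simp add: level_def\<close>)

text \<open>Pairing with \<open>u\<close> shows that \<open>lower l u\<close> has norm 0; above the
  middle the weight is negative, so \<open>nbox_inner_commutator\<close> then forces
  \<open>u\<close> to have norm 0. The composite is used because it maps a level to itself, so that
  injectivity gives surjectivity.\<close>

lemma raise_lower_injective_real:
  fixes u :: "('i::finite \<Rightarrow> nat) \<Rightarrow> real"
  assumes "\<And>a. a \<notin> level l d \<Longrightarrow> u a = 0" "2 * d > sum l UNIV" "\<And>a. raise l (lower l u) a = 0"
  shows "u a = 0"
proof (cases "a \<in> nbox l")
  case True
  have "real (sum l UNIV) < real (2 * d)" using assms(2) by (simp only: of_nat_less_iff)
  then have pos: "real (sum l UNIV) - 2 * real d < 0" by (simp del: of_nat_sum)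
  have "nbox_inner l (lower l u) (lower l u) = nbox_inner l (raise l (lower l u)) u"
    by (simp add: nbox_inner_adjoint)
  also have "\<dots> = 0" by (simp add: nbox_inner_def assms(3))
  finally have "(real (sum l UNIV) - 2 * real d) * nbox_inner l u u \<ge> 0"
    using nbox_inner_commutator[of d u l] nbox_inner_nonneg[of l "raise l u"] assms(1) by (simp add: level_def)
  then have "nbox_inner l u u \<le> 0" using pos by (simp add: zero_le_mult_iff del: of_nat_sum)
  then show ?thesis using True by (rule nbox_inner_eq_0)
qed (use assms(1) in \<open>simp add: level_def\<close>)

text \<open>The positivity argument is real, but both operators have real coefficients, so complex
  functions are treated by real and imaginary parts.\<close>

lemma raise_Re: "raise l (\<lambda>a. Re (u a)) a = Re (raise l u a)" "raise l (\<lambda>a. Im (u a)) a = Im (raise l u a)"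
  by (auto simp: raise_def intro!: sum.cong)

lemma lower_Re: "lower l (\<lambda>a. Re (u a)) = (\<lambda>a. Re (lower l u a))" "lower l (\<lambda>a. Im (u a)) = (\<lambda>a. Im (lower l u a))"
  by (rule ext; auto simp: lower_def simp del: of_nat_mult intro!: sum.cong)+

lemma raise_injective:
  fixes u :: "('i::finite \<Rightarrow> nat) \<Rightarrow> complex"
  assumes "\<And>a. a \<notin> level l d \<Longrightarrow> u a = 0" "2 * d < sum l UNIV" "\<And>a. raise l u a = 0"
  shows "u a = 0"
  using raise_injective_real[of l d "\<lambda>a. Re (u a)" a] raise_injective_real[of l d "\<lambda>a. Im (u a)" a] assms
  by (simp add: raise_Re complex_eq_iff)

lemma raise_lower_injective:
  fixes u :: "('i::finite \<Rightarrow> nat) \<Rightarrow> complex"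
  assumes "\<And>a. a \<notin> level l d \<Longrightarrow> u a = 0" "2 * d > sum l UNIV" "\<And>a. raise l (lower l u) a = 0"
  shows "u a = 0"
  using raise_lower_injective_real[of l d "\<lambda>a. Re (u a)" a] raise_lower_injective_real[of l d "\<lambda>a. Im (u a)" a] assms
  by (simp add: lower_Re raise_Re complex_eq_iff)

section \<open>Linear algebra of coefficient functions\<close>

interpretation fun_vs: vector_space "\<lambda>c (f :: 'a \<Rightarrow> complex) x. c * f x"
  by unfold_locales (auto simp: fun_eq_iff algebra_simps)

definition unit_fun :: "'a \<Rightarrow> 'a \<Rightarrow> complex" where
  "unit_fun a = (\<lambda>b. if b = a then 1 else 0)"

lemma inj_unit_fun: "inj unit_fun"
proof (rule injI)
  fix a b :: 'a assume "unit_fun a = unit_fun b"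
  then have "unit_fun a a = unit_fun b a" by simp
  then show "a = b" by (simp add: unit_fun_def split: if_splits)
qed

lemma sum_fun_apply: "(\<Sum>x\<in>A. f x) y = (\<Sum>x\<in>A. f x y)"
  by (induction A rule: infinite_finite_induct) auto

lemma span_unit_fun:
  assumes "finite S"
  shows "fun_vs.span (unit_fun ` S) = {u. \<forall>a. a \<notin> S \<longrightarrow> u a = 0}"
proof
  have "fun_vs.subspace {u :: 'a \<Rightarrow> complex. \<forall>a. a \<notin> S \<longrightarrow> u a = 0}"
    by (auto simp: fun_vs.subspace_def)
  then show "fun_vs.span (unit_fun ` S) \<subseteq> {u. \<forall>a. a \<notin> S \<longrightarrow> u a = 0}"
    by (intro fun_vs.span_minimal) (auto simp: unit_fun_def)
  show "{u. \<forall>a. a \<notin> S \<longrightarrow> u a = 0} \<subseteq> fun_vs.span (unit_fun ` S)"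
  proof
    fix u :: "'a \<Rightarrow> complex" assume u: "u \<in> {u. \<forall>a. a \<notin> S \<longrightarrow> u a = 0}"
    have "u = (\<Sum>a\<in>S. (\<lambda>x. u a * unit_fun a x))"
    proof
      fix b
      have "(\<Sum>a\<in>S. u a * unit_fun a b) = (\<Sum>a\<in>S. if a = b then u a else 0)"
        by (intro sum.cong) (auto simp: unit_fun_def)
      then show "u b = (\<Sum>a\<in>S. (\<lambda>x. u a * unit_fun a x)) b"
        using u assms by (auto simp: sum_fun_apply)
    qed
    then show "u \<in> fun_vs.span (unit_fun ` S)"
      by (rule ssubst) (intro fun_vs.span_sum fun_vs.span_scale fun_vs.span_base imageI)
  qed
qed

lemma independent_unit_fun: "finite S \<Longrightarrow> fun_vs.independent (unit_fun ` S)"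
proof (rule fun_vs.independent_if_scalars_zero)
  fix f :: "('a \<Rightarrow> complex) \<Rightarrow> complex" and x
  assume S: "finite S" and 0: "(\<Sum>x\<in>unit_fun ` S. (\<lambda>y. f x * x y)) = 0" and x: "x \<in> unit_fun ` S"
  obtain a where a: "a \<in> S" "x = unit_fun a" using x by auto
  have "(\<Sum>x\<in>unit_fun ` S. (\<lambda>y. f x * x y)) a = (\<Sum>b\<in>S. f (unit_fun b) * unit_fun b a)"
    by (subst sum.reindex) (auto intro: inj_on_subset[OF inj_unit_fun] simp: sum_fun_apply)
  also have "\<dots> = (\<Sum>b\<in>S. if b = a then f (unit_fun a) else 0)"
    by (intro sum.cong) (auto simp: unit_fun_def)
  finally show "f x = 0" using a S 0 by simp
qed auto

text \<open>Steinitz exchange; the added vectors are drawn from the unit functions, so that they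
  stand for monomials.\<close>

lemma complete_to_basis:
  assumes S: "finite S" and B: "finite B" "fun_vs.independent B" "B \<subseteq> fun_vs.span (unit_fun ` S)"
  obtains T where "T \<subseteq> S" "card T + card B = card S"
    "fun_vs.span (unit_fun ` S) \<subseteq> fun_vs.span (B \<union> unit_fun ` T)"
proof -
  let ?D = "unit_fun ` S"
  obtain C where C: "B \<subseteq> C" "C \<subseteq> B \<union> ?D" "fun_vs.independent C" "B \<union> ?D \<subseteq> fun_vs.span C"
    using fun_vs.maximal_independent_subset_extend[of B "B \<union> ?D"] B(2) by blast
  have fC: "finite C" using C(2) B(1) S by (meson finite_UnI finite_imageI finite_subset)
  have "C \<subseteq> fun_vs.span ?D" using C(2) B(3) fun_vs.span_superset[of ?D] by blast
  then have "card C \<le> card ?D" using fun_vs.independent_span_bound[OF _ C(3)] S by blast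
  moreover have "card ?D \<le> card C"
    using fun_vs.independent_span_bound[OF fC independent_unit_fun[OF S]] C(4) by blast
  moreover have "card ?D = card S" by (simp add: card_image inj_on_subset[OF inj_unit_fun])
  ultimately have cC: "card C = card S" by simp
  define T where "T = {a\<in>S. unit_fun a \<in> C - B}"
  have T: "unit_fun ` T = C - B" using C(2) by (auto simp: T_def)
  then have "card T = card (C - B)" by (metis card_image inj_on_subset[OF inj_unit_fun] subset_UNIV)
  also have "\<dots> = card C - card B" by (rule card_Diff_subset[OF B(1) C(1)])
  finally have "card T + card B = card S" using cC card_mono[OF fC C(1)] by simp
  moreover have "fun_vs.span ?D \<subseteq> fun_vs.span (B \<union> unit_fun ` T)"
    unfolding T using C(1,4) by (intro fun_vs.span_minimal fun_vs.subspace_span) (simp add: Un_absorb1)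
  moreover have "T \<subseteq> S" by (auto simp: T_def)
  ultimately show ?thesis using that by blast
qed

lemma raise_linear:
  "raise l (u + w) = raise l u + raise l w" "raise l (\<lambda>x. c * u x) = (\<lambda>x. c * raise l u x)"
  by (rule ext; auto simp: raise_def sum_distrib_left simp flip: sum.distrib intro!: sum.cong)+

lemma lower_linear:
  "lower l (u + w) = lower l u + lower l w" "lower l (\<lambda>x. c * u x) = (\<lambda>x. c * lower l u x)"
  by (rule ext; auto simp: lower_def sum_distrib_left algebra_simps simp del: of_nat_mult simp flip: sum.distrib intro!: sum.cong)+

lemma image_linear_span:
  assumes add: "\<And>u w. f (u + w) = f u + f w" and scale: "\<And>c u. f (\<lambda>x. c * u x) = (\<lambda>x. c * f u x)"
    and S: "u \<in> fun_vs.span S"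
  shows "f u \<in> fun_vs.span (f ` S)"
proof -
  have "f 0 = 0" using scale[of 0 0] by (simp add: zero_fun_def)
  then have "fun_vs.subspace {u. f u \<in> fun_vs.span (f ` S)}"
    by (auto simp: fun_vs.subspace_def add scale fun_vs.span_add fun_vs.span_scale fun_vs.span_zero)
  then have "fun_vs.span S \<subseteq> {u. f u \<in> fun_vs.span (f ` S)}"
    by (intro fun_vs.span_minimal) (auto intro: fun_vs.span_base)
  then show ?thesis using S by blast
qed

lemma independent_linear_image:
  assumes add: "\<And>u w. f (u + w) = f u + f w" and scale: "\<And>c u. f (\<lambda>x. c * u x) = (\<lambda>x. c * f u x)"
    and S: "finite S" and inj: "\<And>u. u \<in> fun_vs.span (unit_fun ` S) \<Longrightarrow> f u = 0 \<Longrightarrow> u = 0"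
  shows "fun_vs.independent (f ` unit_fun ` S)" "card (f ` unit_fun ` S) = card S"
proof -
  have diff: "f (u - w) = f u - f w" for u w
    using add[of "u - w" w] by simp
  have inj_f: "inj_on f (fun_vs.span (unit_fun ` S))"
  proof (rule inj_onI)
    fix u w assume uw: "u \<in> fun_vs.span (unit_fun ` S)" "w \<in> fun_vs.span (unit_fun ` S)" "f u = f w"
    have "u - w = 0" by (rule inj[OF fun_vs.span_diff[OF uw(1,2)]]) (simp add: diff uw(3))
    then show "u = w" by simp
  qed
  interpret f: Vector_Spaces.linear "\<lambda>c (f :: 'a \<Rightarrow> complex) x. c * f x" "\<lambda>c (f :: 'b \<Rightarrow> complex) x. c * f x" f
    by unfold_locales (auto simp: add scale)
  show "fun_vs.independent (f ` unit_fun ` S)"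
    by (rule f.independent_inj_on_image[OF independent_unit_fun[OF S] inj_f])
  show "card (f ` unit_fun ` S) = card S"
    by (simp add: card_image inj_on_subset[OF inj_unit_fun] inj_on_subset[OF inj_f fun_vs.span_superset])
qed

lemma raise_unit_fun:
  assumes "a \<in> nbox l"
  shows "raise l (unit_fun b) a = (\<Sum>i\<in>UNIV. if a = b(i := b i + 1) then 1 else 0)"
  using assms unfolding raise_def by (auto simp: unit_fun_def fun_eq_iff intro!: sum.cong)

text \<open>The linear map \<open>f\<close> sends \<open>unit_fun a\<close> to \<open>mo a\<close>,
  and \<open>rel\<close> says that it maps the images under \<open>raise\<close> into
  \<open>G\<close>. The family \<open>mo\<close> is arbitrary because two instances are needed:
  monomials in the polynomial ring, and their values at the points at infinity.\<close>

lemma lefschetz_reduction: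
  fixes scale :: "complex \<Rightarrow> 'v::ab_group_add \<Rightarrow> 'v" and l :: "'i::finite \<Rightarrow> nat"
  assumes "vector_space scale" and G: "module.subspace scale G"
    and span: "unit_fun ` level l d \<subseteq> fun_vs.span (raise l ` unit_fun ` B \<union> unit_fun ` T)" and T: "T \<subseteq> level l d"
    and B: "d = 0 \<Longrightarrow> B = {}" "d > 0 \<Longrightarrow> B \<subseteq> level l (d - 1)"
    and mo_T: "\<And>t. t \<in> T \<Longrightarrow> mo t \<in> G"
    and rel: "\<And>b. b \<in> B \<Longrightarrow> (\<Sum>i | b(i := b i + 1) \<in> nbox l. mo (b(i := b i + 1))) \<in> G"
    and a: "a \<in> level l d"
  shows "mo a \<in> G"
proof -
  interpret vector_space scale by fact
  define f where "f u = (\<Sum>a\<in>level l d. scale (u a) (mo a))" for u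
  have f_unit: "f (unit_fun a) = mo a" if "a \<in> level l d" for a
  proof -
    have "f (unit_fun a) = (\<Sum>b\<in>level l d. if b = a then mo a else 0)"
      unfolding f_def by (intro sum.cong) (auto simp: unit_fun_def)
    then show ?thesis using that by (simp add: finite_level)
  qed
  have f_raise: "f (raise l (unit_fun b)) = (\<Sum>i | b(i := b i + 1) \<in> nbox l. mo (b(i := b i + 1)))" if b: "b \<in> B" for b
  proof -
    have lev: "b(i := b i + 1) \<in> level l d \<longleftrightarrow> b(i := b i + 1) \<in> nbox l" for i
    proof -
      have "sum (b(i := b i + 1)) UNIV + b i = sum b UNIV + (b i + 1)" by (rule sum_fun_upd)
      then show ?thesis using b B by (cases "d = 0") (auto simp: level_def)
    qed
    have "f (raise l (unit_fun b)) = (\<Sum>a\<in>level l d. \<Sum>i\<in>UNIV. if a = b(i := b i + 1) then mo a else 0)"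
      unfolding f_def
    proof (intro sum.cong refl)
      fix a assume "a \<in> level l d"
      then have a: "a \<in> nbox l" by (simp add: level_def)
      show "scale (raise l (unit_fun b) a) (mo a) = (\<Sum>i\<in>UNIV. if a = b(i := b i + 1) then mo a else 0)"
        unfolding raise_unit_fun[OF a] scale_sum_left by (intro sum.cong) auto
    qed
    also have "\<dots> = (\<Sum>i\<in>UNIV. \<Sum>a\<in>level l d. if a = b(i := b i + 1) then mo a else 0)"
      by (rule sum.swap)
    also have "\<dots> = (\<Sum>i\<in>UNIV. if b(i := b i + 1) \<in> nbox l then mo (b(i := b i + 1)) else 0)"
      using finite_level[of l d] lev by (intro sum.cong refl) (simp add: sum.delta)
    also have "\<dots> = (\<Sum>i | b(i := b i + 1) \<in> nbox l. mo (b(i := b i + 1)))"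
      using sum.inter_filter[of UNIV "\<lambda>i. mo (b(i := b i + 1))" "\<lambda>i. b(i := b i + 1) \<in> nbox l"] by simp
    finally show ?thesis .
  qed
  have "fun_vs.subspace {u. f u \<in> G}"
    using G unfolding fun_vs.subspace_def subspace_def
    by (auto simp: f_def scale_left_distrib sum.distrib scale_sum_right[symmetric] scale_scale[symmetric] simp del: scale_scale)
  moreover have "raise l ` unit_fun ` B \<union> unit_fun ` T \<subseteq> {u. f u \<in> G}"
    using f_unit f_raise rel mo_T T by auto
  ultimately have "fun_vs.span (raise l ` unit_fun ` B \<union> unit_fun ` T) \<subseteq> {u. f u \<in> G}"
    by (intro fun_vs.span_minimal)
  then have "f (unit_fun a) \<in> G" using span a by blast
  then show ?thesis using f_unit[OF a] by simp
qed

text \<open>The quotient of the monomial complete intersection \<open>\<complex>[A\<^sub>1, \<dots>, A\<^sub>r]/(A\<^sub>i\<^bsup>l i + 1\<^esup>)\<close> by \<open>A\<^sub>1 + \<dots> + A\<^sub>r\<close>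
  has a basis of monomials whose exponents form the sets \<open>T d\<close>; this is the strong Lefschetz property in
  the form needed here.\<close>

lemma lefschetz_basis_level:
  fixes l :: "'i::finite \<Rightarrow> nat"
  assumes N: "sum l UNIV = 2 * N"
  shows "\<exists>T \<subseteq> level l d. card T = (if d = 0 then 1 else if d \<le> N then card (level l d) - card (level l (d - 1)) else 0) \<and>
    (0 < d \<and> d \<le> N \<longrightarrow> card (level l (d - 1)) \<le> card (level l d)) \<and>
    unit_fun ` level l d \<subseteq> fun_vs.span ((if d = 0 then {} else raise l ` unit_fun ` level l (d - 1)) \<union> unit_fun ` T)"
proof (cases d)
  case 0
  have "level l 0 = {\<lambda>_. 0}" by (auto simp: level_def nbox_def)
  then show ?thesis using 0 fun_vs.span_superset by (intro exI[of _ "level l 0"]) auto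
next
  case (Suc m)
  let ?E = "raise l :: (('i \<Rightarrow> nat) \<Rightarrow> complex) \<Rightarrow> _"
  have E_span: "?E u \<in> fun_vs.span (unit_fun ` level l d)" if "u \<in> fun_vs.span (unit_fun ` level l m)" for u
    using that raise_support[of l m u] Suc by (simp add: span_unit_fun finite_level)
  show ?thesis
  proof (cases "d \<le> N")
    case True
    have inj: "u = 0" if "u \<in> fun_vs.span (unit_fun ` level l m)" "?E u = 0" for u
      using raise_injective[of l m u] that True Suc N by (auto simp: span_unit_fun finite_level fun_eq_iff)
    have B: "fun_vs.independent (?E ` unit_fun ` level l m)" "card (?E ` unit_fun ` level l m) = card (level l m)"
      by (rule independent_linear_image[OF raise_linear finite_level inj]; assumption)+
    have sub: "?E ` unit_fun ` level l m \<subseteq> fun_vs.span (unit_fun ` level l d)"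
      using E_span by (auto intro: fun_vs.span_base)
    have fin: "finite (?E ` unit_fun ` level l m)" by (intro finite_imageI finite_level)
    obtain T where T: "T \<subseteq> level l d" "card T + card (?E ` unit_fun ` level l m) = card (level l d)"
      "fun_vs.span (unit_fun ` level l d) \<subseteq> fun_vs.span (?E ` unit_fun ` level l m \<union> unit_fun ` T)"
      by (rule complete_to_basis[OF finite_level fin B(1) sub], rule that) assumption+
    have "unit_fun ` level l d \<subseteq> fun_vs.span (?E ` unit_fun ` level l m \<union> unit_fun ` T)"
      using T(3) fun_vs.span_superset[of "unit_fun ` level l d"] by (rule order_trans[rotated])
    then show ?thesis using True Suc T(1,2) B(2) by (intro exI[of _ T]) auto
  next
    case False
    \<comment> \<open>An injective endomorphism of the finite-dimensional space at level
      \<open>d\<close> is onto, so above the middle \<open>raise\<close> alone reaches everything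
      and no monomial has to be added.\<close>
    let ?EF = "\<lambda>u. ?E (lower l u)"
    have add: "?EF (u + w) = ?EF u + ?EF w" and scale: "?EF (\<lambda>x. c * u x) = (\<lambda>x. c * ?EF u x)" for u w c
      by (simp_all only: lower_linear raise_linear)
    have inj: "u = 0" if "u \<in> fun_vs.span (unit_fun ` level l d)" "?EF u = 0" for u
      using raise_lower_injective[of l d u] that False N by (auto simp: span_unit_fun finite_level fun_eq_iff)
    have B: "fun_vs.independent (?EF ` unit_fun ` level l d)" "card (?EF ` unit_fun ` level l d) = card (level l d)"
      by (rule independent_linear_image[of ?EF, OF add scale finite_level inj]; assumption)+
    have F_span: "lower l u \<in> fun_vs.span (unit_fun ` level l m)" if "u \<in> fun_vs.span (unit_fun ` level l d)" for u
      using that lower_support[of l m u] Suc by (simp add: span_unit_fun finite_level)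
    have EF_sub: "?EF ` unit_fun ` level l d \<subseteq> fun_vs.span (unit_fun ` level l d)"
      unfolding image_comp by (intro image_subsetI) (simp add: E_span F_span fun_vs.span_base)
    obtain T where T: "T \<subseteq> level l d" "card T + card (?EF ` unit_fun ` level l d) = card (level l d)"
      "fun_vs.span (unit_fun ` level l d) \<subseteq> fun_vs.span (?EF ` unit_fun ` level l d \<union> unit_fun ` T)"
      by (rule complete_to_basis[OF finite_level finite_imageI[OF finite_imageI[OF finite_level]] B(1) EF_sub], rule that) assumption+
    have "T = {}" using T(2) B(2) finite_subset[OF T(1) finite_level] by simp
    have "?EF ` unit_fun ` level l d \<subseteq> fun_vs.span (?E ` unit_fun ` level l m)"
      unfolding image_comp
    proof (intro image_subsetI)
      fix a assume "a \<in> level l d"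
      then have "lower l (unit_fun a) \<in> fun_vs.span (unit_fun ` level l m)"
        by (intro F_span fun_vs.span_base imageI)
      then have "?EF (unit_fun a) \<in> fun_vs.span (?E ` unit_fun ` level l m)"
        by (rule image_linear_span[OF raise_linear])
      then show "(?EF \<circ> unit_fun) a \<in> fun_vs.span ((?E \<circ> unit_fun) ` level l m)"
        by (simp add: image_image o_def)
    qed
    then have "fun_vs.span (?EF ` unit_fun ` level l d) \<subseteq> fun_vs.span (?E ` unit_fun ` level l m)"
      by (intro fun_vs.span_minimal fun_vs.subspace_span)
    then have "unit_fun ` level l d \<subseteq> fun_vs.span (?E ` unit_fun ` level l m)"
      using T(3) \<open>T = {}\<close> fun_vs.span_superset[of "unit_fun ` level l d"] by simp
    then show ?thesis using Suc False by (intro exI[of _ "{}"]) auto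
  qed
qed

lemma level_symmetric:
  assumes "sum l UNIV = 2 * N" "d \<le> 2 * N"
  shows "card (level l (2 * N - d)) = card (level l d)"
proof (rule bij_betw_same_card[of "\<lambda>a i. l i - a i"], rule bij_betwI[where g = "\<lambda>a i. l i - a i"])
  have s: "sum (\<lambda>i. l i - a i) UNIV = 2 * N - sum a UNIV" if "a \<in> nbox l" for a
    using that assms(1) by (subst sum_subtractf_nat) (auto simp: nbox_def)
  show "(\<lambda>a i. l i - a i) \<in> level l (2 * N - d) \<rightarrow> level l d"
    using assms(2) by (auto simp: level_def s) (auto simp: nbox_def)
  show "(\<lambda>a i. l i - a i) \<in> level l d \<rightarrow> level l (2 * N - d)"
    by (auto simp: level_def s) (auto simp: nbox_def)
qed (auto simp: level_def nbox_def)

locale lefschetz =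
  fixes l :: "'i::finite \<Rightarrow> nat" and N :: nat
  assumes sum_l: "sum l UNIV = 2 * N"
begin

definition basis_exponents :: "nat \<Rightarrow> ('i \<Rightarrow> nat) set" where
  "basis_exponents d = (SOME T. T \<subseteq> level l d \<and> card T = (if d = 0 then 1 else if d \<le> N then card (level l d) - card (level l (d - 1)) else 0) \<and>
    (0 < d \<and> d \<le> N \<longrightarrow> card (level l (d - 1)) \<le> card (level l d)) \<and>
    unit_fun ` level l d \<subseteq> fun_vs.span ((if d = 0 then {} else raise l ` unit_fun ` level l (d - 1)) \<union> unit_fun ` T))"

lemma
  shows basis_exponents_subset: "basis_exponents d \<subseteq> level l d"
    and card_basis_exponents: "card (basis_exponents d) =
      (if d = 0 then 1 else if d \<le> N then card (level l d) - card (level l (d - 1)) else 0)"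
    and card_level_mono: "0 < d \<Longrightarrow> d \<le> N \<Longrightarrow> card (level l (d - 1)) \<le> card (level l d)"
    and basis_exponents_span: "unit_fun ` level l d \<subseteq>
      fun_vs.span ((if d = 0 then {} else raise l ` unit_fun ` level l (d - 1)) \<union> unit_fun ` basis_exponents d)"
  using someI_ex[OF lefschetz_basis_level[OF sum_l, of d]] unfolding basis_exponents_def by blast+

lemma monomial_reduction:
  fixes scale :: "complex \<Rightarrow> 'v::ab_group_add \<Rightarrow> 'v"
  assumes "vector_space scale" "module.subspace scale G"
    and "\<And>t. t \<in> basis_exponents d \<Longrightarrow> mo t \<in> G"
    and "\<And>b. d > 0 \<Longrightarrow> b \<in> level l (d - 1) \<Longrightarrow> (\<Sum>i | b(i := b i + 1) \<in> nbox l. mo (b(i := b i + 1))) \<in> G"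
    and "a \<in> level l d"
  shows "mo a \<in> G"
proof (rule lefschetz_reduction[OF assms(1,2) _ basis_exponents_subset _ _ assms(3) _ assms(5)])
  let ?B = "if d = 0 then {} else level l (d - 1)"
  show "unit_fun ` level l d \<subseteq> fun_vs.span (raise l ` unit_fun ` ?B \<union> unit_fun ` basis_exponents d)"
    using basis_exponents_span[of d] by (cases "d = 0") simp_all
  show "(\<Sum>i | b(i := b i + 1) \<in> nbox l. mo (b(i := b i + 1))) \<in> G" if "b \<in> ?B" for b
    using that by (intro assms(4)) (auto split: if_splits)
qed auto

end

section \<open>The filtration by weighted degree\<close>

lemma poly_mapping_sum_singles: "f = (\<Sum>t\<in>Poly_Mapping.keys f. Poly_Mapping.single t (Poly_Mapping.lookup f t))"
proof (rule poly_mapping_eqI)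
  fix k
  have "Poly_Mapping.lookup (\<Sum>t\<in>Poly_Mapping.keys f. Poly_Mapping.single t (Poly_Mapping.lookup f t)) k =
    (\<Sum>t\<in>Poly_Mapping.keys f. if t = k then Poly_Mapping.lookup f k else 0)"
    unfolding lookup_sum by (intro sum.cong) (auto simp: lookup_single when_def)
  also have "\<dots> = Poly_Mapping.lookup f k" by (simp add: in_keys_iff)
  finally show "Poly_Mapping.lookup f k =
    Poly_Mapping.lookup (\<Sum>t\<in>Poly_Mapping.keys f. Poly_Mapping.single t (Poly_Mapping.lookup f t)) k" by simp
qed

section \<open>Evaluation of polynomials in commutative rings\<close>

definition mono_eval :: "('v \<Rightarrow> 'b::comm_ring_1) \<Rightarrow> ('v \<Rightarrow>\<^sub>0 nat) \<Rightarrow> 'b" where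
  "mono_eval \<theta> t = (\<Prod>v\<in>Poly_Mapping.keys t. \<theta> v ^ Poly_Mapping.lookup t v)"

lemma mono_eval_superset:
  assumes "finite S" "Poly_Mapping.keys t \<subseteq> S"
  shows "mono_eval \<theta> t = (\<Prod>v\<in>S. \<theta> v ^ Poly_Mapping.lookup t v)"
  unfolding mono_eval_def using assms by (intro prod.mono_neutral_left) (auto simp: in_keys_iff)

lemma mono_eval_add: "mono_eval \<theta> (s + t) = mono_eval \<theta> s * mono_eval \<theta> t"
proof -
  let ?S = "Poly_Mapping.keys s \<union> Poly_Mapping.keys t"
  have "Poly_Mapping.keys (s + t) \<subseteq> ?S" by (rule Poly_Mapping.keys_add)
  then show ?thesis
    by (simp add: mono_eval_superset[of ?S] lookup_add power_add prod.distrib)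
qed

lemma mono_eval_0 [simp]: "mono_eval \<theta> 0 = 1"
  by (simp add: mono_eval_def)

lemma mono_eval_single [simp]: "mono_eval \<theta> (Poly_Mapping.single v k) = \<theta> v ^ k"
  by (simp add: mono_eval_superset[of "{v}"])

text \<open>The coefficient map \<open>c\<close> is a parameter because polynomials are evaluated
  both in polynomials (\<open>Const\<close>, for dehomogenization) and in Laurent series
  (\<open>fls_const\<close>, along the branches).\<close>

locale ring_embedding =
  fixes c :: "complex \<Rightarrow> 'b::comm_ring_1"
  assumes c_add: "c (x + y) = c x + c y" and c_mult: "c (x * y) = c x * c y" and c_1: "c 1 = 1"
begin

lemma c_0 [simp]: "c 0 = 0"
  using c_add[of 0 0] by simp

definition poly_eval :: "('v \<Rightarrow> 'b) \<Rightarrow> 'v cpoly \<Rightarrow> 'b" where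
  "poly_eval \<theta> f = (\<Sum>t\<in>Poly_Mapping.keys f. c (Poly_Mapping.lookup f t) * mono_eval \<theta> t)"

lemma poly_eval_superset:
  assumes "finite S" "Poly_Mapping.keys f \<subseteq> S"
  shows "poly_eval \<theta> f = (\<Sum>t\<in>S. c (Poly_Mapping.lookup f t) * mono_eval \<theta> t)"
  unfolding poly_eval_def using assms by (intro sum.mono_neutral_left) (auto simp: in_keys_iff)

lemma poly_eval_0 [simp]: "poly_eval \<theta> 0 = 0"
  by (simp add: poly_eval_def)

lemma poly_eval_add: "poly_eval \<theta> (f + g) = poly_eval \<theta> f + poly_eval \<theta> g"
proof -
  let ?S = "Poly_Mapping.keys f \<union> Poly_Mapping.keys g"
  have "Poly_Mapping.keys (f + g) \<subseteq> ?S" by (rule Poly_Mapping.keys_add)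
  then show ?thesis
    by (simp add: poly_eval_superset[of ?S] lookup_add c_add distrib_right sum.distrib)
qed

lemma poly_eval_sum: "poly_eval \<theta> (\<Sum>i\<in>I. f i) = (\<Sum>i\<in>I. poly_eval \<theta> (f i))"
  by (induction I rule: infinite_finite_induct) (auto simp: poly_eval_add)

lemma poly_eval_single: "poly_eval \<theta> (Poly_Mapping.single t x) = c x * mono_eval \<theta> t"
  by (simp add: poly_eval_superset[of "{t}"])

lemma poly_eval_mult: "poly_eval \<theta> (f * g) = poly_eval \<theta> f * poly_eval \<theta> g"
proof -
  let ?F = "\<lambda>t. Poly_Mapping.single t (Poly_Mapping.lookup f t)" and ?G = "\<lambda>t. Poly_Mapping.single t (Poly_Mapping.lookup g t)"
  have "f * g = (\<Sum>s\<in>Poly_Mapping.keys f. ?F s) * (\<Sum>t\<in>Poly_Mapping.keys g. ?G t)"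
    using poly_mapping_sum_singles[of f] poly_mapping_sum_singles[of g] by simp
  also have "\<dots> = (\<Sum>s\<in>Poly_Mapping.keys f. \<Sum>t\<in>Poly_Mapping.keys g. ?F s * ?G t)"
    by (rule sum_product)
  finally have "poly_eval \<theta> (f * g) = (\<Sum>s\<in>Poly_Mapping.keys f. \<Sum>t\<in>Poly_Mapping.keys g. poly_eval \<theta> (?F s) * poly_eval \<theta> (?G t))"
    by (simp add: poly_eval_sum mult_single poly_eval_single c_mult mono_eval_add mult_ac)
  also have "\<dots> = (\<Sum>s\<in>Poly_Mapping.keys f. poly_eval \<theta> (?F s)) * (\<Sum>t\<in>Poly_Mapping.keys g. poly_eval \<theta> (?G t))"
    by (rule sum_product[symmetric])
  also have "\<dots> = poly_eval \<theta> f * poly_eval \<theta> g"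
    unfolding poly_eval_sum[symmetric] poly_mapping_sum_singles[symmetric] ..
  finally show ?thesis .
qed

lemma poly_eval_Const [simp]: "poly_eval \<theta> (Const x) = c x"
  by (simp add: Const_def poly_eval_single)

lemma poly_eval_Var [simp]: "poly_eval \<theta> (Var v) = \<theta> v"
  by (simp add: Var_def poly_eval_single c_1)

lemma poly_eval_1 [simp]: "poly_eval \<theta> 1 = 1"
  by (simp add: poly_eval_single c_1 flip: single_one)

end

lemma Const_add: "Const (x + y) = Const x + Const y" and Const_mult: "Const (x * y) = Const x * Const y"
  and Const_1: "Const 1 = 1" and Const_0: "Const 0 = 0"
  by (simp_all add: Const_def single_add mult_single)

interpretation dehom: ring_embedding "Const :: complex \<Rightarrow> 'v cpoly"
  by unfold_locales (simp_all add: Const_add Const_mult Const_1)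

interpretation fls_eval: ring_embedding "fls_const :: complex \<Rightarrow> complex fls"
  by unfold_locales (auto intro: fls_eqI)

interpretation cpoly_vs: vector_space "\<lambda>x (f :: 'v cpoly). Const x * f"
  by unfold_locales (simp_all add: Const_add Const_mult Const_1 algebra_simps)

lemma Const_single: "Const x * Poly_Mapping.single t y = Poly_Mapping.single t (x * y)"
  by (simp add: Const_def mult_single)

section \<open>Ideals of the polynomial rings\<close>

interpretation cpoly_ring: cring "cpoly_ring :: 'v cpoly ring"
  by (rule cring_from_type_algebra)

lemma cpoly_ring_simps [simp]:
  "carrier (cpoly_ring :: 'v cpoly ring) = UNIV" "x \<otimes>\<^bsub>cpoly_ring\<^esub> y = x * (y :: 'v cpoly)"
  "x \<oplus>\<^bsub>cpoly_ring\<^esub> y = x + (y :: 'v cpoly)" "\<zero>\<^bsub>cpoly_ring\<^esub> = (0 :: 'v cpoly)" "\<one>\<^bsub>cpoly_ring\<^esub> = (1 :: 'v cpoly)"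
  by (simp_all add: ring_of_type_algebra_def)

lemma cpoly_ring_uminus: "\<ominus>\<^bsub>cpoly_ring\<^esub> x = - (x :: 'v cpoly)"
  using cpoly_ring.minus_equality[of "- x" x] by simp

lemma ideal_cpolyI:
  fixes I :: "'v cpoly set"
  assumes "0 \<in> I" "\<And>f g. f \<in> I \<Longrightarrow> g \<in> I \<Longrightarrow> f + g \<in> I" "\<And>f g. f \<in> I \<Longrightarrow> g * f \<in> I"
  shows "ideal I cpoly_ring"
proof (rule idealI[OF cpoly_ring.ring_axioms])
  show "subgroup I (add_monoid cpoly_ring)"
  proof
    show "inv\<^bsub>add_monoid cpoly_ring\<^esub> x \<in> I" if "x \<in> I" for x
      using assms(3)[OF that, of "- 1"] cpoly_ring_uminus[of x] by (simp add: a_inv_def)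
  qed (use assms in auto)
qed (use assms in \<open>auto simp: mult.commute\<close>)

lemma
  fixes I :: "'v cpoly set"
  assumes "ideal I cpoly_ring"
  shows ideal_cpoly_0: "0 \<in> I" and ideal_cpoly_add: "f \<in> I \<Longrightarrow> g \<in> I \<Longrightarrow> f + g \<in> I"
    and ideal_cpoly_mult: "f \<in> I \<Longrightarrow> g * f \<in> I"
proof -
  interpret ideal I cpoly_ring by fact
  show "0 \<in> I" using additive_subgroup.zero_closed[OF additive_subgroup_axioms] by simp
  show "f + g \<in> I" if "f \<in> I" "g \<in> I" for f g
    using additive_subgroup.a_closed[OF additive_subgroup_axioms that] by simp
  show "g * f \<in> I" if "f \<in> I" for f g using I_l_closed[OF that, of g] by simp
qed

lemma ideal_genideal_cpoly: "ideal (Idl\<^bsub>cpoly_ring\<^esub> S) cpoly_ring" for S :: "'v cpoly set"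
  by (rule cpoly_ring.genideal_ideal) simp

lemma genideal_cpoly_self: "f \<in> S \<Longrightarrow> f \<in> Idl\<^bsub>cpoly_ring\<^esub> S" for S :: "'v cpoly set"
  using cpoly_ring.genideal_self[of S] by auto

lemma genideal_cpoly_subset: "ideal I cpoly_ring \<Longrightarrow> S \<subseteq> I \<Longrightarrow> Idl\<^bsub>cpoly_ring\<^esub> S \<subseteq> I" for S :: "'v cpoly set"
  by (rule cpoly_ring.genideal_minimal)

section \<open>Spaces spanned by monomials, and the weighted degree\<close>

definition supported :: "('v \<Rightarrow>\<^sub>0 nat) set \<Rightarrow> 'v cpoly set" where
  "supported P = {f. Poly_Mapping.keys f \<subseteq> P}"

lemma supported_subspace: "cpoly_vs.subspace (supported P)"
proof -
  have "Poly_Mapping.keys (Const x * f) \<subseteq> Poly_Mapping.keys f" for x and f :: "'v cpoly"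
    using mult_map_scale_conv_mult[of x f] by (auto simp: Const_def Poly_Mapping.keys.rep_eq Poly_Mapping.map.rep_eq when_def simp flip: mult_map_scale_conv_mult)
  then have "Const x * f \<in> supported P" if "f \<in> supported P" for x f
    using that unfolding supported_def by fast
  moreover have "f + g \<in> supported P" if "f \<in> supported P" "g \<in> supported P" for f g
    using that Poly_Mapping.keys_add[of f g] unfolding supported_def by fast
  ultimately show ?thesis
    unfolding cpoly_vs.subspace_def by (simp add: supported_def)
qed

lemma supported_mono: "P \<subseteq> R \<Longrightarrow> supported P \<subseteq> supported R"
  by (auto simp: supported_def)

lemma supported_mult:
  assumes "f \<in> supported P" "g \<in> supported R" "\<And>s t. s \<in> P \<Longrightarrow> t \<in> R \<Longrightarrow> s + t \<in> S"
  shows "f * g \<in> supported S"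
  using assms keys_mult[of f g] unfolding supported_def by blast

lemma supported_subset_subspace:
  assumes "cpoly_vs.subspace G" "\<And>t. t \<in> P \<Longrightarrow> Poly_Mapping.single t 1 \<in> G"
  shows "supported P \<subseteq> G"
proof
  fix f assume f: "f \<in> supported P"
  have "(\<Sum>t\<in>Poly_Mapping.keys f. Const (Poly_Mapping.lookup f t) * Poly_Mapping.single t 1) \<in> G"
    using f assms by (intro cpoly_vs.subspace_sum cpoly_vs.subspace_scale) (auto simp: supported_def)
  then show "f \<in> G" using poly_mapping_sum_singles[of f] by (simp add: Const_single)
qed

lemma UNIV_aff_var: "(UNIV :: 'i aff_var set) = insert VarB (range VarA)"
  by (auto intro: aff_var.exhaust)

lemma finite_UNIV_aff_var: "finite (UNIV :: 'i::finite aff_var set)"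
  by (simp add: UNIV_aff_var)

lemma sum_UNIV_aff_var: "(\<Sum>v\<in>(UNIV :: 'i::finite aff_var set). f v) = (\<Sum>i\<in>UNIV. f (VarA i)) + f VarB"
  unfolding UNIV_aff_var by (subst sum.insert) (auto simp: sum.reindex inj_on_def add.commute)

lemma prod_UNIV_aff_var: "(\<Prod>v\<in>(UNIV :: 'i::finite aff_var set). f v) = (\<Prod>i\<in>UNIV. f (VarA i)) * f VarB"
  unfolding UNIV_aff_var by (subst prod.insert) (auto simp: prod.reindex inj_on_def mult.commute)

definition expo :: "('i::finite \<Rightarrow> nat) \<Rightarrow> nat \<Rightarrow> 'i aff_var \<Rightarrow>\<^sub>0 nat" where
  "expo a b = (\<Sum>i\<in>UNIV. Poly_Mapping.single (VarA i) (a i)) + Poly_Mapping.single VarB b"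

lemma lookup_expo [simp]:
  "Poly_Mapping.lookup (expo a b) (VarA i) = a i" "Poly_Mapping.lookup (expo a b) VarB = b"
  by (simp_all add: expo_def lookup_add lookup_sum lookup_single when_def)

lemma expo_eqI: "t = expo (\<lambda>i. Poly_Mapping.lookup t (VarA i)) (Poly_Mapping.lookup t VarB)"
proof (rule poly_mapping_eqI)
  fix v show "Poly_Mapping.lookup t v = Poly_Mapping.lookup (expo (\<lambda>i. Poly_Mapping.lookup t (VarA i)) (Poly_Mapping.lookup t VarB)) v"
    by (cases v) simp_all
qed

lemma expo_inject [simp]: "expo a b = expo a' b' \<longleftrightarrow> a = a' \<and> b = b'"
proof
  assume "expo a b = expo a' b'"
  then have "Poly_Mapping.lookup (expo a b) v = Poly_Mapping.lookup (expo a' b') v" for v by simp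
  from this[of "VarA _"] this[of VarB] show "a = a' \<and> b = b'" by auto
qed simp

lemma expo_add: "expo a b + expo a' b' = expo (\<lambda>i. a i + a' i) (b + b')"
  by (simp add: expo_def sum.distrib single_add add_ac)

abbreviation aff_deg :: "('i::finite aff_var \<Rightarrow>\<^sub>0 nat) \<Rightarrow> nat" where
  "aff_deg \<equiv> wdeg_mon aff_weight"

lemma aff_deg_eq: "aff_deg t = (\<Sum>i\<in>UNIV. Poly_Mapping.lookup t (VarA i)) + 2 * Poly_Mapping.lookup t VarB"
proof -
  have "aff_deg t = (\<Sum>v\<in>UNIV. aff_weight v * Poly_Mapping.lookup t v)"
    unfolding wdeg_mon_def by (rule sum.mono_neutral_left) (auto simp: in_keys_iff finite_UNIV_aff_var)
  then show ?thesis by (simp add: sum_UNIV_aff_var)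
qed

lemma aff_deg_expo [simp]: "aff_deg (expo a b) = sum a UNIV + 2 * b"
  by (simp add: aff_deg_eq)

lemma aff_deg_add: "aff_deg (s + t) = aff_deg s + aff_deg t"
  by (simp add: aff_deg_eq lookup_add sum.distrib)

definition aff_mono :: "('i::finite \<Rightarrow> nat) \<Rightarrow> nat \<Rightarrow> 'i aff_var cpoly" where
  "aff_mono a b = Poly_Mapping.single (expo a b) 1"

lemma aff_mono_mult: "aff_mono a b * aff_mono a' b' = aff_mono (\<lambda>i. a i + a' i) (b + b')"
  by (simp add: aff_mono_def mult_single expo_add)

lemma expo_0: "expo (\<lambda>_. 0) 0 = 0"
  by (simp add: expo_def)

lemma expo_VarA: "expo ((\<lambda>_. 0)(i := k)) 0 = Poly_Mapping.single (VarA i) k"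
  by (rule poly_mapping_eqI, case_tac ka) (auto simp: lookup_single when_def)

lemma expo_VarB: "expo (\<lambda>_. 0) k = Poly_Mapping.single VarB k"
  by (simp add: expo_def)

lemma aff_mono_0: "aff_mono (\<lambda>_. 0) 0 = 1"
  by (simp add: aff_mono_def expo_0)

lemma Var_VarA: "Var (VarA i) = aff_mono ((\<lambda>_. 0)(i := 1)) 0"
  and Var_VarB: "Var VarB = aff_mono (\<lambda>_. 0) 1"
  by (simp_all only: Var_def aff_mono_def expo_VarA expo_VarB)

text \<open>Leading terms are compared modulo \<open>subtop\<close>, that is, at \<open>B = 0\<close> and up to lower weighted degree.\<close>

definition fil :: "nat \<Rightarrow> 'i::finite aff_var cpoly set" where
  "fil m = supported {t. aff_deg t \<le> m}"

definition subtop :: "nat \<Rightarrow> 'i::finite aff_var cpoly set" where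
  "subtop m = supported {t. aff_deg t < m \<or> aff_deg t = m \<and> Poly_Mapping.lookup t VarB > 0}"

lemma subtop_mult: "f \<in> subtop a \<Longrightarrow> g \<in> fil b \<Longrightarrow> f * g \<in> subtop (a + b)"
  unfolding fil_def subtop_def by (rule supported_mult) (auto simp: aff_deg_add lookup_add)

lemma subtop_fil: "subtop m \<subseteq> fil m" and fil_subtop: "m < m' \<Longrightarrow> fil m \<subseteq> subtop m'"
  unfolding fil_def subtop_def by (rule supported_mono; auto)+

lemma subspace_fil: "cpoly_vs.subspace (fil m)" and subspace_subtop: "cpoly_vs.subspace (subtop m)"
  unfolding fil_def subtop_def by (rule supported_subspace)+

lemma aff_mono_fil: "sum a UNIV + 2 * b \<le> m \<Longrightarrow> aff_mono a b \<in> fil m"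
  by (simp add: fil_def supported_def aff_mono_def)

lemma Const_fil: "Const x \<in> fil m"
  using cpoly_vs.subspace_scale[OF subspace_fil aff_mono_fil[of "\<lambda>_. 0" 0 m], of x] by (simp add: aff_mono_0)

lemma Var_VarA_fil: "Var (VarA i) \<in> fil 1"
  unfolding Var_VarA by (rule aff_mono_fil) (simp add: fun_upd_def)

lemma VarB_subtop: "Var VarB \<in> subtop 2"
  unfolding Var_VarB by (simp add: subtop_def supported_def aff_mono_def)

section \<open>Leading forms of the logarithmic obstructions\<close>

locale singular_point =
  fixes q :: "int \<Rightarrow> 'i::finite aff_var cpoly" and i :: 'i and l :: nat
  assumes q_res: "q (-1) = Var (VarA i)"
    and q_nonneg: "\<And>s. s \<ge> 0 \<Longrightarrow> q s - (if s = 0 then Var VarB else 0) \<in> fil 1"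
begin

text \<open>For \<open>s \<ge> 0\<close> the degree of \<open>q s\<close> is at most 1, which is
  less than \<open>s + 2\<close>, apart from \<open>B\<close> in \<open>q 0\<close>, which has
  degree 2 but is discarded in \<open>subtop\<close>. Hence only \<open>q (-1) = A_i\<close>
  contributes to leading terms.\<close>

lemma q_subtop: "s \<ge> 0 \<Longrightarrow> q s \<in> subtop (nat (s + 2))"
proof -
  assume s: "s \<ge> 0"
  have "q s - (if s = 0 then Var VarB else 0) \<in> subtop (nat (s + 2))"
    using q_nonneg[OF s] fil_subtop[of 1 "nat (s + 2)"] s by auto
  moreover have "(if s = 0 then Var VarB else 0) \<in> subtop (nat (s + 2))"
    using VarB_subtop cpoly_vs.subspace_0[OF subspace_subtop] by auto
  ultimately have "(q s - (if s = 0 then Var VarB else 0)) + (if s = 0 then Var VarB else 0) \<in> subtop (nat (s + 2))"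
    by (rule cpoly_vs.subspace_add[OF subspace_subtop])
  then show ?thesis by simp
qed

abbreviation power_A :: "nat \<Rightarrow> 'i aff_var cpoly" where
  "power_A k \<equiv> aff_mono ((\<lambda>_. 0)(i := k)) 0"

lemma power_A_Suc: "Var (VarA i) * power_A k = power_A (Suc k)"
  unfolding Var_VarA aff_mono_mult by (rule arg_cong2[of _ _ _ _ aff_mono]) auto

lemma power_A_fil: "power_A k \<in> fil k"
  by (rule aff_mono_fil) (simp add: fun_upd_def)

text \<open>The term \<open>s = -1\<close> multiplies the leading power of \<open>A_i\<close> by one
  more \<open>A_i\<close>; the others fall into \<open>subtop k\<close>. Up to its scalar factor,
  this sum is \<open>c_k\<close> for \<open>1 \<le> k \<le> l\<close>, and for
  \<open>k = l + 1\<close> it is the obstruction.\<close>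

lemma leading_step:
  assumes "\<And>k'. k' < k \<Longrightarrow> c k' \<in> fil k'" and k: "k > 0"
    and "c (k - 1) - Const \<gamma> * power_A (k - 1) \<in> subtop (k - 1)"
  shows "(\<Sum>s\<in>{-1..int k - 2}. q s * c (nat (int k - 2 - s))) - Const \<gamma> * power_A k \<in> subtop k"
proof -
  have "{-1..int k - 2} = insert (-1) {0..int k - 2}" using k by auto
  then have e1: "(\<Sum>s\<in>{-1..int k - 2}. q s * c (nat (int k - 2 - s))) =
      q (-1) * c (k - 1) + (\<Sum>s\<in>{0..int k - 2}. q s * c (nat (int k - 2 - s)))"
    using k by (simp add: nat_diff_distrib')
  have "(c (k - 1) - Const \<gamma> * power_A (k - 1)) * Var (VarA i) \<in> subtop (k - 1 + 1)"
    by (rule subtop_mult[OF assms(3) Var_VarA_fil])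
  then have e2: "q (-1) * c (k - 1) - Const \<gamma> * power_A k \<in> subtop k"
    using k power_A_Suc[of "k - 1"] by (simp add: q_res algebra_simps)
  have e3: "(\<Sum>s\<in>{0..int k - 2}. q s * c (nat (int k - 2 - s))) \<in> subtop k"
  proof (rule cpoly_vs.subspace_sum[OF subspace_subtop])
    fix s assume s: "s \<in> {0..int k - 2}"
    have "q s * c (nat (int k - 2 - s)) \<in> subtop (nat (s + 2) + nat (int k - 2 - s))"
      using s by (intro subtop_mult q_subtop assms(1)) auto
    also have "nat (s + 2) + nat (int k - 2 - s) = k" using s by auto
    finally show "q s * c (nat (int k - 2 - s)) \<in> subtop k" .
  qed
  show ?thesis
    using cpoly_vs.subspace_add[OF subspace_subtop e2 e3] unfolding e1 by (simp only: diff_add_eq)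
qed

lemma frobenius_leading:
  "k \<le> l \<Longrightarrow> \<exists>\<gamma>. \<gamma> \<noteq> 0 \<and> frobenius_coeff q l k - Const \<gamma> * power_A k \<in> subtop k"
proof (induction k rule: less_induct)
  case (less k)
  have fil: "frobenius_coeff q l k' \<in> fil k'" if k': "k' < k" for k'
  proof -
    have "\<exists>\<gamma>. \<gamma> \<noteq> 0 \<and> frobenius_coeff q l k' - Const \<gamma> * power_A k' \<in> subtop k'"
      by (rule less.IH) (use less.prems k' in auto)
    then obtain \<gamma> where "frobenius_coeff q l k' - Const \<gamma> * power_A k' \<in> subtop k'" by blast
    then have "frobenius_coeff q l k' - Const \<gamma> * power_A k' \<in> fil k'" using subtop_fil by blast
    then have "(frobenius_coeff q l k' - Const \<gamma> * power_A k') + Const \<gamma> * power_A k' \<in> fil k'"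
      by (intro cpoly_vs.subspace_add[OF subspace_fil] cpoly_vs.subspace_scale[OF subspace_fil] power_A_fil)
    then show ?thesis by simp
  qed
  show ?case
  proof (cases "k = 0")
    case True
    have "(\<lambda>_. 0 :: nat)(i := 0) = (\<lambda>_. 0)" by auto
    then have "power_A 0 = 1" by (simp only: aff_mono_0)
    then have "frobenius_coeff q l 0 - Const 1 * power_A 0 = 0"
      by (simp only: frobenius_coeff.simps[of q l 0] Const_1) simp
    then have "frobenius_coeff q l 0 - Const 1 * power_A 0 \<in> subtop 0"
      using cpoly_vs.subspace_0[OF subspace_subtop] by (simp only:)
    then show ?thesis unfolding True using one_neq_zero by blast
  next
    case False
    have "\<exists>\<gamma>. \<gamma> \<noteq> 0 \<and> frobenius_coeff q l (k - 1) - Const \<gamma> * power_A (k - 1) \<in> subtop (k - 1)"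
      by (rule less.IH) (use less.prems False in auto)
    then obtain \<gamma> where \<gamma>: "\<gamma> \<noteq> 0" "frobenius_coeff q l (k - 1) - Const \<gamma> * power_A (k - 1) \<in> subtop (k - 1)"
      by blast
    define d where "d = 1 / (of_nat k * (of_nat k - 1 - of_nat l) :: complex)"
    have "of_nat k \<noteq> (of_nat (Suc l) :: complex)" using less.prems by (simp only: of_nat_eq_iff)
    then have "of_nat k - 1 - of_nat l \<noteq> (0 :: complex)" by (simp add: algebra_simps)
    then have d: "d \<noteq> 0" using False by (simp add: d_def)
    let ?S = "\<Sum>s\<in>{-1..int k - 2}. q s * frobenius_coeff q l (nat (int k - 2 - s))"
    have "?S - Const \<gamma> * power_A k \<in> subtop k"
      using False by (intro leading_step fil \<gamma>) auto
    then have "Const d * (?S - Const \<gamma> * power_A k) \<in> subtop k"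
      by (rule cpoly_vs.subspace_scale[OF subspace_subtop])
    moreover have "frobenius_coeff q l k = Const d * ?S"
      using False by (subst frobenius_coeff.simps) (simp add: d_def)
    ultimately have "frobenius_coeff q l k - Const (d * \<gamma>) * power_A k \<in> subtop k"
      by (simp only: right_diff_distrib Const_mult mult.assoc)
    moreover have "d * \<gamma> \<noteq> 0" using d \<gamma>(1) by simp
    ultimately show ?thesis by blast
  qed
qed

lemma log_obstruction_leading:
  "\<exists>\<gamma>. \<gamma> \<noteq> 0 \<and> log_obstruction q l - Const \<gamma> * power_A (Suc l) \<in> subtop (Suc l)"
proof -
  have fil: "frobenius_coeff q l k \<in> fil k" if k: "k < Suc l" for k
  proof -
    obtain \<gamma> where "frobenius_coeff q l k - Const \<gamma> * power_A k \<in> subtop k" using frobenius_leading[of k] k by auto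
    then have "frobenius_coeff q l k - Const \<gamma> * power_A k \<in> fil k" using subtop_fil by blast
    then have "(frobenius_coeff q l k - Const \<gamma> * power_A k) + Const \<gamma> * power_A k \<in> fil k"
      by (intro cpoly_vs.subspace_add[OF subspace_fil] cpoly_vs.subspace_scale[OF subspace_fil] power_A_fil)
    then show ?thesis by simp
  qed
  obtain \<gamma> where \<gamma>: "\<gamma> \<noteq> 0" "frobenius_coeff q l l - Const \<gamma> * power_A l \<in> subtop l"
    using frobenius_leading[of l] by auto
  have "log_obstruction q l - Const \<gamma> * power_A (Suc l) \<in> subtop (Suc l)"
    using leading_step[of "Suc l" "frobenius_coeff q l" \<gamma>, OF fil] \<gamma> by (simp add: log_obstruction_def)
  then show ?thesis using \<gamma> by blast
qed

end

context lefschetz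
begin

definition basis_monomials :: "nat \<Rightarrow> ('i aff_var \<Rightarrow>\<^sub>0 nat) set" where
  "basis_monomials m = {expo a b | a b. a \<in> (\<Union>d. basis_exponents d) \<and> sum a UNIV + 2 * b \<le> m}"

lemma basis_monomials_mono: "m \<le> m' \<Longrightarrow> basis_monomials m \<subseteq> basis_monomials m'"
  by (fastforce simp: basis_monomials_def)

text \<open>Rewriting by an obstruction either lowers the weighted degree \<open>m\<close> or keeps
  it and produces a factor \<open>B\<close>, which lowers the degree \<open>d\<close> in the
  \<open>A_i\<close>; this dictates the nested inductions. Exponents outside the box are rewritten
  in this way (\<open>out\<close>), those inside by \<open>monomial_reduction\<close>.\<close>

theorem span_modulo_ideal:
  fixes I :: "'i aff_var cpoly set"
  assumes I: "ideal I cpoly_ring" and e: "(\<Sum>i\<in>UNIV. Var (VarA i)) \<in> I"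
    and F: "\<And>i. \<exists>\<gamma> f. \<gamma> \<noteq> 0 \<and> f \<in> I \<and> f - Const \<gamma> * aff_mono ((\<lambda>_. 0)(i := Suc (l i))) 0 \<in> subtop (Suc (l i))"
    and f: "f \<in> fil m"
  shows "\<exists>g\<in>supported (basis_monomials m). f - g \<in> I"
proof -
  define R where "R m = {f. \<exists>g\<in>supported (basis_monomials m). f - g \<in> I}" for m
  have sub: "cpoly_vs.subspace (R m)" for m
    unfolding cpoly_vs.subspace_def
  proof (intro conjI ballI allI)
    note SS = supported_subspace[of "basis_monomials m"]
    show "0 \<in> R m" using cpoly_vs.subspace_0[OF SS] ideal_cpoly_0[OF I] by (auto simp: R_def intro!: bexI[of _ 0])
    fix f g x assume "f \<in> R m"
    then obtain f' where f': "f' \<in> supported (basis_monomials m)" "f - f' \<in> I" by (auto simp: R_def)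
    show "Const x * f \<in> R m"
      unfolding R_def using ideal_cpoly_mult[OF I f'(2), of "Const x"] cpoly_vs.subspace_scale[OF SS f'(1), of x]
      by (intro CollectI bexI[of _ "Const x * f'"]) (simp_all add: algebra_simps)
    assume "g \<in> R m"
    then obtain g' where g': "g' \<in> supported (basis_monomials m)" "g - g' \<in> I" by (auto simp: R_def)
    show "f + g \<in> R m"
      unfolding R_def using ideal_cpoly_add[OF I f'(2) g'(2)] cpoly_vs.subspace_add[OF SS f'(1) g'(1)]
      by (intro CollectI bexI[of _ "f' + g'"]) (simp_all add: algebra_simps)
  qed
  have mono: "R m \<subseteq> R m'" if "m \<le> m'" for m m'
    using supported_mono[OF basis_monomials_mono[OF that]] by (auto simp: R_def)
  have IR: "I \<subseteq> R m" for m
    using cpoly_vs.subspace_0[OF supported_subspace] by (auto simp: R_def intro!: bexI[of _ 0])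
  have main: "\<forall>a b. sum a UNIV + 2 * b = m \<longrightarrow> sum a UNIV = d \<longrightarrow> aff_mono a b \<in> R m" for m d
  proof (induction m arbitrary: d rule: less_induct)
    case outer: (less m)
    show ?case
    proof (induction d rule: less_induct)
      case inner: (less d)
      have IH: "Poly_Mapping.single t 1 \<in> R m" if t: "aff_deg t < m \<or> aff_deg t = m \<and> (\<Sum>i\<in>UNIV. Poly_Mapping.lookup t (VarA i)) < d" for t
      proof -
        define a where "a = (\<lambda>i. Poly_Mapping.lookup t (VarA i))"
        define b where "b = Poly_Mapping.lookup t VarB"
        have tab: "t = expo a b" unfolding a_def b_def by (rule expo_eqI)
        have "aff_mono a b \<in> R (aff_deg t)"
        proof (cases "aff_deg t < m")
          case True
          then show ?thesis using outer[of "aff_deg t" "sum a UNIV"] by (simp add: tab)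
        next
          case False
          then show ?thesis using inner[of "sum a UNIV"] t by (simp add: tab)
        qed
        moreover have "aff_deg t \<le> m" using t by auto
        ultimately show ?thesis using mono tab by (auto simp: aff_mono_def)
      qed
      have out: "aff_mono a b \<in> R m" if ab: "sum a UNIV + 2 * b = m" "sum a UNIV = d" and a: "a \<notin> nbox l" for a b
      proof -
        obtain i where i: "l i < a i" using a by (auto simp: nbox_def not_le)
        obtain \<gamma> f where f: "\<gamma> \<noteq> 0" "f \<in> I" and g: "f - Const \<gamma> * aff_mono ((\<lambda>_. 0)(i := Suc (l i))) 0 \<in> subtop (Suc (l i))"
          using F[of i] by blast
        define g where "g = f - Const \<gamma> * aff_mono ((\<lambda>_. 0)(i := Suc (l i))) 0"
        define a' where "a' = a(i := a i - Suc (l i))"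
        have split: "aff_mono a b = aff_mono ((\<lambda>_. 0)(i := Suc (l i))) 0 * aff_mono a' b"
          unfolding aff_mono_mult using i by (intro arg_cong2[of _ _ _ _ aff_mono]) (auto simp: a'_def)
        have sa: "sum a UNIV = Suc (l i) + sum a' UNIV"
        proof -
          have "sum a' UNIV + a i = sum a UNIV + (a i - Suc (l i))" unfolding a'_def by (rule sum_fun_upd)
          then show ?thesis using i by simp
        qed
        have "g * aff_mono a' b \<in> supported {t. aff_deg t < m \<or> aff_deg t = m \<and> (\<Sum>i\<in>UNIV. Poly_Mapping.lookup t (VarA i)) < d}"
        proof (rule supported_mult)
          show "g \<in> supported {t. aff_deg t < Suc (l i) \<or> aff_deg t = Suc (l i) \<and> Poly_Mapping.lookup t VarB > 0}"
            using g by (simp add: g_def subtop_def)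
          show "aff_mono a' b \<in> supported {expo a' b}" by (simp add: supported_def aff_mono_def)
          fix s t :: "'i aff_var \<Rightarrow>\<^sub>0 nat" assume s: "s \<in> {t. aff_deg t < Suc (l i) \<or> aff_deg t = Suc (l i) \<and> Poly_Mapping.lookup t VarB > 0}" and t: "t \<in> {expo a' b}"
          have "aff_deg (s + t) = aff_deg s + sum a' UNIV + 2 * b" using t by (simp add: aff_deg_add)
          moreover have "(\<Sum>i\<in>UNIV. Poly_Mapping.lookup (s + t) (VarA i)) = (\<Sum>i\<in>UNIV. Poly_Mapping.lookup s (VarA i)) + sum a' UNIV"
            using t by (simp add: lookup_add sum.distrib)
          ultimately show "s + t \<in> {t. aff_deg t < m \<or> aff_deg t = m \<and> (\<Sum>i\<in>UNIV. Poly_Mapping.lookup t (VarA i)) < d}"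
            using s ab sa by (auto simp: aff_deg_eq[of s])
        qed
        also have "\<dots> \<subseteq> R m" using IH by (intro supported_subset_subspace sub) auto
        finally have gR: "g * aff_mono a' b \<in> R m" .
        have "aff_mono a' b * f \<in> R m" using ideal_cpoly_mult[OF I f(2)] IR by blast
        then have "Const (1 / \<gamma>) * (aff_mono a' b * f - g * aff_mono a' b) \<in> R m"
          using gR by (intro cpoly_vs.subspace_scale[OF sub] cpoly_vs.subspace_diff[OF sub])
        moreover have "aff_mono a' b * f - g * aff_mono a' b = Const \<gamma> * aff_mono a b"
          unfolding g_def split by (simp add: algebra_simps)
        then have "Const (1 / \<gamma>) * (aff_mono a' b * f - g * aff_mono a' b) = Const (1 / \<gamma> * \<gamma>) * aff_mono a b"
          by (simp only: Const_mult mult.assoc)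
        ultimately show ?thesis using f(1) by (simp add: Const_1)
      qed
      show ?case
      proof (intro allI impI)
        fix a :: "'i \<Rightarrow> nat" and b assume ab: "sum a UNIV + 2 * b = m" "sum a UNIV = d"
        show "aff_mono a b \<in> R m"
        proof (cases "a \<in> nbox l")
          case True
          show ?thesis
          proof (rule monomial_reduction[OF cpoly_vs.vector_space_axioms sub, where d = d and mo = "\<lambda>a. aff_mono a b"])
            show "a \<in> level l d" using True ab by (simp add: level_def)
            fix t assume t: "t \<in> basis_exponents d"
            then have "sum t UNIV = d" using basis_exponents_subset by (auto simp: level_def)
            then have "expo t b \<in> basis_monomials m" using t ab by (auto simp: basis_monomials_def)
            then have "aff_mono t b \<in> supported (basis_monomials m)" by (simp add: supported_def aff_mono_def)
            then show "aff_mono t b \<in> R m" using ideal_cpoly_0[OF I] by (auto simp: R_def intro!: bexI[of _ "aff_mono t b"])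
          next
            fix b' assume d: "d > 0" and b': "b' \<in> level l (d - 1)"
            let ?u = "\<lambda>i. b'(i := b' i + 1)"
            have deg: "sum (?u i) UNIV = d" for i
            proof -
              have "sum (?u i) UNIV + b' i = sum b' UNIV + (b' i + 1)" by (rule sum_fun_upd)
              then show ?thesis using b' d by (simp add: level_def)
            qed
            have "aff_mono b' b * (\<Sum>i\<in>UNIV. Var (VarA i)) \<in> R m"
              using ideal_cpoly_mult[OF I e] IR by blast
            also have "aff_mono b' b * (\<Sum>i\<in>UNIV. Var (VarA i)) = (\<Sum>i\<in>UNIV. aff_mono (?u i) b)"
              unfolding sum_distrib_left Var_VarA aff_mono_mult
              by (intro sum.cong refl arg_cong2[of _ _ _ _ aff_mono]) auto
            \<comment> \<open>A multiple of \<open>A_1 + ... + A_r\<close> may leave the box; the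
              terms that do so already lie in \<open>R m\<close> by \<open>out\<close>, so what
              remains is the relation of the truncated ring.\<close>
            also have "\<dots> = (\<Sum>i | ?u i \<in> nbox l. aff_mono (?u i) b) + (\<Sum>i | ?u i \<notin> nbox l. aff_mono (?u i) b)"
              by (subst sum.union_disjoint[symmetric]) (auto intro!: sum.cong)
            finally have "(\<Sum>i | ?u i \<in> nbox l. aff_mono (?u i) b) + (\<Sum>i | ?u i \<notin> nbox l. aff_mono (?u i) b) \<in> R m" .
            moreover have "(\<Sum>i | ?u i \<notin> nbox l. aff_mono (?u i) b) \<in> R m"
              using deg ab by (intro cpoly_vs.subspace_sum[OF sub] out) auto
            ultimately show "(\<Sum>i | ?u i \<in> nbox l. aff_mono (?u i) b) \<in> R m"
              using cpoly_vs.subspace_diff[OF sub] by fastforce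
          qed
        qed (use out ab in blast)
      qed
    qed
  qed
  have "fil m \<subseteq> R m"
    unfolding fil_def
  proof (rule supported_subset_subspace[OF sub])
    fix t :: "'i aff_var \<Rightarrow>\<^sub>0 nat" assume t: "t \<in> {t. aff_deg t \<le> m}"
    define a where "a = (\<lambda>i. Poly_Mapping.lookup t (VarA i))"
    define b where "b = Poly_Mapping.lookup t VarB"
    have tab: "t = expo a b" unfolding a_def b_def by (rule expo_eqI)
    have "aff_mono a b \<in> R (sum a UNIV + 2 * b)" using main by blast
    then show "Poly_Mapping.single t 1 \<in> R m"
      using mono[of "sum a UNIV + 2 * b" m] t unfolding tab aff_mono_def by auto
  qed
  then show ?thesis using f by (auto simp: R_def)
qed

end

section \<open>The points at infinity and their branches\<close>

text \<open>Values of monomials in the \<open>A\<^sub>i\<close> at the \<open>F(n)\<close> points at infinity \<open>B = 1\<close>, \<open>A\<^sub>i = l\<^sub>i - 2 k\<^sub>i\<close>.\<close>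

context lefschetz
begin

definition infinity_value :: "('i \<Rightarrow> nat) \<Rightarrow> ('i \<Rightarrow> nat) \<Rightarrow> complex" where
  "infinity_value a k = (if k \<in> level l N then \<Prod>i\<in>UNIV. (of_nat (l i) - 2 * of_nat (k i)) ^ a i else 0)"

lemma infinity_value_add: "infinity_value (\<lambda>i. a i + a' i) k = infinity_value a k * infinity_value a' k"
  by (simp add: infinity_value_def power_add prod.distrib)

definition all_exponents :: "('i \<Rightarrow> nat) set" where
  "all_exponents = (\<Union>d\<le>N. basis_exponents d)"

lemma basis_exponents_empty: "d > N \<Longrightarrow> basis_exponents d = {}"
  using card_basis_exponents[of d] card_0_eq[OF finite_subset[OF basis_exponents_subset finite_level]] by simp

lemma all_exponents_eq: "all_exponents = (\<Union>d. basis_exponents d)"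
proof -
  have "basis_exponents d \<subseteq> all_exponents" for d
    using basis_exponents_empty[of d] by (cases "d \<le> N") (auto simp: all_exponents_def)
  then show ?thesis by (auto simp: all_exponents_def)
qed

lemma finite_basis_exponents: "finite (basis_exponents d)"
  using basis_exponents_subset finite_level by (rule finite_subset)

lemma finite_all_exponents: "finite all_exponents"
  by (simp add: all_exponents_def finite_basis_exponents)

lemma sum_all_exponents: "(\<Sum>a\<in>all_exponents. f (sum a UNIV)) = (\<Sum>d\<le>N. of_nat (card (basis_exponents d)) * f d)"
  for f :: "nat \<Rightarrow> 'c::semiring_1"
proof -
  have "(\<Sum>a\<in>all_exponents. f (sum a UNIV)) = (\<Sum>d\<le>N. \<Sum>a\<in>basis_exponents d. f (sum a UNIV))"
    unfolding all_exponents_def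
  proof (rule sum.UNION_disjoint)
    show "\<forall>d\<in>{..N}. \<forall>e\<in>{..N}. d \<noteq> e \<longrightarrow> basis_exponents d \<inter> basis_exponents e = {}"
    proof (intro ballI impI)
      fix d e :: nat assume "d \<noteq> e"
      then show "basis_exponents d \<inter> basis_exponents e = {}"
        using basis_exponents_subset[of d] basis_exponents_subset[of e] by (auto simp: level_def)
    qed
  qed (auto simp: finite_basis_exponents)
  also have "\<dots> = (\<Sum>d\<le>N. of_nat (card (basis_exponents d)) * f d)"
  proof (rule sum.cong[OF refl])
    fix d
    have "(\<Sum>a\<in>basis_exponents d. f (sum a UNIV)) = (\<Sum>a\<in>basis_exponents d. f d)"
      using basis_exponents_subset[of d] by (intro sum.cong) (auto simp: level_def)
    then show "(\<Sum>a\<in>basis_exponents d. f (sum a UNIV)) = of_nat (card (basis_exponents d)) * f d" by simp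
  qed
  finally show ?thesis .
qed

lemma card_basis_exponents_diff:
  "int (card (basis_exponents d)) = (if d = 0 then 1 else if d \<le> N then int (card (level l d)) - int (card (level l (d - 1))) else 0)"
  using card_basis_exponents[of d] card_level_mono[of d] by (auto simp: of_nat_diff)

lemma card_level_0: "card (level l 0) = 1"
proof -
  have "level l 0 = {\<lambda>_. 0}" by (auto simp: level_def nbox_def)
  then show ?thesis by simp
qed

text \<open>The differences of consecutive level sizes telescope. The right-hand side is the number
  of points at infinity.\<close>

lemma card_all_exponents: "card all_exponents = card (level l N)"
proof -
  have "(\<Sum>d\<le>M. int (card (basis_exponents d))) = int (card (level l M))" if "M \<le> N" for M
    using that
  proof (induction M)
    case 0 then show ?case by (simp add: card_basis_exponents_diff card_level_0)
  next
    case (Suc M) then show ?case by (simp add: card_basis_exponents_diff)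
  qed
  from this[of N] have "(\<Sum>a\<in>all_exponents. 1) = int (card (level l N))"
    using sum_all_exponents[of "\<lambda>_. 1 :: int"] by simp
  then show ?thesis by simp
qed

lemma sum_infinity_point: "k \<in> level l N \<Longrightarrow> (\<Sum>i\<in>UNIV. of_nat (l i) - 2 * of_nat (k i)) = (0 :: complex)"
proof -
  assume k: "k \<in> level l N"
  have "(\<Sum>i\<in>UNIV. of_nat (l i) - 2 * of_nat (k i)) = (of_nat (sum l UNIV) - 2 * of_nat (sum k UNIV) :: complex)"
    by (simp add: sum_subtractf sum_distrib_left)
  also have "\<dots> = 0" using k sum_l by (simp add: level_def del: of_nat_sum)
  finally show ?thesis .
qed

text \<open>At the points at infinity the coordinate \<open>A_i\<close> takes only the
  \<open>l i + 1\<close> values \<open>l i - 2 j\<close>, so it is a root of the monic polynomial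
  \<open>P\<close>. This takes the place of the obstruction in the reduction of exponents outside
  the box.\<close>

lemma infinity_value_reduce:
  assumes "l i < a i"
  shows "\<exists>c. infinity_value a = (\<Sum>e\<le>l i. (\<lambda>k. c e * infinity_value (a(i := a i - Suc (l i) + e)) k))"
proof -
  define P where "P = (\<Prod>j\<le>l i. [:- (of_nat (l i) - 2 * of_nat j), 1 :: complex:])"
  have degP: "Polynomial.degree P = Suc (l i)" unfolding P_def by (subst degree_prod_eq_sum_degree) auto
  have leadP: "Polynomial.lead_coeff P = 1" unfolding P_def by (simp add: lead_coeff_prod)
  show ?thesis
  proof (intro exI ext)
    fix k
    show "infinity_value a k = (\<Sum>e\<le>l i. (\<lambda>k. - Polynomial.coeff P e * infinity_value (a(i := a i - Suc (l i) + e)) k)) k"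
    proof (cases "k \<in> level l N")
      case True
      define x where "x = (of_nat (l i) - 2 * of_nat (k i) :: complex)"
      define r where "r = (\<Prod>i'\<in>UNIV - {i}. (of_nat (l i') - 2 * of_nat (k i')) ^ a i' :: complex)"
      have val: "infinity_value (a(i := e)) k = x ^ e * r" for e
        unfolding infinity_value_def using True by (subst prod.remove[of _ i]) (auto simp: x_def r_def intro!: prod.cong)
      have "k i \<le> l i" using True by (auto simp: level_def nbox_def)
      then have "poly P x = 0" unfolding P_def x_def poly_prod by (intro prod_zero) (auto intro!: bexI[of _ "k i"])
      then have "(\<Sum>e\<le>l i. Polynomial.coeff P e * x ^ e) + x ^ Suc (l i) = 0"
        using leadP by (simp add: poly_altdef degP)
      then have xs: "x ^ Suc (l i) = (\<Sum>e\<le>l i. - Polynomial.coeff P e * x ^ e)"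
        by (simp add: sum_negf eq_neg_iff_add_eq_0 add.commute)
      have "x ^ a i = x ^ (a i - Suc (l i)) * x ^ Suc (l i)"
        using assms by (simp only: power_add[symmetric]) simp
      then have "infinity_value a k = x ^ (a i - Suc (l i)) * x ^ Suc (l i) * r"
        using val[of "a i"] by (simp only: fun_upd_triv)
      also have "\<dots> = (\<Sum>e\<le>l i. - Polynomial.coeff P e * (x ^ (a i - Suc (l i) + e) * r))"
        unfolding xs by (simp add: sum_distrib_left sum_distrib_right power_add mult_ac sum_negf)
      finally show ?thesis by (simp only: val sum_fun_apply)
    qed (simp add: infinity_value_def sum_fun_apply)
  qed
qed

text \<open>The same reduction as in \<open>span_modulo_ideal\<close>, for values instead of
  polynomials: the coordinates of every point at infinity sum to 0, and
  \<open>infinity_value_reduce\<close> handles large exponents.\<close>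

lemma infinity_value_span: "infinity_value a \<in> fun_vs.span (infinity_value ` all_exponents)"
proof -
  let ?S = "fun_vs.span (infinity_value ` all_exponents)"
  have "\<forall>a. sum a UNIV = d \<longrightarrow> infinity_value a \<in> ?S" for d
  proof (induction d rule: less_induct)
    case (less d)
    have out: "infinity_value a \<in> ?S" if a: "sum a UNIV = d" "a \<notin> nbox l" for a
    proof -
      obtain i where i: "l i < a i" using a by (auto simp: nbox_def not_le)
      then obtain c where c: "infinity_value a = (\<Sum>e\<le>l i. (\<lambda>k. c e * infinity_value (a(i := a i - Suc (l i) + e)) k))"
        using infinity_value_reduce by blast
      show ?thesis
        unfolding c
      proof (intro fun_vs.span_sum fun_vs.span_scale)
        fix e assume e: "e \<in> {..l i}"
        let ?a = "a(i := a i - Suc (l i) + e)"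
        have "sum ?a UNIV + a i = sum a UNIV + (a i - Suc (l i) + e)" by (rule sum_fun_upd)
        then have "sum ?a UNIV < d" using a i e by auto
        then show "infinity_value ?a \<in> ?S" using less by blast
      qed
    qed
    show ?case
    proof (intro allI impI)
      fix a :: "'i \<Rightarrow> nat" assume a: "sum a UNIV = d"
      show "infinity_value a \<in> ?S"
      proof (cases "a \<in> nbox l")
        case True
        show ?thesis
        proof (rule monomial_reduction[OF fun_vs.vector_space_axioms fun_vs.subspace_span, where d = d and mo = infinity_value])
          show "a \<in> level l d" using True a by (simp add: level_def)
          fix t assume "t \<in> basis_exponents d"
          then show "infinity_value t \<in> ?S" by (intro fun_vs.span_base) (auto simp: all_exponents_eq)
        next
          fix b assume d: "d > 0" and b: "b \<in> level l (d - 1)"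
          let ?u = "\<lambda>i. b(i := b i + 1)"
          have deg: "sum (?u i) UNIV = d" for i
          proof -
            have "sum (?u i) UNIV + b i = sum b UNIV + (b i + 1)" by (rule sum_fun_upd)
            then show ?thesis using b d by (simp add: level_def)
          qed
          have "(\<Sum>i\<in>UNIV. infinity_value (?u i)) = 0"
          proof
            fix k
            show "(\<Sum>i\<in>UNIV. infinity_value (?u i)) k = 0 k"
            proof (cases "k \<in> level l N")
              case True
              have "infinity_value (?u i) k = (of_nat (l i) - 2 * of_nat (k i)) * infinity_value b k" for i
              proof -
                have "infinity_value (?u i) k = (of_nat (l i) - 2 * of_nat (k i)) ^ (b i + 1) *
                    (\<Prod>i'\<in>UNIV - {i}. (of_nat (l i') - 2 * of_nat (k i')) ^ b i')"
                  unfolding infinity_value_def using True by (subst prod.remove[of _ i]) (auto intro!: prod.cong)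
                moreover have "infinity_value b k = (of_nat (l i) - 2 * of_nat (k i)) ^ b i *
                    (\<Prod>i'\<in>UNIV - {i}. (of_nat (l i') - 2 * of_nat (k i')) ^ b i')"
                  unfolding infinity_value_def using True by (subst prod.remove[of _ i]) auto
                ultimately show ?thesis by simp
              qed
              then have "(\<Sum>i\<in>UNIV. infinity_value (?u i)) k = (\<Sum>i\<in>UNIV. of_nat (l i) - 2 * of_nat (k i)) * infinity_value b k"
                unfolding sum_fun_apply by (simp only: sum_distrib_right)
              then show ?thesis by (simp only: sum_infinity_point[OF True]) simp
            qed (simp add: infinity_value_def sum_fun_apply)
          qed
          also have "(\<Sum>i\<in>UNIV. infinity_value (?u i)) = (\<Sum>i | ?u i \<in> nbox l. infinity_value (?u i)) + (\<Sum>i | ?u i \<notin> nbox l. infinity_value (?u i))"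
            by (subst sum.union_disjoint[symmetric]) (auto intro!: sum.cong)
          finally have "(\<Sum>i | ?u i \<in> nbox l. infinity_value (?u i)) = - (\<Sum>i | ?u i \<notin> nbox l. infinity_value (?u i))"
            by (simp only: eq_neg_iff_add_eq_0)
          also have "\<dots> \<in> ?S"
            using deg by (intro fun_vs.span_neg fun_vs.span_sum out) auto
          finally show "(\<Sum>i | ?u i \<in> nbox l. infinity_value (?u i)) \<in> ?S" .
        qed
      qed (use out a in blast)
    qed
  qed
  then show ?thesis by blast
qed

text \<open>Lagrange interpolation: the product of the affine-linear factors \<open>lin\<close> over
  \<open>D\<close> is 1 at \<open>k\<close> and 0 at the other points of the level. It stays in the
  span, which is closed under multiplication by affine-linear functions of a single
  coordinate.\<close>

lemma unit_fun_infinity_span: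
  assumes k: "k \<in> level l N"
  shows "unit_fun k \<in> fun_vs.span (range infinity_value)"
proof -
  let ?S = "fun_vs.span (range infinity_value)"
  define x where "x i k' = (of_nat (l i) - 2 * of_nat (k' i) :: complex)" for i :: 'i and k' :: "'i \<Rightarrow> nat"
  have mult: "(\<lambda>k'. (\<alpha> * x i k' + \<beta>) * u k') \<in> ?S" if "u \<in> ?S" for \<alpha> \<beta> i u
  proof -
    have xi: "x i k' * infinity_value a k' = infinity_value (\<lambda>j. ((\<lambda>_. 0)(i := 1)) j + a j) k'" for a k'
    proof (cases "k' \<in> level l N")
      case True
      then have "infinity_value ((\<lambda>_. 0)(i := 1)) k' = x i k'"
        by (simp add: infinity_value_def x_def prod.remove[of UNIV i])
      then show ?thesis by (simp only: infinity_value_add)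
    qed (simp add: infinity_value_def)
    have "fun_vs.subspace {u. (\<lambda>k'. (\<alpha> * x i k' + \<beta>) * u k') \<in> ?S}"
    proof -
      have "(\<lambda>k'. (\<alpha> * x i k' + \<beta>) * (u k' + w k')) = (\<lambda>k'. (\<alpha> * x i k' + \<beta>) * u k') + (\<lambda>k'. (\<alpha> * x i k' + \<beta>) * w k')"
        "(\<lambda>k'. (\<alpha> * x i k' + \<beta>) * (c * u k')) = (\<lambda>k'. c * ((\<alpha> * x i k' + \<beta>) * u k'))" for u w c
        by (auto simp: algebra_simps)
      then show ?thesis
        using fun_vs.span_zero[of "range infinity_value"]
        by (auto simp: fun_vs.subspace_def fun_vs.span_add fun_vs.span_scale zero_fun_def)
    qed
    moreover have "range infinity_value \<subseteq> {u. (\<lambda>k'. (\<alpha> * x i k' + \<beta>) * u k') \<in> ?S}"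
    proof clarify
      fix a
      have "(\<lambda>k'. (\<alpha> * x i k' + \<beta>) * infinity_value a k') =
        (\<lambda>k'. \<alpha> * infinity_value (\<lambda>j. ((\<lambda>_. 0)(i := 1)) j + a j) k') + (\<lambda>k'. \<beta> * infinity_value a k')"
        by (rule ext) (simp add: distrib_right mult.assoc xi)
      also have "\<dots> \<in> ?S" by (intro fun_vs.span_add fun_vs.span_scale fun_vs.span_base rangeI)
      finally show "(\<lambda>k'. (\<alpha> * x i k' + \<beta>) * infinity_value a k') \<in> ?S" .
    qed
    ultimately have "?S \<subseteq> {u. (\<lambda>k'. (\<alpha> * x i k' + \<beta>) * u k') \<in> ?S}" by (intro fun_vs.span_minimal)
    then show ?thesis using that by blast
  qed
  define D where "D = (SIGMA i : UNIV. {..l i} - {k i})"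
  define lin where "lin z k' = (1 / (2 * of_nat (snd z) - 2 * of_nat (k (fst z)))) * x (fst z) k' +
     (2 * of_nat (snd z) - of_nat (l (fst z))) / (2 * of_nat (snd z) - 2 * of_nat (k (fst z)))" for z :: "'i \<times> nat" and k'
  have mult_lin: "(\<lambda>k'. lin z k' * u k') \<in> ?S" if "u \<in> ?S" for u z
    unfolding lin_def by (rule mult[OF that])
  have lin: "lin (i, j) k' = (2 * of_nat j - 2 * of_nat (k' i)) / (2 * of_nat j - 2 * of_nat (k i))" for i j k'
    by (simp add: lin_def x_def flip: add_divide_distrib)
  have "finite D'  \<Longrightarrow> (\<lambda>k'. (\<Prod>z\<in>D'. lin z k') * infinity_value (\<lambda>_. 0) k') \<in> ?S" for D'
  proof (induction D' rule: finite_induct)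
    case empty then show ?case by (auto intro!: fun_vs.span_base)
  next
    case (insert z D')
    have "(\<lambda>k'. (\<Prod>z\<in>insert z D'. lin z k') * infinity_value (\<lambda>_. 0) k') =
        (\<lambda>k'. lin z k' * ((\<Prod>z\<in>D'. lin z k') * infinity_value (\<lambda>_. 0) k'))"
      using insert by (simp add: mult.assoc)
    also have "\<dots> \<in> ?S" by (rule mult_lin[OF insert.IH])
    finally show ?case .
  qed
  moreover have "finite D" by (simp add: D_def)
  ultimately have "(\<lambda>k'. (\<Prod>z\<in>D. lin z k') * infinity_value (\<lambda>_. 0) k') \<in> ?S" by blast
  also have "(\<lambda>k'. (\<Prod>z\<in>D. lin z k') * infinity_value (\<lambda>_. 0) k') = unit_fun k"
  proof
    fix k'
    show "(\<Prod>z\<in>D. lin z k') * infinity_value (\<lambda>_. 0) k' = unit_fun k k'"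
    proof (cases "k' = k")
      case True
      have "lin z k = 1" if zD: "z \<in> D" for z
      proof -
        obtain i j where z: "z = (i, j)" "j \<noteq> k i" using zD by (auto simp: D_def)
        then have "of_nat j \<noteq> (of_nat (k i) :: complex)" by (simp only: of_nat_eq_iff not_False_eq_True)
        then have "(2 * of_nat j - 2 * of_nat (k i) :: complex) \<noteq> 0" by simp
        then show ?thesis by (simp add: z lin)
      qed
      then show ?thesis using True k by (simp add: unit_fun_def infinity_value_def)
    next
      case False
      show ?thesis
      proof (cases "k' \<in> level l N")
        case True
        obtain i where i: "k' i \<noteq> k i" using False by auto
        then have "(i, k' i) \<in> D" using True by (auto simp: D_def level_def nbox_def)
        moreover have "lin (i, k' i) k' = 0" by (simp add: lin)
        ultimately have "(\<Prod>z\<in>D. lin z k') = 0" using \<open>finite D\<close> by (intro prod_zero) auto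
        then show ?thesis using False by (simp add: unit_fun_def)
      qed (use False in \<open>simp add: unit_fun_def infinity_value_def\<close>)
    qed
  qed
  finally show ?thesis .
qed

text \<open>By interpolation the values of the basis monomials span all functions on the points at
  infinity, and there are as many monomials as points; a spanning family of that size is
  independent.\<close>

theorem infinity_values_independent:
  assumes 0: "\<And>k. k \<in> level l N \<Longrightarrow> (\<Sum>a\<in>all_exponents. c a * infinity_value a k) = 0" and a: "a \<in> all_exponents"
  shows "c a = 0"
proof -
  let ?E = "infinity_value ` all_exponents" and ?U = "unit_fun ` level l N"
  have "range infinity_value \<subseteq> fun_vs.span ?E" using infinity_value_span by auto
  then have "?U \<subseteq> fun_vs.span ?E"
    using unit_fun_infinity_span fun_vs.span_minimal[OF _ fun_vs.subspace_span] by blast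
  then obtain C where C: "C \<subseteq> ?E" "fun_vs.independent C" "?E \<subseteq> fun_vs.span C"
    using fun_vs.maximal_independent_subset[of ?E] by blast
  have finC: "finite C" using C(1) finite_all_exponents finite_subset by blast
  have "?U \<subseteq> fun_vs.span C"
    using \<open>?U \<subseteq> fun_vs.span ?E\<close> fun_vs.span_minimal[OF C(3) fun_vs.subspace_span] by blast
  then have "card ?U \<le> card C"
    using fun_vs.independent_span_bound[OF finC independent_unit_fun[OF finite_level]] by blast
  moreover have "card ?U = card all_exponents"
    by (simp add: card_image inj_on_subset[OF inj_unit_fun] card_all_exponents)
  ultimately have "card all_exponents \<le> card C" by simp
  moreover have "card C \<le> card ?E" using C(1) finite_all_exponents by (intro card_mono) auto
  moreover have "card ?E \<le> card all_exponents" by (rule card_image_le[OF finite_all_exponents])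
  ultimately have cards: "card ?E = card all_exponents" "card C = card ?E" by linarith+
  then have CE: "C = ?E" using C(1) finite_all_exponents by (metis card_subset_eq finite_imageI)
  have inj: "inj_on infinity_value all_exponents" using cards(1) finite_all_exponents by (simp add: eq_card_imp_inj_on)
  have "(\<Sum>v\<in>?E. (\<lambda>k. c (the_inv_into all_exponents infinity_value v) * v k)) = 0"
  proof
    fix k
    have "(\<Sum>v\<in>?E. (\<lambda>k. c (the_inv_into all_exponents infinity_value v) * v k)) k = (\<Sum>a\<in>all_exponents. c a * infinity_value a k)"
      unfolding sum_fun_apply by (subst sum.reindex[OF inj]) (auto simp: the_inv_into_f_f[OF inj] intro!: sum.cong)
    also have "\<dots> = 0" using 0[of k] by (cases "k \<in> level l N") (auto simp: infinity_value_def)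
    finally show "(\<Sum>v\<in>?E. (\<lambda>k. c (the_inv_into all_exponents infinity_value v) * v k)) k = 0 k" by simp
  qed
  then have "c (the_inv_into all_exponents infinity_value (infinity_value a)) = 0"
    using C(2) a finite_all_exponents unfolding CE
    by (auto simp: fun_vs.dependent_finite)
  then show ?thesis by (simp add: the_inv_into_f_f[OF inj a])
qed

end

text \<open>The point at infinity \<open>k\<close> is the limit, for \<open>\<kappa> \<rightarrow> \<infinity>\<close>, of the formal curve \<open>B = \<kappa>\<^sup>2\<close>,
  \<open>A\<^sub>i = \<kappa> \<alpha>\<^sub>i(1/\<kappa>)\<close>; here \<open>1/\<kappa>\<close> is the formal variable.\<close>

definition branch :: "('i \<Rightarrow> complex fps) \<Rightarrow> 'i aff_var \<Rightarrow> complex fls" where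
  "branch \<alpha> v = (case v of VarA i \<Rightarrow> fls_X_inv * fps_to_fls (\<alpha> i) | VarB \<Rightarrow> fls_X_inv ^ 2)"

lemma fps_to_fls_prod: "fps_to_fls (\<Prod>i\<in>A. f i) = (\<Prod>i\<in>A. fps_to_fls (f i :: complex fps))"
  by (induction A rule: infinite_finite_induct) (simp_all add: fls_times_fps_to_fls)

lemma fps_nth_0_prod: "(\<Prod>i\<in>A. f i) $ 0 = (\<Prod>i\<in>A. (f i :: complex fps) $ 0)"
  by (induction A rule: infinite_finite_induct) simp_all

lemma fls_X_inv_power_times: "(fls_X_inv ^ n * f) $$ s = f $$ (s + int n)" for f :: "complex fls"
proof (induction n arbitrary: s)
  case (Suc n)
  have "(fls_X_inv ^ Suc n * f) $$ s = (fls_X_inv * (fls_X_inv ^ n * f)) $$ s" by (simp add: mult.assoc)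
  also have "\<dots> = (fls_X_inv ^ n * f) $$ (s + 1)" by (simp only: fls_X_inv_times_conv_shift fls_shift_nth)
  also have "\<dots> = f $$ (s + int (Suc n))" unfolding Suc.IH by (simp add: algebra_simps)
  finally show ?case .
qed simp

lemma mono_eval_branch:
  "mono_eval (branch \<alpha>) (expo a b) = fls_X_inv ^ (sum a UNIV + 2 * b) * fps_to_fls (\<Prod>i\<in>UNIV. \<alpha> i ^ a i)"
proof -
  have "mono_eval (branch \<alpha>) (expo a b) = (\<Prod>v\<in>UNIV. branch \<alpha> v ^ Poly_Mapping.lookup (expo a b) v)"
    by (rule mono_eval_superset) (auto simp: finite_UNIV_aff_var)
  also have "\<dots> = (\<Prod>i\<in>UNIV. fls_X_inv ^ a i * fps_to_fls (\<alpha> i) ^ a i) * fls_X_inv ^ (2 * b)"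
    by (simp add: prod_UNIV_aff_var branch_def power_mult_distrib power_mult)
  also have "\<dots> = fls_X_inv ^ (sum a UNIV + 2 * b) * fps_to_fls (\<Prod>i\<in>UNIV. \<alpha> i ^ a i)"
    by (simp add: prod.distrib power_add power_sum fps_to_fls_prod fps_to_fls_power mult_ac)
  finally show ?thesis .
qed

text \<open>Along a branch \<open>A_i\<close> has order at most 1 and \<open>B\<close> order 2 in
  \<open>\<kappa>\<close>, matching the weights. So only monomials of weight \<open>m\<close> reach
  \<open>\<kappa>^m\<close>, and \<open>B\<close> contributes the factor 1.\<close>

lemma branch_leading_coeff:
  assumes "f \<in> fil m"
  shows "fls_eval.poly_eval (branch \<alpha>) f $$ (- int m) =
    (\<Sum>t | t \<in> Poly_Mapping.keys f \<and> aff_deg t = m. Poly_Mapping.lookup f t * (\<Prod>i\<in>UNIV. (\<alpha> i $ 0) ^ Poly_Mapping.lookup t (VarA i)))"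
proof -
  have "(fls_const (Poly_Mapping.lookup f t) * mono_eval (branch \<alpha>) t) $$ (- int m) =
    (if aff_deg t = m then Poly_Mapping.lookup f t * (\<Prod>i\<in>UNIV. (\<alpha> i $ 0) ^ Poly_Mapping.lookup t (VarA i)) else 0)"
    if t: "t \<in> Poly_Mapping.keys f" for t
  proof -
    define a where "a = (\<lambda>i. Poly_Mapping.lookup t (VarA i))"
    define b where "b = Poly_Mapping.lookup t VarB"
    have tab: "t = expo a b" unfolding a_def b_def by (rule expo_eqI)
    have "aff_deg t \<le> m" using t assms by (auto simp: fil_def supported_def)
    then have le: "sum a UNIV + 2 * b \<le> m" by (simp add: tab)
    have "(fls_const (Poly_Mapping.lookup f t) * mono_eval (branch \<alpha>) t) $$ (- int m) =
      Poly_Mapping.lookup f t * fps_to_fls (\<Prod>i\<in>UNIV. \<alpha> i ^ a i) $$ (- int m + int (sum a UNIV + 2 * b))"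
      unfolding tab mono_eval_branch by (simp only: fls_mult_const_nth fls_X_inv_power_times)
    moreover have "- int m + int (sum a UNIV + 2 * b) < 0" if "sum a UNIV + 2 * b \<noteq> m" using le that by linarith
    ultimately show ?thesis
      by (cases "sum a UNIV + 2 * b = m") (simp_all add: tab fps_nth_0_prod fps_power_zeroth)
  qed
  then show ?thesis
    unfolding fls_eval.poly_eval_def fls_nth_sum
    by (simp add: sum.inter_filter)
qed

context lefschetz
begin

theorem basis_independent:
  assumes branches: "\<And>k. k \<in> level l N \<Longrightarrow> \<exists>\<alpha>. (\<forall>i. \<alpha> i $ 0 = of_nat (l i) - 2 * of_nat (k i)) \<and> fls_eval.poly_eval (branch \<alpha>) f = 0"
    and f: "f \<in> supported (basis_monomials m)"
  shows "f = 0"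
proof (rule ccontr)
  assume "f \<noteq> 0"
  define M where "M = Max (aff_deg ` Poly_Mapping.keys f)"
  have ne: "Poly_Mapping.keys f \<noteq> {}" using \<open>f \<noteq> 0\<close> by simp
  have fM: "f \<in> fil M" by (auto simp: fil_def supported_def M_def)
  obtain t0 where t0: "t0 \<in> Poly_Mapping.keys f" "aff_deg t0 = M"
  proof -
    have "M \<in> aff_deg ` Poly_Mapping.keys f" unfolding M_def using ne by (intro Max_in) auto
    then show ?thesis using that by auto
  qed
  define K where "K = {t \<in> Poly_Mapping.keys f. aff_deg t = M}"
  define A where "A t = (\<lambda>i. Poly_Mapping.lookup t (VarA i))" for t :: "'i aff_var \<Rightarrow>\<^sub>0 nat"
  \<comment> \<open>At a fixed weight \<open>M\<close> the exponent of \<open>B\<close> is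
    determined by those of the \<open>A_i\<close>, so distinct top monomials have distinct basis
    exponents and no cancellation between powers of \<open>B\<close> can occur.\<close>
  have inj: "inj_on A K"
  proof (rule inj_onI)
    fix s t assume st: "s \<in> K" "t \<in> K" "A s = A t"
    have "aff_deg s = sum (A s) UNIV + 2 * Poly_Mapping.lookup s VarB" "aff_deg t = sum (A t) UNIV + 2 * Poly_Mapping.lookup t VarB"
      by (simp_all add: A_def aff_deg_eq)
    then have "Poly_Mapping.lookup s VarB = Poly_Mapping.lookup t VarB" using st by (simp add: K_def)
    then show "s = t" using expo_eqI[of s] expo_eqI[of t] st(3) unfolding A_def by simp
  qed
  have AK: "A ` K \<subseteq> all_exponents"
  proof
    fix a assume "a \<in> A ` K"
    then obtain t where t: "t \<in> K" "a = A t" by auto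
    then have "t \<in> basis_monomials m" using f by (auto simp: K_def supported_def)
    then show "a \<in> all_exponents" using t(2) by (auto simp: basis_monomials_def all_exponents_eq A_def)
  qed
  have finK: "finite K" by (simp add: K_def)
  define c where "c a = (if a \<in> A ` K then Poly_Mapping.lookup f (the_inv_into K A a) else 0)" for a
  have c: "c (A t) = Poly_Mapping.lookup f t" if "t \<in> K" for t
    using that by (simp add: c_def the_inv_into_f_f[OF inj])
  have "c (A t0) = 0"
  proof (rule infinity_values_independent)
    show "A t0 \<in> all_exponents" using AK t0 by (auto simp: K_def)
    fix k assume k: "k \<in> level l N"
    obtain \<alpha> where \<alpha>: "\<And>i. \<alpha> i $ 0 = of_nat (l i) - 2 * of_nat (k i)" "fls_eval.poly_eval (branch \<alpha>) f = 0"
      using branches[OF k] by blast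
    have "(\<Sum>a\<in>all_exponents. c a * infinity_value a k) = (\<Sum>a\<in>A ` K. c a * infinity_value a k)"
      using finite_all_exponents AK by (intro sum.mono_neutral_right) (auto simp: c_def)
    also have "\<dots> = (\<Sum>t\<in>K. Poly_Mapping.lookup f t * infinity_value (A t) k)"
      by (subst sum.reindex[OF inj]) (simp add: c)
    also have "\<dots> = (\<Sum>t\<in>K. Poly_Mapping.lookup f t * (\<Prod>i\<in>UNIV. (\<alpha> i $ 0) ^ Poly_Mapping.lookup t (VarA i)))"
      by (intro sum.cong refl) (simp add: infinity_value_def k \<alpha> A_def)
    also have "\<dots> = 0" using branch_leading_coeff[OF fM, of \<alpha>] by (simp add: \<alpha>(2) K_def)
    finally show "(\<Sum>a\<in>all_exponents. c a * infinity_value a k) = 0" .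
  qed
  moreover have "t0 \<in> K" using t0 by (simp add: K_def)
  ultimately show False using c[of t0] t0(1) by (simp add: in_keys_iff)
qed

end

text \<open>The recursion determines \<open>U k\<close> as the value of \<open>c_k\<close> times
  \<open>U 0\<close> for \<open>k \<le> l\<close>. At \<open>m = l + 1\<close> its left side is 0
  and its right side is the value of the obstruction times \<open>U 0\<close>; Laurent series have
  no zero divisors.\<close>

theorem log_obstruction_vanishes:
  fixes q :: "int \<Rightarrow> 'v cpoly" and U :: "nat \<Rightarrow> complex fls"
  assumes U0: "U 0 \<noteq> 0"
    and U: "\<And>m. of_nat m * (of_nat m - 1 - of_nat l) * U m = (\<Sum>i<m. fls_eval.poly_eval \<theta> (q (int i - 1)) * U (m - 1 - i))"
  shows "fls_eval.poly_eval \<theta> (log_obstruction q l) = 0"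
proof -
  let ?\<phi> = "fls_eval.poly_eval \<theta>"
  have sum_eq: "?\<phi> (\<Sum>s\<in>{-1..int m - 2}. q s * frobenius_coeff q l (nat (int m - 2 - s))) * U 0 =
      of_nat m * (of_nat m - 1 - of_nat l) * U m"
    if frob: "\<And>k. k < m \<Longrightarrow> ?\<phi> (frobenius_coeff q l k) * U 0 = U k" for m
  proof -
    have "?\<phi> (\<Sum>s\<in>{-1..int m - 2}. q s * frobenius_coeff q l (nat (int m - 2 - s))) * U 0 =
      (\<Sum>s\<in>{-1..int m - 2}. ?\<phi> (q s) * (?\<phi> (frobenius_coeff q l (nat (int m - 2 - s))) * U 0))"
      by (simp add: fls_eval.poly_eval_sum fls_eval.poly_eval_mult sum_distrib_right mult.assoc)
    also have "\<dots> = (\<Sum>i<m. ?\<phi> (q (int i - 1)) * U (m - 1 - i))"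
    proof (rule sum.reindex_bij_witness[of _ "\<lambda>i. int i - 1" "\<lambda>s. nat (s + 1)"])
      fix s assume s: "s \<in> {-1..int m - 2}"
      then have "nat (int m - 2 - s) = m - 1 - nat (s + 1)" "int (nat (s + 1)) - 1 = s" by auto
      moreover have "m - 1 - nat (s + 1) < m" using s by auto
      ultimately show "?\<phi> (q (int (nat (s + 1)) - 1)) * U (m - 1 - nat (s + 1)) =
        ?\<phi> (q s) * (?\<phi> (frobenius_coeff q l (nat (int m - 2 - s))) * U 0)"
        using frob by simp
    qed auto
    finally show ?thesis using U[of m] by simp
  qed
  have frob: "k \<le> l \<Longrightarrow> ?\<phi> (frobenius_coeff q l k) * U 0 = U k" for k
  proof (induction k rule: less_induct)
    case (less k)
    show ?case
    proof (cases "k = 0")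
      case True
      then show ?thesis by (simp add: frobenius_coeff.simps[of q l 0])
    next
      case False
      define d where "d = (of_nat k * (of_nat k - 1 - of_nat l) :: complex)"
      have "of_nat k \<noteq> (of_nat (Suc l) :: complex)" using less.prems by (simp only: of_nat_eq_iff)
      then have "of_nat k - 1 - of_nat l \<noteq> (0 :: complex)" by (simp add: algebra_simps)
      then have d: "d \<noteq> 0" using False by (simp add: d_def)
      have dc: "of_nat k * (of_nat k - 1 - of_nat l) = fls_const d"
        by (rule fls_eqI) (auto simp: d_def fls_of_nat simp flip: fls_const_1)
      have "?\<phi> (frobenius_coeff q l k) * U 0 = fls_const (1 / d) *
          (?\<phi> (\<Sum>s\<in>{-1..int k - 2}. q s * frobenius_coeff q l (nat (int k - 2 - s))) * U 0)"
        using False by (subst frobenius_coeff.simps) (simp add: fls_eval.poly_eval_mult d_def mult.assoc)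
      also have "\<dots> = fls_const (1 / d) * (fls_const d * U k)"
      proof -
        have "?\<phi> (\<Sum>s\<in>{-1..int k - 2}. q s * frobenius_coeff q l (nat (int k - 2 - s))) * U 0 = fls_const d * U k"
          unfolding dc[symmetric] by (rule sum_eq, rule less.IH) (use less.prems in auto)
        then show ?thesis by (simp only:)
      qed
      also have "\<dots> = fls_const (1 / d * d) * U k"
        by (simp only: fls_const_mult_const mult.assoc[symmetric])
      finally show ?thesis using d by simp
    qed
  qed
  have "?\<phi> (log_obstruction q l) * U 0 = of_nat (Suc l) * (of_nat (Suc l) - 1 - of_nat l) * U (Suc l)"
    using sum_eq[of "Suc l"] frob by (simp add: log_obstruction_def)
  then show ?thesis using U0 by simp
qed

text \<open>The condition \<open>sum l UNIV = 2 * sum k UNIV\<close> says that the prescribed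
  residues \<open>\<nu> i = n_i - k_i\<close> add up to 0, as they must for \<open>v_0\<close> to be
  elliptic.\<close>

theorem exists_branch:
  fixes \<tau> :: complex and n :: "'i::finite \<Rightarrow> real" and p :: "'i \<Rightarrow> complex" and l k :: "'i \<Rightarrow> nat"
  assumes \<tau>: "Im \<tau> > 0" and p: "\<And>i j. i \<noteq> j \<Longrightarrow> p i - p j \<notin> lattice \<tau>"
    and n: "\<And>i. 2 * n i = real (l i)" and k: "\<And>i. k i \<le> l i" "sum l UNIV = 2 * sum k UNIV"
  obtains \<alpha> where "\<And>i. \<alpha> i $ 0 = of_nat (l i) - 2 * of_nat (k i)"
    "fls_eval.poly_eval (branch \<alpha>) (\<Sum>i\<in>UNIV. Var (VarA i)) = 0"
    "\<And>i. fls_eval.poly_eval (branch \<alpha>) (log_obstruction (potential_coeff \<tau> n p i) (l i)) = 0"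
proof -
  interpret elliptic_poles \<tau> p by unfold_locales (use \<tau> p in auto)
  define \<nu> where "\<nu> i = (of_nat (l i) / 2 - of_nat (k i) :: complex)" for i
  define c where "c i = (of_real (n i * (n i + 1)) :: complex)" for i
  define W where "W i j = laurent_expansion (\<lambda>z. wp \<tau> (z - p j)) (p i)" for i j
  define Z where "Z i j = laurent_expansion (\<lambda>z. wzeta \<tau> (z - p j)) (p i)" for i j
  note WZ = laurent_expansion_wp_wzeta[where p = p and \<tau> = \<tau>, OF \<tau> p, folded W_def Z_def]
  have "(\<Sum>i\<in>UNIV. \<nu> i) = of_nat (sum l UNIV) / 2 - of_nat (sum k UNIV)"
    by (simp add: \<nu>_def sum_subtractf sum_divide_distrib)
  then have \<nu>0: "(\<Sum>i\<in>UNIV. \<nu> i) = 0" using k(2) by simp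
  obtain a L where aL: "\<And>i. a i 0 = 2 * \<nu> i" "\<And>j. (\<Sum>i\<in>UNIV. a i j) = 0"
    "\<And>i j. fls_residue (L i j) = (if j = 0 then \<nu> i else 0)"
    "\<And>i. 2 * L i 0 = (\<Sum>l\<in>UNIV. fls_const (a l 0) * Z i l)"
    "\<And>i j. 2 * L i (Suc j) = (\<Sum>l\<in>UNIV. fls_const (a l (Suc j)) * Z i l) +
        (\<Sum>l\<in>UNIV. fls_const (if j = 0 then c l else 0) * W i l) -
        fls_deriv (L i j) - (\<Sum>b\<le>j. L i b * L i (j - b))"
    by (rule wkb_expansion[OF \<nu>0, of c, folded W_def Z_def], rule that) assumption+
  define \<alpha> where "\<alpha> i = Abs_fps (a i)" for i
  let ?\<phi> = "fls_eval.poly_eval (branch \<alpha>)"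
  have "?\<phi> (log_obstruction (potential_coeff \<tau> n p i) (l i)) = 0" for i
  proof -
    define Q where "Q j = (\<Sum>l\<in>UNIV. fls_const (a l j) * Z i l) + (\<Sum>l\<in>UNIV. fls_const (if j = 1 then c l else 0) * W i l)" for j
    define R where "R j = Q j - fls_const (if j = 0 then 2 * \<nu> i else 0) * fls_X_inv - fls_const (if j = 1 then c i else 0) * fls_X_inv ^ 2" for j
    have R_nth: "R j $$ s = (\<Sum>l\<in>UNIV. a l j * Z i l $$ s) + (if j = 1 then \<Sum>l\<in>UNIV. c l * W i l $$ s else 0)
        - (if j = 0 \<and> s = -1 then 2 * \<nu> i else 0) - (if j = 1 \<and> s = -2 then c i else 0)" for j s
      by (simp add: R_def Q_def fls_nth_sum fls_X_inv_power_nth)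
    interpret local_wkb "l i" "k i" "\<nu> i" "c i" Q "L i" R
    proof
      show "k i \<le> l i" by (rule k)
      show "2 * \<nu> i = of_nat (l i) - 2 * of_nat (k i)" by (simp add: \<nu>_def algebra_simps)
      have "4 * (n i * (n i + 1)) = real (l i) * (real (l i) + 2)"
        by (simp flip: n)
      then have "complex_of_real (4 * (n i * (n i + 1))) = complex_of_real (real (l i) * (real (l i) + 2))" by simp
      then show "4 * c i = of_nat (l i) * (of_nat (l i) + 2)" by (simp add: c_def)
      show "fls_residue (L i j) = (if j = 0 then \<nu> i else 0)" for j by (rule aL)
      show "2 * L i 0 = Q 0" by (simp add: aL(4) Q_def)
      show "2 * L i (Suc j) = Q (Suc j) - fls_deriv (L i j) - (\<Sum>b\<le>j. L i b * L i (j - b))" for j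
        by (simp add: aL(5) Q_def)
      show "Q j = R j + fls_const (if j = 0 then 2 * \<nu> i else 0) * fls_X_inv
        + fls_const (if j = 1 then c i else 0) * fls_X_inv ^ 2" for j by (simp add: R_def)
      show "R j $$ s = 0" if s: "s < -1" for j s
      proof -
        have z: "(\<Sum>l\<in>UNIV. a l j * Z i l $$ s) = 0" using s WZ(2)[of s i] by (intro sum.neutral) auto
        have w: "(\<Sum>l\<in>UNIV. c l * W i l $$ s) = (if s = -2 then c i else 0)"
        proof -
          have "(\<Sum>l\<in>UNIV. c l * W i l $$ s) = (\<Sum>l\<in>UNIV. if i = l then (if s = -2 then c i else 0) else 0)"
          proof (rule sum.cong[OF refl])
            fix l
            show "c l * W i l $$ s = (if i = l then (if s = -2 then c i else 0) else 0)"
              using s WZ(1)[of s i l] by auto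
          qed
          then show ?thesis by simp
        qed
        show ?thesis unfolding R_nth z w using s by simp
      qed
      have "(\<Sum>l\<in>UNIV. a l 0 * Z i l $$ (-1)) = (\<Sum>l\<in>UNIV. if i = l then a i 0 else 0)"
      proof (rule sum.cong[OF refl])
        fix l show "a l 0 * Z i l $$ (-1) = (if i = l then a i 0 else 0)"
          using WZ(2)[of "-1" i l] by auto
      qed
      then have z: "(\<Sum>l\<in>UNIV. a l 0 * Z i l $$ (-1)) = 2 * \<nu> i" by (simp add: aL(1))
      show "R 0 $$ (- 1) = 0" unfolding R_nth z by simp
    qed
    \<comment> \<open>The factor \<open>fls_X_inv\<close> is the \<open>\<kappa>\<close> in
      \<open>A_i = \<kappa> \<alpha>_i\<close>; the second summand restores the leading residue
      taken out of \<open>R\<close>, and \<open>m = 1\<close>, that is \<open>z^0\<close>, receives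
      \<open>B = \<kappa>^2\<close>. The double pole does not appear: it is absorbed in the factor
      \<open>m (m - 1 - l)\<close> of the Frobenius recursion.\<close>
    have q: "?\<phi> (potential_coeff \<tau> n p i (int m - 1)) = fls_X_inv * fps_to_fls (Abs_fps (\<lambda>j. R j $$ (int m - 1)))
      + (if m = 0 then fls_X_inv * fls_const (2 * \<nu> i) else 0) + (if m = 1 then fls_X_inv ^ 2 else 0)" for m
    proof -
      define s where "s = int m - 1"
      define w where "w = (\<Sum>l\<in>UNIV. c l * W i l $$ s)"
      have "Abs_fps (\<lambda>j. R j $$ s) = (\<Sum>l\<in>UNIV. fps_const (Z i l $$ s) * \<alpha> l) + fps_const w * fps_X
          - fps_const (if m = 0 then 2 * \<nu> i else 0)"
        by (rule fps_ext) (auto simp: R_nth s_def w_def \<alpha>_def fps_sum_nth mult.commute)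
      then have "fls_X_inv * fps_to_fls (Abs_fps (\<lambda>j. R j $$ s)) =
          (\<Sum>l\<in>UNIV. fls_const (Z i l $$ s) * (fls_X_inv * fps_to_fls (\<alpha> l))) + fls_const w * (fls_X_inv * fls_X)
          - fls_X_inv * fls_const (if m = 0 then 2 * \<nu> i else 0)"
        by (simp only: fps_to_fls_plus fps_to_fls_minus fps_to_fls_sum fls_times_fps_to_fls fps_const_to_fls fps_X_to_fls
              right_diff_distrib distrib_left sum_distrib_left mult.left_commute)
      also have "fls_X_inv * fls_X = (1 :: complex fls)"
        by (rule fls_eqI) (simp add: fls_X_inv_times_conv_shift)
      finally have *: "fls_X_inv * fps_to_fls (Abs_fps (\<lambda>j. R j $$ s)) =
          (\<Sum>l\<in>UNIV. fls_const (Z i l $$ s) * (fls_X_inv * fps_to_fls (\<alpha> l))) + fls_const w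
          - fls_X_inv * fls_const (if m = 0 then 2 * \<nu> i else 0)" by simp
      have "fls_const w = (\<Sum>l\<in>UNIV. fls_const (c l * W i l $$ s))"
        by (rule fls_eqI) (simp add: w_def fls_nth_sum)
      then have "?\<phi> (potential_coeff \<tau> n p i s) = fls_const w + (\<Sum>l\<in>UNIV. fls_const (Z i l $$ s) * (fls_X_inv * fps_to_fls (\<alpha> l)))
          + (if s = 0 then fls_X_inv ^ 2 else 0)"
        unfolding potential_coeff_def
        by (simp add: fls_eval.poly_eval_add fls_eval.poly_eval_sum fls_eval.poly_eval_mult branch_def c_def W_def Z_def)
      then show ?thesis unfolding s_def[symmetric] * by (simp add: s_def)
    qed
    obtain U where "U 0 \<noteq> 0"
      "\<And>m. of_nat m * (of_nat m - 1 - of_nat (l i)) * U m = (\<Sum>j<m. ?\<phi> (potential_coeff \<tau> n p i (int j - 1)) * U (m - 1 - j))"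
      by (rule log_free_series[OF q], rule that) assumption+
    then show ?thesis by (rule log_obstruction_vanishes)
  qed
  moreover have "\<alpha> i $ 0 = of_nat (l i) - 2 * of_nat (k i)" for i
    by (simp add: \<alpha>_def aL(1) \<nu>_def algebra_simps)
  moreover have "?\<phi> (\<Sum>i\<in>UNIV. Var (VarA i)) = 0"
  proof -
    have "?\<phi> (\<Sum>i\<in>UNIV. Var (VarA i)) = fls_X_inv * fps_to_fls (\<Sum>i\<in>UNIV. \<alpha> i)"
      by (simp add: fls_eval.poly_eval_sum branch_def sum_distrib_left fps_to_fls_sum)
    also have "(\<Sum>i\<in>UNIV. \<alpha> i) = 0" by (rule fps_ext) (simp add: \<alpha>_def fps_sum_nth aL(2))
    finally show ?thesis by simp
  qed
  ultimately show ?thesis using that by blast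
qed

section \<open>The closure and its Hilbert function\<close>

lemma UNIV_proj_var: "(UNIV :: 'i proj_var set) = insert VarA0 (range Aff)"
  by (auto intro: proj_var.exhaust)

lemma finite_UNIV_proj_var: "finite (UNIV :: 'i::finite proj_var set)"
  by (simp add: UNIV_proj_var finite_UNIV_aff_var)

lemma lookup_lift_mon [simp]:
  "Poly_Mapping.lookup (lift_mon t) (Aff v) = Poly_Mapping.lookup t v" "Poly_Mapping.lookup (lift_mon t) VarA0 = 0"
proof -
  have "Poly_Mapping.lookup (lift_mon t) (Aff v) = (\<Sum>w\<in>Poly_Mapping.keys t. if w = v then Poly_Mapping.lookup t v else 0)"
    unfolding lift_mon_def lookup_sum by (intro sum.cong) (auto simp: lookup_single when_def)
  then show "Poly_Mapping.lookup (lift_mon t) (Aff v) = Poly_Mapping.lookup t v" by (simp add: in_keys_iff)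
  show "Poly_Mapping.lookup (lift_mon t) VarA0 = 0"
    unfolding lift_mon_def lookup_sum by (intro sum.neutral) (auto simp: lookup_single when_def)
qed

lemma proj_mono_cases:
  fixes t :: "'i::finite proj_var \<Rightarrow>\<^sub>0 nat"
  obtains t' e where "t = lift_mon t' + Poly_Mapping.single VarA0 e"
proof -
  define t' where "t' = (\<Sum>v\<in>UNIV. Poly_Mapping.single v (Poly_Mapping.lookup t (Aff v)))"
  have t': "Poly_Mapping.lookup t' v = Poly_Mapping.lookup t (Aff v)" for v
  proof -
    have "Poly_Mapping.lookup t' v = (\<Sum>w\<in>UNIV. if w = v then Poly_Mapping.lookup t (Aff v) else 0)"
      unfolding t'_def lookup_sum by (intro sum.cong) (auto simp: lookup_single when_def)
    then show ?thesis by (simp add: finite_UNIV_aff_var)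
  qed
  have "t = lift_mon t' + Poly_Mapping.single VarA0 (Poly_Mapping.lookup t VarA0)"
  proof (rule poly_mapping_eqI)
    fix v show "Poly_Mapping.lookup t v = Poly_Mapping.lookup (lift_mon t' + Poly_Mapping.single VarA0 (Poly_Mapping.lookup t VarA0)) v"
      by (cases v) (simp_all add: lookup_add t' lookup_single when_def)
  qed
  then show ?thesis by (rule that)
qed

lemma wdeg_proj: "wdeg_mon proj_weight (lift_mon t + Poly_Mapping.single VarA0 e) = aff_deg t + e"
  for t :: "'i::finite aff_var \<Rightarrow>\<^sub>0 nat"
proof -
  let ?t = "lift_mon t + Poly_Mapping.single VarA0 e"
  have "wdeg_mon proj_weight ?t = (\<Sum>v\<in>UNIV. proj_weight v * Poly_Mapping.lookup ?t v)"
    unfolding wdeg_mon_def by (rule sum.mono_neutral_left) (auto simp: in_keys_iff finite_UNIV_proj_var)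
  also have "\<dots> = e + (\<Sum>v\<in>UNIV. aff_weight v * Poly_Mapping.lookup t v)"
    unfolding UNIV_proj_var by (subst sum.insert) (auto simp: sum.reindex inj_on_def lookup_add lookup_single when_def finite_UNIV_aff_var)
  also have "(\<Sum>v\<in>UNIV. aff_weight v * Poly_Mapping.lookup t v) = aff_deg t"
    unfolding wdeg_mon_def by (rule sum.mono_neutral_right) (auto simp: in_keys_iff finite_UNIV_aff_var)
  finally show ?thesis by simp
qed

definition homog_mono :: "nat \<Rightarrow> ('i::finite aff_var \<Rightarrow>\<^sub>0 nat) \<Rightarrow> 'i proj_var \<Rightarrow>\<^sub>0 nat" where
  "homog_mono m t = lift_mon t + Poly_Mapping.single VarA0 (m - aff_deg t)"

text \<open>Unlike in \<open>homogenize\<close>, the target degree is prescribed, which makes the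
  map linear; on \<open>fil m\<close> the two differ by a power of \<open>A_0\<close>.\<close>

definition homog :: "nat \<Rightarrow> 'i::finite aff_var cpoly \<Rightarrow> 'i proj_var cpoly" where
  "homog m f = (\<Sum>t\<in>Poly_Mapping.keys f. Poly_Mapping.single (homog_mono m t) (Poly_Mapping.lookup f t))"

lemma homog_superset:
  assumes "finite S" "Poly_Mapping.keys f \<subseteq> S"
  shows "homog m f = (\<Sum>t\<in>S. Poly_Mapping.single (homog_mono m t) (Poly_Mapping.lookup f t))"
  unfolding homog_def using assms by (intro sum.mono_neutral_left) (auto simp: in_keys_iff)

lemma homog_add: "homog m (f + g) = homog m f + homog m g"
proof -
  let ?S = "Poly_Mapping.keys f \<union> Poly_Mapping.keys g"
  have "Poly_Mapping.keys (f + g) \<subseteq> ?S" by (rule Poly_Mapping.keys_add)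
  then show ?thesis
    by (simp add: homog_superset[of ?S] lookup_add single_add sum.distrib)
qed

lemma homog_0 [simp]: "homog m 0 = 0"
  by (simp add: homog_def)

lemma homog_diff: "homog m (f - g) = homog m f - homog m g"
  using homog_add[of m "f - g" g] by simp

lemma homog_sum: "homog m (\<Sum>i\<in>I. f i) = (\<Sum>i\<in>I. homog m (f i))"
  by (induction I rule: infinite_finite_induct) (auto simp: homog_add)

lemma homog_single: "homog m (Poly_Mapping.single t x) = Poly_Mapping.single (homog_mono m t) x"
  by (simp add: homog_superset[of "{t}"])

lemma homog_Const: "homog m (Const x * f) = Const x * homog m f"
proof -
  have "homog m (Const x * (\<Sum>t\<in>Poly_Mapping.keys f. Poly_Mapping.single t (Poly_Mapping.lookup f t))) =
      Const x * homog m (\<Sum>t\<in>Poly_Mapping.keys f. Poly_Mapping.single t (Poly_Mapping.lookup f t))"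
    unfolding sum_distrib_left homog_sum Const_single homog_single ..
  then show ?thesis by (simp only: poly_mapping_sum_singles[symmetric])
qed

definition dehom_value :: "'i proj_var \<Rightarrow> 'i aff_var cpoly" where
  "dehom_value v = (case v of VarA0 \<Rightarrow> 1 | Aff w \<Rightarrow> Var w)"

abbreviation dehomogenize :: "'i proj_var cpoly \<Rightarrow> 'i aff_var cpoly" where
  "dehomogenize \<equiv> dehom.poly_eval dehom_value"

lemma mono_eval_sum: "mono_eval \<theta> (\<Sum>i\<in>I. f i) = (\<Prod>i\<in>I. mono_eval \<theta> (f i))"
  by (induction I rule: infinite_finite_induct) (auto simp: mono_eval_add)

lemma Var_power: "Var v ^ k = Poly_Mapping.single (Poly_Mapping.single v k) 1"
  by (induction k) (simp_all add: Var_def mult_single flip: single_add)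

lemma prod_single: "(\<Prod>i\<in>I. Poly_Mapping.single (f i) (1 :: complex)) = Poly_Mapping.single (\<Sum>i\<in>I. f i) 1"
  by (induction I rule: infinite_finite_induct) (simp_all add: mult_single)

lemma dehomogenize_single:
  "dehomogenize (Poly_Mapping.single (lift_mon t + Poly_Mapping.single VarA0 e) x) = Poly_Mapping.single t x"
proof -
  have "mono_eval dehom_value (lift_mon t) = (\<Prod>v\<in>Poly_Mapping.keys t. Var v ^ Poly_Mapping.lookup t v)"
    by (simp add: lift_mon_def mono_eval_sum dehom_value_def)
  also have "\<dots> = Poly_Mapping.single t 1"
    unfolding Var_power prod_single poly_mapping_sum_singles[symmetric] ..
  finally have "mono_eval dehom_value (lift_mon t + Poly_Mapping.single VarA0 e) = Poly_Mapping.single t 1"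
    by (simp add: mono_eval_add dehom_value_def)
  then show ?thesis by (simp add: dehom.poly_eval_single Const_single)
qed

lemma dehomogenize_homog: "dehomogenize (homog m f) = f"
  unfolding homog_def homog_mono_def dehom.poly_eval_sum dehomogenize_single poly_mapping_sum_singles[symmetric] ..

lemma homogenize_eq_homog: "homogenize f = homog (wdeg aff_weight f) f"
  by (simp add: homogenize_def homog_def homog_mono_def)

lemma aff_deg_le_wdeg: "t \<in> Poly_Mapping.keys f \<Longrightarrow> aff_deg t \<le> wdeg aff_weight f"
  by (auto simp: wdeg_def)

lemma
  fixes f :: "'i::finite proj_var cpoly"
  assumes f: "f \<in> homogeneous_piece proj_weight m"
  shows homog_dehomogenize: "homog m (dehomogenize f) = f"
    and dehomogenize_fil: "dehomogenize f \<in> fil m"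
proof -
  have t: "homog m (dehomogenize (Poly_Mapping.single t x)) = Poly_Mapping.single t x"
    "dehomogenize (Poly_Mapping.single t x) \<in> fil m" if "t \<in> Poly_Mapping.keys f" for t x
  proof -
    obtain t' e where t: "t = lift_mon t' + Poly_Mapping.single VarA0 e" by (rule proj_mono_cases)
    have "wdeg_mon proj_weight t = m" using f that by (simp add: homogeneous_piece_def)
    then have "aff_deg t' + e = m" unfolding t wdeg_proj .
    then show "homog m (dehomogenize (Poly_Mapping.single t x)) = Poly_Mapping.single t x"
      "dehomogenize (Poly_Mapping.single t x) \<in> fil m"
      unfolding t dehomogenize_single homog_single homog_mono_def by (auto simp: fil_def supported_def)
  qed
  have fs: "dehomogenize f = (\<Sum>t\<in>Poly_Mapping.keys f. dehomogenize (Poly_Mapping.single t (Poly_Mapping.lookup f t)))"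
    unfolding dehom.poly_eval_sum[symmetric] poly_mapping_sum_singles[symmetric] ..
  have "homog m (dehomogenize f) = (\<Sum>t\<in>Poly_Mapping.keys f. Poly_Mapping.single t (Poly_Mapping.lookup f t))"
    unfolding fs homog_sum by (intro sum.cong refl t)
  then show "homog m (dehomogenize f) = f" by (simp only: poly_mapping_sum_singles[symmetric])
  show "dehomogenize f \<in> fil m"
    unfolding fs by (intro cpoly_vs.subspace_sum[OF subspace_fil] t)
qed

lemma homog_homogeneous: "f \<in> fil m \<Longrightarrow> homog m f \<in> homogeneous_piece proj_weight m"
proof -
  assume f: "f \<in> fil m"
  have "Poly_Mapping.keys (homog m f) \<subseteq> (\<Union>t\<in>Poly_Mapping.keys f. Poly_Mapping.keys (Poly_Mapping.single (homog_mono m t) (Poly_Mapping.lookup f t)))"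
    unfolding homog_def by (rule keys_sum)
  also have "\<dots> \<subseteq> homog_mono m ` Poly_Mapping.keys f" by auto
  finally have keys: "Poly_Mapping.keys (homog m f) \<subseteq> homog_mono m ` Poly_Mapping.keys f" .
  show ?thesis
    unfolding homogeneous_piece_def
  proof (intro CollectI ballI)
    fix t assume "t \<in> Poly_Mapping.keys (homog m f)"
    then obtain t' where t': "t' \<in> Poly_Mapping.keys f" "t = homog_mono m t'" using keys by blast
    then have "aff_deg t' \<le> m" using f by (auto simp: fil_def supported_def)
    then show "wdeg_mon proj_weight t = m" unfolding t'(2) homog_mono_def wdeg_proj by simp
  qed
qed

text \<open>Dehomogenization returns the generators of the closure ideal to \<open>I\<close>, hence
  the whole closure ideal. Conversely \<open>homog m f\<close> is a power of \<open>A_0\<close>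
  times \<open>homogenize f\<close>.\<close>

lemma homog_closure_ideal_iff:
  fixes I :: "'i::finite aff_var cpoly set"
  assumes I: "ideal I cpoly_ring" and f: "f \<in> fil m"
  shows "homog m f \<in> closure_ideal I \<longleftrightarrow> f \<in> I"
proof
  have "ideal {g. dehomogenize g \<in> I} cpoly_ring"
    by (rule ideal_cpolyI)
       (auto simp: dehom.poly_eval_add dehom.poly_eval_mult ideal_cpoly_0[OF I] ideal_cpoly_add[OF I] ideal_cpoly_mult[OF I])
  then have "closure_ideal I \<subseteq> {g. dehomogenize g \<in> I}"
    unfolding closure_ideal_def
    by (rule genideal_cpoly_subset) (auto simp: homogenize_eq_homog dehomogenize_homog)
  then show "f \<in> I" if "homog m f \<in> closure_ideal I"
    using that dehomogenize_homog[of m f] by auto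
  assume "f \<in> I"
  let ?w = "wdeg aff_weight f"
  have w: "?w \<le> m" using f by (auto simp: wdeg_def fil_def supported_def)
  have "homog m f = Poly_Mapping.single (Poly_Mapping.single VarA0 (m - ?w)) 1 * homogenize f"
    unfolding homogenize_eq_homog homog_def sum_distrib_left mult_single
  proof (rule sum.cong[OF refl])
    fix t assume "t \<in> Poly_Mapping.keys f"
    then have "aff_deg t \<le> ?w" by (rule aff_deg_le_wdeg)
    then have "m - aff_deg t = (m - ?w) + (?w - aff_deg t)" using w by simp
    then have "homog_mono m t = Poly_Mapping.single VarA0 (m - ?w) + homog_mono ?w t"
      by (simp only: homog_mono_def single_add add_ac)
    then show "Poly_Mapping.single (homog_mono m t) (Poly_Mapping.lookup f t) =
        Poly_Mapping.single (Poly_Mapping.single VarA0 (m - ?w) + homog_mono ?w t) (1 * Poly_Mapping.lookup f t)" by simp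
  qed
  moreover have "homogenize f \<in> closure_ideal I"
    unfolding closure_ideal_def using \<open>f \<in> I\<close> by (intro genideal_cpoly_self) auto
  ultimately show "homog m f \<in> closure_ideal I"
    using ideal_cpoly_mult[OF ideal_genideal_cpoly] by (simp add: closure_ideal_def)
qed

text \<open>Homogenization identifies \<open>fil m\<close> modulo \<open>I\<close> with the
  degree-\<open>m\<close> piece of the quotient. The predicate \<open>dimension\<close> is
  inductive, so the basis is adjoined one monomial at a time; independence shows that each new class
  lies outside the previous span.\<close>

theorem graded_piece_dim_closure:
  fixes I :: "'i::finite aff_var cpoly set"
  assumes I: "ideal I cpoly_ring" and B: "finite B" "\<And>t. t \<in> B \<Longrightarrow> aff_deg t \<le> m"
    and span: "\<And>f. f \<in> fil m \<Longrightarrow> \<exists>g\<in>supported B. f - g \<in> I"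
    and indep: "\<And>g. g \<in> supported B \<Longrightarrow> g \<in> I \<Longrightarrow> g = 0"
  shows "graded_piece_dim proj_weight (closure_ideal I) m (card B)"
proof -
  define K where "K = closure_ideal I"
  have K: "ideal K cpoly_ring" unfolding K_def closure_ideal_def by (rule ideal_genideal_cpoly)
  interpret K: ideal K cpoly_ring by (rule K)
  let ?Q = "cpoly_ring Quot K" and ?c = "\<lambda>f. K +>\<^bsub>cpoly_ring\<^esub> f"
  interpret Q: ring ?Q by (rule K.quotient_is_ring)
  have c_eq: "?c f = ?c g \<longleftrightarrow> f - g \<in> K" for f g
    using cpoly_ring.quotient_eq_iff_same_a_r_cos[OF K, of f g] by (simp add: a_minus_def cpoly_ring_uminus)
  have c_add: "?c f \<oplus>\<^bsub>?Q\<^esub> ?c g = ?c (f + g)" for f g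
    using K.a_rcos_sum[of f g] by (simp add: FactRing_def)
  have c_mult: "?c f \<otimes>\<^bsub>?Q\<^esub> ?c g = ?c (f * g)" for f g
    using K.rcoset_mult_add[of f g] by (simp add: FactRing_def)
  have c_zero: "\<zero>\<^bsub>?Q\<^esub> = ?c 0"
    using cpoly_ring.a_rcos_zero[OF K ideal_cpoly_0[OF K]] by (simp add: FactRing_def)
  have c_carrier: "?c f \<in> carrier ?Q" for f
    by (auto simp: FactRing_def A_RCOSETS_def')
  have fil_B: "supported S \<subseteq> fil m" if "S \<subseteq> B" for S
    unfolding fil_def using B(2) that by (intro supported_mono) auto
  have dim: "Q.dimension (card S) (range (\<lambda>x. ?c (Const x))) ((\<lambda>g. ?c (homog m g)) ` supported S)" if "S \<subseteq> B" for S
    using finite_subset[OF that B(1)] that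
  proof (induction S rule: finite_induct)
    case empty
    have "supported {} = {0 :: 'i aff_var cpoly}" by (auto simp: supported_def)
    then show ?case using Q.zero_dim by (simp add: c_zero)
  next
    case (insert t S)
    define v where "v = ?c (homog m (Poly_Mapping.single t 1))"
    let ?E = "(\<lambda>g. ?c (homog m g)) ` supported S"
    have "v \<notin> ?E"
    proof
      assume "v \<in> ?E"
      then obtain g where g: "g \<in> supported S" "?c (homog m (Poly_Mapping.single t 1)) = ?c (homog m g)" by (auto simp: v_def)
      have "Poly_Mapping.single t 1 - g \<in> supported B"
      proof (rule cpoly_vs.subspace_diff[OF supported_subspace])
        show "Poly_Mapping.single t 1 \<in> supported B" "g \<in> supported B"
          using g(1) insert.prems supported_mono[of S B] by (auto simp: supported_def)
      qed
      moreover have "homog m (Poly_Mapping.single t 1 - g) \<in> K" using g(2) by (simp add: c_eq homog_diff)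
      ultimately have "Poly_Mapping.single t 1 - g = 0"
        using homog_closure_ideal_iff[OF I] indep fil_B[OF order.refl] unfolding K_def by blast
      then have "g = Poly_Mapping.single t 1" by simp
      then have "t \<in> Poly_Mapping.keys g" by simp
      then show False using g(1) insert.hyps by (auto simp: supported_def)
    qed
    moreover have "v \<in> carrier ?Q" unfolding v_def by (rule c_carrier)
    moreover have "Q.dimension (card S) (range (\<lambda>x. ?c (Const x))) ?E" using insert by simp
    ultimately have "Q.dimension (Suc (card S)) (range (\<lambda>x. ?c (Const x))) (Q.line_extension (range (\<lambda>x. ?c (Const x))) v ?E)"
      by (intro Q.Suc_dim)
    moreover have "Q.line_extension (range (\<lambda>x. ?c (Const x))) v ?E = (\<lambda>g. ?c (homog m g)) ` supported (insert t S)"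
    proof (intro equalityI subsetI)
      fix u assume "u \<in> Q.line_extension (range (\<lambda>x. ?c (Const x))) v ?E"
      then obtain x g where xg: "g \<in> supported S" "u = ?c (Const x) \<otimes>\<^bsub>?Q\<^esub> v \<oplus>\<^bsub>?Q\<^esub> ?c (homog m g)"
        by (auto simp: Q.line_extension_mem_iff)
      have "u = ?c (homog m (Const x * Poly_Mapping.single t 1 + g))"
        by (simp only: xg(2) v_def c_mult c_add homog_add homog_Const)
      moreover have "Const x * Poly_Mapping.single t 1 + g \<in> supported (insert t S)"
      proof (intro cpoly_vs.subspace_add[OF supported_subspace] cpoly_vs.subspace_scale[OF supported_subspace])
        show "Poly_Mapping.single t 1 \<in> supported (insert t S)" by (simp add: supported_def)
        show "g \<in> supported (insert t S)" using xg(1) by (auto simp: supported_def)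
      qed
      ultimately show "u \<in> (\<lambda>g. ?c (homog m g)) ` supported (insert t S)" by blast
    next
      fix u assume "u \<in> (\<lambda>g. ?c (homog m g)) ` supported (insert t S)"
      then obtain g where g: "g \<in> supported (insert t S)" "u = ?c (homog m g)" by blast
      define x where "x = Poly_Mapping.lookup g t"
      define g' where "g' = g - Const x * Poly_Mapping.single t 1"
      have "Poly_Mapping.lookup g' t = 0" by (simp add: g'_def x_def lookup_minus Const_single)
      moreover have "g' \<in> supported (insert t S)"
        unfolding g'_def
      proof (intro cpoly_vs.subspace_diff[OF supported_subspace] cpoly_vs.subspace_scale[OF supported_subspace] g(1))
        show "Poly_Mapping.single t 1 \<in> supported (insert t S)" by (simp add: supported_def)
      qed
      ultimately have g': "g' \<in> supported S" by (auto simp: supported_def in_keys_iff)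
      have "u = ?c (homog m (Const x * Poly_Mapping.single t 1 + g'))" by (simp add: g(2) g'_def)
      also have "\<dots> = ?c (Const x) \<otimes>\<^bsub>?Q\<^esub> v \<oplus>\<^bsub>?Q\<^esub> ?c (homog m g')"
        by (simp only: v_def c_mult c_add homog_add homog_Const)
      finally show "u \<in> Q.line_extension (range (\<lambda>x. ?c (Const x))) v ?E"
        using g' by (auto simp: Q.line_extension_mem_iff)
    qed
    ultimately show ?case using insert by simp
  qed
  have "(\<lambda>g. ?c (homog m g)) ` supported B = ?c ` homogeneous_piece proj_weight m"
  proof (intro equalityI subsetI)
    fix u assume "u \<in> (\<lambda>g. ?c (homog m g)) ` supported B"
    then show "u \<in> ?c ` homogeneous_piece proj_weight m"
      using homog_homogeneous fil_B[OF order.refl] by blast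
  next
    fix u assume "u \<in> ?c ` homogeneous_piece proj_weight m"
    then obtain f where f: "f \<in> homogeneous_piece proj_weight m" "u = ?c f" by blast
    obtain g where g: "g \<in> supported B" "dehomogenize f - g \<in> I" using span[OF dehomogenize_fil[OF f(1)]] by blast
    have "dehomogenize f - g \<in> fil m"
      using dehomogenize_fil[OF f(1)] g(1) fil_B[OF order.refl] by (intro cpoly_vs.subspace_diff[OF subspace_fil]) auto
    then have "homog m (dehomogenize f - g) \<in> K" using homog_closure_ideal_iff[OF I] g(2) unfolding K_def by blast
    then have "u = ?c (homog m g)" by (simp add: f(2) c_eq homog_diff homog_dehomogenize[OF f(1)])
    then show "u \<in> (\<lambda>g. ?c (homog m g)) ` supported B" using g(1) by blast
  qed
  then show ?thesis using dim[OF order.refl] unfolding graded_piece_dim_def K_def by simp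
qed

section \<open>Counting the basis monomials\<close>

context lefschetz
begin

text \<open>A basis exponent of degree \<open>d\<close> may be combined with \<open>B^b\<close> for
  all \<open>b\<close> with \<open>2 b \<le> m - d\<close>. The bound \<open>m \<ge> N\<close> keeps
  the truncated subtraction exact, as \<open>d \<le> N\<close>.\<close>

lemma card_basis_monomials:
  assumes "m \<ge> N"
  shows "finite (basis_monomials m)"
    and "real (card (basis_monomials m)) = (\<Sum>d\<le>N. real (card (basis_exponents d)) * real ((m - d) div 2 + 1))"
proof -
  have le: "sum a UNIV \<le> N" if "a \<in> all_exponents" for a
    using that basis_exponents_subset by (auto simp: all_exponents_def level_def)
  have eq: "basis_monomials m = (\<lambda>(a, b). expo a b) ` (SIGMA a : all_exponents. {..(m - sum a UNIV) div 2})"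
  proof -
    have "sum a UNIV + 2 * b \<le> m \<longleftrightarrow> b \<le> (m - sum a UNIV) div 2" if "a \<in> all_exponents" for a b
      using le[OF that] assms by auto
    then show ?thesis unfolding basis_monomials_def all_exponents_eq[symmetric] by auto
  qed
  show "finite (basis_monomials m)" unfolding eq using finite_all_exponents by auto
  have "card (basis_monomials m) = card (SIGMA a : all_exponents. {..(m - sum a UNIV) div 2})"
    unfolding eq by (rule card_image) (auto simp: inj_on_def)
  also have "\<dots> = (\<Sum>a\<in>all_exponents. (m - sum a UNIV) div 2 + 1)"
    using finite_all_exponents by simp
  finally have "real (card (basis_monomials m)) = (\<Sum>a\<in>all_exponents. real ((m - sum a UNIV) div 2 + 1))"
    by simp
  then show "real (card (basis_monomials m)) = (\<Sum>d\<le>N. real (card (basis_exponents d)) * real ((m - d) div 2 + 1))"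
    using sum_all_exponents[of "\<lambda>d. real ((m - d) div 2 + 1)"] by simp
qed

lemma level_generating_function:
  "(\<Sum>d\<le>2 * N. real (card (level l d)) * x ^ d) = (\<Prod>i\<in>UNIV. \<Sum>j\<le>l i. x ^ j)"
proof -
  have "(\<Prod>i\<in>UNIV. \<Sum>j\<le>l i. x ^ j) = (\<Sum>a\<in>nbox l. x ^ sum a UNIV)"
  proof -
    have "nbox l = (\<Pi>\<^sub>E i\<in>UNIV. {..l i})" by (auto simp: nbox_def)
    then show ?thesis by (subst prod_sum_PiE) (auto simp: power_sum)
  qed
  also have "nbox l = (\<Union>d\<le>2 * N. level l d)"
  proof -
    have "sum a UNIV \<le> 2 * N" if "a \<in> nbox l" for a
      using that sum_mono[of UNIV a l] sum_l by (auto simp: nbox_def)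
    then show ?thesis by (auto simp: level_def)
  qed
  also have "(\<Sum>a\<in>\<dots>. x ^ sum a UNIV) = (\<Sum>d\<le>2 * N. \<Sum>a\<in>level l d. x ^ sum a UNIV)"
    by (rule sum.UNION_disjoint) (auto simp: finite_level, auto simp: level_def)
  also have "\<dots> = (\<Sum>d\<le>2 * N. real (card (level l d)) * x ^ d)"
  proof (rule sum.cong[OF refl])
    fix d
    have "(\<Sum>a\<in>level l d. x ^ sum a UNIV) = (\<Sum>a\<in>level l d. x ^ d)" by (intro sum.cong) (auto simp: level_def)
    then show "(\<Sum>a\<in>level l d. x ^ sum a UNIV) = real (card (level l d)) * x ^ d" by simp
  qed
  finally show ?thesis by simp
qed

text \<open>The symmetry of the levels under \<open>d \<mapsto> 2 * N - d\<close> folds the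
  generating function onto its lower half wherever \<open>x\<close> respects it; the cases of
  interest are \<open>x = 1\<close> and \<open>x = -1\<close>.\<close>

lemma level_half_sum:
  assumes "\<And>d. d \<le> 2 * N \<Longrightarrow> x ^ (2 * N - d) = (x ^ d :: real)"
  shows "(\<Prod>i\<in>UNIV. \<Sum>j\<le>l i. x ^ j) = 2 * (\<Sum>d<N. real (card (level l d)) * x ^ d) + real (card (level l N)) * x ^ N"
proof -
  let ?f = "\<lambda>d. real (card (level l d)) * x ^ d"
  have "{..2 * N} = {..<N} \<union> {N} \<union> {N<..2 * N}" by auto
  then have "sum ?f {..2 * N} = sum ?f ({..<N} \<union> {N} \<union> {N<..2 * N})" by simp
  also have "\<dots> = sum ?f {..<N} + ?f N + sum ?f {N<..2 * N}"
    by (subst sum.union_disjoint; (subst sum.union_disjoint)?) auto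
  also have "sum ?f {N<..2 * N} = sum ?f {..<N}"
    by (rule sum.reindex_bij_witness[of _ "\<lambda>d. 2 * N - d" "\<lambda>d. 2 * N - d"])
       (auto simp: level_symmetric[OF sum_l] assms)
  finally show ?thesis by (simp add: level_generating_function)
qed

text \<open>Summation by parts, since the numbers of basis exponents are the first differences of
  the level sizes.\<close>

lemma weighted_basis_sums:
  fixes \<sigma> :: real
  assumes "\<sigma> \<in> {1, -1}"
  shows "(\<Sum>d\<le>N. real (card (basis_exponents d)) * \<sigma> ^ d) =
      \<sigma> ^ N * real (card (level l N)) + (1 - \<sigma>) * (\<Sum>d<N. real (card (level l d)) * \<sigma> ^ d)"
    and "(\<Sum>d\<le>N. real (card (basis_exponents d)) * real d) =
      real N * real (card (level l N)) - (\<Sum>d<N. real (card (level l d)))"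
proof -
  have t0: "real (card (basis_exponents 0)) = 1"
    using card_basis_exponents_diff[of 0] by simp
  have tS: "real (card (basis_exponents (Suc M))) = real (card (level l (Suc M))) - real (card (level l M))" if "Suc M \<le> N" for M
    using arg_cong[OF card_basis_exponents_diff[of "Suc M"], of real_of_int] that by simp
  have "M \<le> N \<Longrightarrow> (\<Sum>d\<le>M. real (card (basis_exponents d)) * \<sigma> ^ d) =
      \<sigma> ^ M * real (card (level l M)) + (1 - \<sigma>) * (\<Sum>d<M. real (card (level l d)) * \<sigma> ^ d)" for M
  proof (induction M)
    case (Suc M)
    then show ?case by (simp add: tS algebra_simps)
  qed (simp add: t0 card_level_0)
  then show "(\<Sum>d\<le>N. real (card (basis_exponents d)) * \<sigma> ^ d) =
      \<sigma> ^ N * real (card (level l N)) + (1 - \<sigma>) * (\<Sum>d<N. real (card (level l d)) * \<sigma> ^ d)" by simp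
  have "M \<le> N \<Longrightarrow> (\<Sum>d\<le>M. real (card (basis_exponents d)) * real d) =
      real M * real (card (level l M)) - (\<Sum>d<M. real (card (level l d)))" for M
  proof (induction M)
    case (Suc M)
    then show ?case by (simp add: tS algebra_simps)
  qed simp
  then show "(\<Sum>d\<le>N. real (card (basis_exponents d)) * real d) =
      real N * real (card (level l N)) - (\<Sum>d<N. real (card (level l d)))" by simp
qed

text \<open>As \<open>B\<close> has weight 2, each basis exponent of degree \<open>d\<close> counts
  \<open>(m - d) div 2 + 1 = (m - d)/2 + 3/4 + (-1)^(m-d)/4\<close> times. The parity term sums to a
  quarter of \<open>(-1)^m\<close> times the generating function of the levels at
  \<open>x = -1\<close>, a product of factors 1 (\<open>l i\<close> even) or 0 (\<open>l i\<close>
  odd). The product of the \<open>l i + 1\<close> is its value at \<open>x = 1\<close>; it enters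
  through the sum \<open>s1\<close> of the sizes of the lower levels.\<close>

theorem hilbert_function_formula:
  assumes m: "m \<ge> N"
  shows "real (card (basis_monomials m)) = (real m - real N + 1) / 2 * real (card (level l N)) +
    1 / 4 * ((\<Prod>i\<in>UNIV. real (l i) + 1) + (-1) ^ m * (if \<forall>i. even (l i) then 1 else 0))"
proof -
  let ?F = "real (card (level l N))" and ?t = "\<lambda>d. real (card (basis_exponents d))"
  define s1 where "s1 = (\<Sum>d<N. real (card (level l d)))"
  have floor: "real ((m - d) div 2 + 1) = (real m - real d) / 2 + 3 / 4 + (-1) ^ m * (-1) ^ d / 4" if "d \<le> N" for d
  proof -
    have d: "d \<le> m" using that m by simp
    have "real (e div 2 + 1) = real e / 2 + 3 / 4 + (-1) ^ e / 4" for e :: nat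
      by (cases "even e") (auto elim!: evenE oddE)
    moreover have "(-1 :: real) ^ (m - d) = (-1) ^ m * (-1) ^ d"
      using d by (simp add: minus_one_power_iff)
    ultimately show ?thesis using d by (simp add: of_nat_diff)
  qed
  have "real (card (basis_monomials m)) = (\<Sum>d\<le>N. ?t d * ((real m - real d) / 2 + 3 / 4 + (-1) ^ m * (-1) ^ d / 4))"
    unfolding card_basis_monomials(2)[OF m] by (rule sum.cong[OF refl]) (simp only: atMost_iff floor)
  also have "\<dots> = (real m / 2 + 3 / 4) * (\<Sum>d\<le>N. ?t d * 1 ^ d) - (\<Sum>d\<le>N. ?t d * real d) / 2
      + (-1) ^ m / 4 * (\<Sum>d\<le>N. ?t d * (-1) ^ d)"
    by (simp add: sum_distrib_left sum_divide_distrib algebra_simps add_divide_distrib diff_divide_distrib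
        sum.distrib sum_subtractf)
  also have "(\<Sum>d\<le>N. ?t d * 1 ^ d) = ?F" using weighted_basis_sums(1)[of 1] by simp
  also have "(\<Sum>d\<le>N. ?t d * real d) = real N * ?F - s1" using weighted_basis_sums(2)[of 1] by (simp add: s1_def)
  also have "(\<Sum>d\<le>N. ?t d * (-1) ^ d) = (\<Prod>i\<in>UNIV. \<Sum>j\<le>l i. (-1) ^ j)"
    using weighted_basis_sums(1)[of "-1"] level_half_sum[of "-1"] by (simp add: minus_one_power_iff)
  also have "(\<Prod>i\<in>UNIV. \<Sum>j\<le>l i. (-1 :: real) ^ j) = (if \<forall>i. even (l i) then 1 else 0)"
  proof -
    have alt: "(\<Sum>j\<le>k. (-1 :: real) ^ j) = (if even k then 1 else 0)" for k :: nat
      by (induction k) auto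
    show ?thesis unfolding alt by auto
  qed
  also have "s1 = ((\<Prod>i\<in>UNIV. real (l i) + 1) - ?F) / 2"
    using level_half_sum[of 1] by (simp add: s1_def add.commute)
  finally show ?thesis by (simp add: field_simps)
qed

end

theorem corollary5p5:
  fixes \<tau> :: complex and n :: "'i::finite \<Rightarrow> real" and p :: "'i \<Rightarrow> complex"
  assumes "Im \<tau> > 0"
    and "\<And>i. n i \<in> (\<lambda>x. x / 2) ` pos_nats"
    and "(\<Sum>i\<in>UNIV. n i) \<in> pos_nats"
    and "\<And>i j. i \<noteq> j \<Longrightarrow> p i - p j \<notin> lattice \<tau>"
  shows "is_hilbert_quasi_polynomial proj_weight (closure_ideal (log_free_ideal \<tau> n p))
    (\<lambda>m. (of_int m - (\<Sum>i\<in>UNIV. n i) + 1) / 2 * real (F_count n) +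
      1 / 4 * ((\<Prod>i\<in>UNIV. 2 * n i + 1) + (-1) powi m * (if \<forall>i. n i \<in> pos_nats then 1 else 0)))"
proof -
  have "\<forall>i. \<exists>l. l \<ge> 1 \<and> n i = real l / 2" using assms(2) by force
  from choice[OF this] obtain l where l: "\<And>i. l i \<ge> 1" "\<And>i. n i = real (l i) / 2" by blast
  obtain N where N: "(\<Sum>i\<in>UNIV. n i) = real N" using assms(3) by auto
  have "real (sum l UNIV) = real (2 * N)" using N by (simp add: l(2) flip: sum_divide_distrib)
  then have sum_l: "sum l UNIV = 2 * N" by (simp only: of_nat_eq_iff)
  interpret lefschetz l N by unfold_locales (rule sum_l)
  let ?I = "log_free_ideal \<tau> n p" and ?q = "potential_coeff \<tau> n p"
  have fl: "nat \<lfloor>2 * n i\<rfloor> = l i" for i by (simp add: l(2))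
  have I: "ideal ?I cpoly_ring" unfolding log_free_ideal_def by (rule ideal_genideal_cpoly)
  have e: "(\<Sum>i\<in>UNIV. Var (VarA i)) \<in> ?I" unfolding log_free_ideal_def by (rule genideal_cpoly_self) simp
  have F: "log_obstruction (?q i) (l i) \<in> ?I" for i
    unfolding log_free_ideal_def fl by (rule genideal_cpoly_self) simp
  note WZ = laurent_expansion_wp_wzeta[where p = p and \<tau> = \<tau>, OF assms(1,4)]
  have lead: "\<exists>\<gamma> f. \<gamma> \<noteq> 0 \<and> f \<in> ?I \<and> f - Const \<gamma> * aff_mono ((\<lambda>_. 0)(i := Suc (l i))) 0 \<in> subtop (Suc (l i))" for i
  proof -
    interpret singular_point "?q i" i "l i"
    proof
      have "Const (fls_nth (laurent_expansion (\<lambda>z. wzeta \<tau> (z - p j)) (p i)) (-1)) * Var (VarA j) =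
          (if j = i then Var (VarA i) else 0)" for j
        using WZ(2)[of "-1" j i] by (simp add: Const_1 Const_0)
      moreover have "fls_nth (laurent_expansion (\<lambda>z. wp \<tau> (z - p j)) (p i)) (-1) = 0" for j
        using WZ(1)[of "-1" j i] by simp
      ultimately show "?q i (-1) = Var (VarA i)"
        by (simp add: potential_coeff_def Const_0)
      fix s :: int assume "s \<ge> 0"
      have "?q i s - (if s = 0 then Var VarB else 0) =
        (\<Sum>j\<in>UNIV. Const (of_real (n j * (n j + 1)) * fls_nth (laurent_expansion (\<lambda>z. wp \<tau> (z - p j)) (p i)) s)) +
        (\<Sum>j\<in>UNIV. Const (fls_nth (laurent_expansion (\<lambda>z. wzeta \<tau> (z - p j)) (p i)) s) * Var (VarA j))"
        by (simp add: potential_coeff_def)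
      also have "\<dots> \<in> fil 1"
        by (intro cpoly_vs.subspace_add[OF subspace_fil] cpoly_vs.subspace_sum[OF subspace_fil]
            cpoly_vs.subspace_scale[OF subspace_fil] Const_fil Var_VarA_fil)
      finally show "?q i s - (if s = 0 then Var VarB else 0) \<in> fil 1" .
    qed
    show ?thesis using log_obstruction_leading F[of i] by blast
  qed
  have indep: "g = 0" if g: "g \<in> supported (basis_monomials m)" "g \<in> ?I" for g m
  proof (rule basis_independent[OF _ g(1)])
    fix k assume k: "k \<in> level l N"
    then have kl: "\<And>i. k i \<le> l i" "sum l UNIV = 2 * sum k UNIV" using sum_l by (auto simp: level_def nbox_def)
    have nl: "2 * n i = real (l i)" for i by (simp add: l(2))
    obtain \<alpha> where \<alpha>: "\<And>i. fps_nth (\<alpha> i) 0 = of_nat (l i) - 2 * of_nat (k i)"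
      "fls_eval.poly_eval (branch \<alpha>) (\<Sum>i\<in>UNIV. Var (VarA i)) = 0"
      "\<And>i. fls_eval.poly_eval (branch \<alpha>) (log_obstruction (?q i) (l i)) = 0"
      by (rule exists_branch[OF assms(1,4) nl kl], assumption, rule that) assumption+
    \<comment> \<open>Evaluation along a branch is a ring homomorphism, so its kernel contains the
      whole log-free ideal as soon as it contains the generators.\<close>
    have "ideal {f. fls_eval.poly_eval (branch \<alpha>) f = 0} cpoly_ring"
      by (rule ideal_cpolyI) (auto simp: fls_eval.poly_eval_add fls_eval.poly_eval_mult)
    then have "?I \<subseteq> {f. fls_eval.poly_eval (branch \<alpha>) f = 0}"
      unfolding log_free_ideal_def fl by (rule genideal_cpoly_subset) (use \<alpha>(2,3) in auto)
    then show "\<exists>\<alpha>. (\<forall>i. fps_nth (\<alpha> i) 0 = of_nat (l i) - 2 * of_nat (k i)) \<and> fls_eval.poly_eval (branch \<alpha>) g = 0"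
      using g(2) \<alpha>(1) by blast
  qed
  have dim: "graded_piece_dim proj_weight (closure_ideal ?I) m (card (basis_monomials m))" if m: "m \<ge> N" for m
  proof (rule graded_piece_dim_closure[OF I card_basis_monomials(1)[OF m]])
    show "aff_deg t \<le> m" if "t \<in> basis_monomials m" for t
      using that by (auto simp: basis_monomials_def)
    show "\<exists>g\<in>supported (basis_monomials m). f - g \<in> ?I" if "f \<in> fil m" for f
      by (rule span_modulo_ideal[OF I e lead that])
    show "g = 0" if "g \<in> supported (basis_monomials m)" "g \<in> ?I" for g by (rule indep[OF that])
  qed
  have "(\<Sum>i\<in>UNIV. real (k i)) = real N \<longleftrightarrow> sum k UNIV = N" for k :: "'i \<Rightarrow> nat"
    by (simp flip: of_nat_sum)
  then have Fc: "F_count n = card (level l N)"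
    unfolding F_count_def N by (simp add: l(2) level_def nbox_def conj_commute)
  have nat_iff: "n i \<in> pos_nats \<longleftrightarrow> even (l i)" for i
  proof
    assume "n i \<in> pos_nats"
    then obtain j where "n i = real j" by auto
    then have "real (l i) = real (2 * j)" by (simp add: l(2))
    then have "l i = 2 * j" by (simp only: of_nat_eq_iff)
    then show "even (l i)" by simp
  next
    assume "even (l i)"
    then obtain j where j: "l i = 2 * j" by (auto elim: evenE)
    then have "n i = real j" "j \<ge> 1" using l[of i] by auto
    then show "n i \<in> pos_nats" by simp
  qed
  define P where "P = (\<Prod>i\<in>UNIV. 2 * n i + 1)"
  define \<delta> where "\<delta> = (if \<forall>i. n i \<in> pos_nats then 1 else 0 :: real)"
  define h where "h m = (of_int m - real N + 1) / 2 * real (F_count n) + 1 / 4 * (P + (-1) powi m * \<delta>)" for m :: int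
  have sgn: "(-1 :: real) powi m = (if even m then 1 else -1)" for m
    by (simp add: power_int_minus_left)
  have "quasi_polynomial h"
    unfolding quasi_polynomial_def
  proof (intro exI conjI allI)
    show "(2 :: int) > 0" by simp
    fix m
    \<comment> \<open>Two linear polynomials, one for each parity of \<open>m\<close>; they differ
      only in the sign of \<open>\<delta>\<close>.\<close>
    show "h m = poly ((\<lambda>r. [: (1 - real N) / 2 * real (F_count n) + (P + (if r = 0 then \<delta> else - \<delta>)) / 4, real (F_count n) / 2 :]) (m mod 2)) (of_int m)"
      by (cases "even m") (simp_all add: h_def sgn even_iff_mod_2_eq_zero odd_iff_mod_2_eq_one field_simps)
  qed
  moreover have "\<exists>d. graded_piece_dim proj_weight (closure_ideal ?I) m d \<and> h (int m) = real d" if "m \<ge> N" for m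
  proof (intro exI conjI)
    show "graded_piece_dim proj_weight (closure_ideal ?I) m (card (basis_monomials m))" by (rule dim[OF that])
    have "P = (\<Prod>i\<in>UNIV. real (l i) + 1)" by (simp add: P_def l(2))
    moreover have "\<delta> = (if \<forall>i. even (l i) then 1 else 0)" by (simp only: \<delta>_def nat_iff)
    ultimately show "h (int m) = real (card (basis_monomials m))"
      unfolding h_def hilbert_function_formula[OF that] Fc by simp
  qed
  ultimately have "is_hilbert_quasi_polynomial proj_weight (closure_ideal ?I) h"
    unfolding is_hilbert_quasi_polynomial_def by blast
  then show ?thesis unfolding h_def[abs_def] P_def \<delta>_def N .
qed

end
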